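(* Let $f_1,\dots,f_n:\mathbb{R}^d\to\mathbb{R}$ be differentiable with $\|\nabla f_i(x)-\nabla f_i(y)\|\le \ell\|x-y\|$ for all $x,y$ ($\ell>0$), and let $f=\frac1n\sum_{i=1}^n f_i$ satisfy $f^\ast=\inf f>-\infty$. Let the communication graph be undirected and connected. Let $\mathcal{C}:\mathbb{R}^d\to\mathbb{R}^d$ be a (possibly random) globally-bounded compressor: for some $r>0$, $C>0$, $\delta\in(0,1]$, $\mathbb E_{\mathcal C}\big[\big\|\frac{\mathcal{C}(x)}{r}-x\big\|^2\big]\le(1-\delta)\|x\|^2+C$ for all $x\in\mathbb R^d$. Let $\{x_{i,k}\}$ be generated by the Unified Compression Algorithm (see context) with $$\alpha\in(0,\hat\kappa_0'),\quad\beta=\tau_1\gamma,\quad\gamma>\kappa_2,\quad\omega\in(0,1/r],\quad s_0\ge\max_i\|x_{i,0}\|_p,\quad s_k=s_0\varepsilon^k,\quad\tau_1\ge\kappa_1,\quad\varepsilon\in(0,1),$$ where $p\ge1$ and the constants are those given in the context. Then, with $\bar x_k=\frac1n\sum_ix_{i,k}$, $$\frac1T\sum_{k=0}^{T-1}\mathbb E_{\mathcal C}\Big[\|\nabla f(\bar x_k)\|^2+\frac1n\sum_{i=1}^n\|x_{i,k}-\bar x_k\|^2\Big]=\mathcal O\Big(\frac1T\Big),\qquad\mathbb E_{\mathcal C}[f(\bar x_T)-f^\ast]=\mathcal O(1),$$ where the constants hidden in $\mathcal O(\cdot)$ are independent of $T$.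
   Context: Network: $n\ge2$ agents, weighted undirected connected graph with symmetric nonnegative adjacency matrix $A=[A_{ij}]$, $A_{ij}>0$ iff $(j,i)$ is an edge; Laplacian $L=\mathrm{diag}(\sum_jA_{1j},\dots,\sum_j A_{nj})-A=[L_{ij}]$. $\rho(L)$ is the spectral radius, $\rho_2(L)$ the smallest positive eigenvalue. $\|\cdot\|=\|\cdot\|_2$. $\mathbb E_{\mathcal C}$ is the expectation over the internal randomness of the compressor; the randomness of each call of $\mathcal C$ is independent of the past, so that the compressor inequality holds conditionally on the past. Unified Compression Algorithm: positive parameters $\alpha,\beta,\gamma,\omega$, positive sequence $\{s_k\}$; $x_{i,0}\in\mathbb{R}^d$ arbitrary, $v_{i,0}=\hat x_{i,-1}=y_{i,-1}=\mathbf 0_d$. For $k=0,1,\dots$ and each $i$: $q_{i,k}=\mathcal{C}((x_{i,k}-\hat x_{i,k-1})/s_k)$, $\hat x_{i,k}=\hat x_{i,k-1}+\omega s_kq_{i,k}$, $y_{i,k}=y_{i,k-1}+\omega s_k\sum_{j=1}^nL_{ij}q_{j,k}$, $x_{i,k+1}=x_{i,k}-\alpha(\beta y_{i,k}+\gamma v_{i,k}+\nabla f_i(x_{i,k}))$, $v_{i,k+1}=v_{i,k}+\alpha\gamma y_{i,k}$. Constants: $\kappa_1=4/\rho_2(L)$; $\kappa_2=\max\{2+2\ell^2,\ 5/\rho_2(L),\ (16\ell^2(\kappa_1+1)^2/\rho_2(L))^{1/3},\ 2\sqrt2\,\ell/\rho_2(L)\}$; $\varepsilon_9=\omega r\delta/2$;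 $\varepsilon_{10}=(1-2\varepsilon_9)(1+\varepsilon_9^{-1})$; $\varepsilon_{12}=(\varepsilon_9+2\varepsilon_9^2)/2$; $\varphi_1=\frac12(\rho_2(L)\beta-(3\gamma+2+2\ell^2))$; $\varphi_2'=(3+4\varepsilon_{10})\rho^2(L)\beta^2-\rho_2(L)\beta\gamma+(\rho(L)+2)\gamma^2+1+(\frac52+4\varepsilon_{10})\ell^2$; $\varphi_3=\frac\gamma2-\frac52\rho_2^{-1}(L)$; $\varphi_4'=(2+4\varepsilon_{10})\rho(L)\gamma^2+\frac12\rho(L)$; $\varphi_5=\frac18-\frac{(\beta+\gamma)^2}{\gamma^5}\rho_2^{-1}(L)\ell^2-\frac1{2\gamma^2}\rho_2^{-2}(L)\ell^2$; $\varphi_6=\frac{\beta+\gamma}{2\gamma^3}\rho_2^{-1}(L)\ell^2+\frac1{2\gamma^2}\rho_2^{-2}(L)\ell^2+\frac12\rho_2^{-2}(L)\ell^2+\frac{\ell^2}2+\frac\ell2$; $\varphi_7=(\rho(L)+1)\gamma+\frac12\rho(L)\beta$; $\varphi_8'=(3+4\varepsilon_{10})\rho^2(L)\beta^2+(\rho(L)-2\rho_2(L))\beta\gamma+(\rho(L)+2)\gamma^2+1$; $\hat\kappa_0'=\min\Big\{\frac{\varphi_1}{\varphi_2'},\frac{\varphi_3}{\varphi_4'},\frac{\varphi_5}{\varphi_6},\frac{\sqrt{\varphi_7^2+8\varepsilon_{12}\varphi_8'}-\varphi_7}{2\varphi_8'}\Big\}$. *)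

theory Defs
  imports "HOL-Probability.Probability"
begin

subsection \<open>Gradients and norms\<close>

text \<open>Meaningful only where \<open>F\<close> is differentiable.\<close>

definition gradient :: "('a::real_inner \<Rightarrow> real) \<Rightarrow> 'a \<Rightarrow> 'a" where
  "gradient F x = (THE D. GDERIV F x :> D)"

text \<open>The exponent ranges over \<open>[1, \<infinity>]\<close>, so that the maximum norm is included.\<close>

definition lp_norm :: "ennreal \<Rightarrow> real ^ 'd \<Rightarrow> real" where
  "lp_norm p x =
     (if p = \<infinity> then (MAX j. \<bar>x $ j\<bar>)
      else (\<Sum>j\<in>UNIV. \<bar>x $ j\<bar> powr enn2real p) powr (1 / enn2real p))"

definition average :: "('n::finite \<Rightarrow> 'a::real_vector) \<Rightarrow> 'a" where
  "average z = (1 / real CARD('n)) *\<^sub>R (\<Sum>i\<in>UNIV. z i)"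

subsection \<open>Communication graph\<close>

text \<open>
  The agents are the elements of \<open>'n\<close>. Self-loops are not excluded; they do not affect
  the Laplacian.
\<close>

definition graph_edges :: "real ^ 'n ^ 'n \<Rightarrow> ('n \<times> 'n) set" where
  "graph_edges A = {(j, i). A $ i $ j > 0}"

definition undirected_weights :: "real ^ 'n ^ 'n \<Rightarrow> bool" where
  "undirected_weights A \<longleftrightarrow> transpose A = A \<and> (\<forall>i j. 0 \<le> A $ i $ j)"

definition connected_graph :: "real ^ 'n ^ 'n \<Rightarrow> bool" where
  "connected_graph A \<longleftrightarrow> (\<forall>i j. (i, j) \<in> (graph_edges A)\<^sup>*)"

definition laplacian :: "real ^ 'n ^ 'n \<Rightarrow> real ^ 'n ^ 'n" where
  "laplacian A = (\<chi> i j. (if i = j then (\<Sum>m\<in>UNIV. A $ i $ m) else 0) - A $ i $ j)"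

definition eigenvalues :: "real ^ 'n ^ 'n \<Rightarrow> complex set" where
  "eigenvalues B =
     {c. \<exists>u :: complex ^ 'n. u \<noteq> 0 \<and> (\<chi> i j. complex_of_real (B $ i $ j)) *v u = c *s u}"

definition spectral_radius :: "real ^ 'n ^ 'n \<Rightarrow> real" where
  "spectral_radius B = Max (cmod ` eigenvalues B)"

definition least_pos_eigenvalue :: "real ^ 'n ^ 'n \<Rightarrow> real" where
  "least_pos_eigenvalue B = Min {c. 0 < c \<and> complex_of_real c \<in> eigenvalues B}"

subsection \<open>Compressor\<close>

text \<open>
  A random map \<open>\<real>\<^sup>d \<rightarrow> \<real>\<^sup>d\<close> is a map \<open>Cmp\<close> with an additional argument, the seed, which is
  drawn from the probability space \<open>D\<close>. A deterministic compressor ignores the seed.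
\<close>

definition globally_bounded_compressor ::
  "'s measure \<Rightarrow> ('s \<Rightarrow> real ^ 'd \<Rightarrow> real ^ 'd) \<Rightarrow> real \<Rightarrow> real \<Rightarrow> real \<Rightarrow> bool" where
  "globally_bounded_compressor D Cmp r \<delta> C \<longleftrightarrow>
     prob_space D \<and>
     (\<lambda>(\<zeta>, x). Cmp \<zeta> x) \<in> borel_measurable (D \<Otimes>\<^sub>M borel) \<and>
     (\<forall>x. integrable D (\<lambda>\<zeta>. (norm ((1 / r) *\<^sub>R Cmp \<zeta> x - x))\<^sup>2) \<and>
          (\<integral>\<zeta>. (norm ((1 / r) *\<^sub>R Cmp \<zeta> x - x))\<^sup>2 \<partial>D) \<le> (1 - \<delta>) * (norm x)\<^sup>2 + C)"

definition past_events :: "'w measure \<Rightarrow> 's measure \<Rightarrow> ('n \<Rightarrow> nat \<Rightarrow> 'w \<Rightarrow> 's) \<Rightarrow> nat \<Rightarrow> 'w set set" where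
  "past_events M D \<xi> k =
     sigma_sets (space M) {\<xi> j m -` S \<inter> space M | j m S. m < k \<and> S \<in> sets D}"

text \<open>
  \<open>\<xi> i k\<close> is the seed of the call made by agent \<open>i\<close> in iteration \<open>k\<close>. Seeds used by different
  agents in the same iteration may be dependent.
\<close>

definition compressor_seeds :: "'w measure \<Rightarrow> 's measure \<Rightarrow> ('n \<Rightarrow> nat \<Rightarrow> 'w \<Rightarrow> 's) \<Rightarrow> bool" where
  "compressor_seeds M D \<xi> \<longleftrightarrow>
     (\<forall>i k. \<xi> i k \<in> measurable M D \<and> distr M D (\<xi> i k) = D \<and>
            prob_space.indep_set M {\<xi> i k -` S \<inter> space M | S. S \<in> sets D} (past_events M D \<xi> k))"

subsection \<open>Unified Compression Algorithm\<close>

text \<open>\<open>prev z k\<close> is \<open>z\<^bsub>k-1\<^esub>\<close> with the convention \<open>z\<^bsub>-1\<^esub> = 0\<close>.\<close>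

definition prev :: "(nat \<Rightarrow> 'a::zero) \<Rightarrow> nat \<Rightarrow> 'a" where
  "prev z k = (case k of 0 \<Rightarrow> 0 | Suc m \<Rightarrow> z m)"

text \<open>
  A single run: \<open>c i k\<close> is the map realised by the compressor when agent \<open>i\<close> calls it in
  iteration \<open>k\<close>, and \<open>g i\<close> is the gradient of the cost of agent \<open>i\<close>.
\<close>

definition unified_compression_run ::
  "real ^ 'n ^ 'n \<Rightarrow> ('n \<Rightarrow> real ^ 'd \<Rightarrow> real ^ 'd) \<Rightarrow>
   real \<Rightarrow> real \<Rightarrow> real \<Rightarrow> real \<Rightarrow> (nat \<Rightarrow> real) \<Rightarrow>
   ('n \<Rightarrow> nat \<Rightarrow> real ^ 'd \<Rightarrow> real ^ 'd) \<Rightarrow> ('n \<Rightarrow> real ^ 'd) \<Rightarrow>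
   ('n \<Rightarrow> nat \<Rightarrow> real ^ 'd) \<Rightarrow> ('n \<Rightarrow> nat \<Rightarrow> real ^ 'd) \<Rightarrow> ('n \<Rightarrow> nat \<Rightarrow> real ^ 'd) \<Rightarrow>
   ('n \<Rightarrow> nat \<Rightarrow> real ^ 'd) \<Rightarrow> ('n \<Rightarrow> nat \<Rightarrow> real ^ 'd) \<Rightarrow> bool" where
  "unified_compression_run L g \<alpha> \<beta> \<gamma> \<omega> s c x0 x v xh y q \<longleftrightarrow>
     (\<forall>i. x i 0 = x0 i \<and> v i 0 = 0) \<and>
     (\<forall>i k.
        q i k = c i k ((1 / s k) *\<^sub>R (x i k - prev (xh i) k)) \<and>
        xh i k = prev (xh i) k + (\<omega> * s k) *\<^sub>R q i k \<and>
        y i k = prev (y i) k + (\<omega> * s k) *\<^sub>R (\<Sum>j\<in>UNIV. L $ i $ j *\<^sub>R q j k) \<and>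
        x i (Suc k) = x i k - \<alpha> *\<^sub>R (\<beta> *\<^sub>R y i k + \<gamma> *\<^sub>R v i k + g i (x i k)) \<and>
        v i (Suc k) = v i k + (\<alpha> * \<gamma>) *\<^sub>R y i k)"

subsection \<open>Constants\<close>

text \<open>Throughout, \<open>\<rho>\<close> and \<open>\<rho>2\<close> stand for the spectral radius and the least positive eigenvalue
  of the Laplacian.\<close>

definition kappa1 :: "real \<Rightarrow> real" where
  "kappa1 \<rho>2 = 4 / \<rho>2"

definition kappa2 :: "real \<Rightarrow> real \<Rightarrow> real" where
  "kappa2 \<rho>2 l = Max {2 + 2 * l\<^sup>2, 5 / \<rho>2, root 3 (16 * l\<^sup>2 * (kappa1 \<rho>2 + 1)\<^sup>2 / \<rho>2),
                      2 * sqrt 2 * l / \<rho>2}"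

definition eps9 :: "real \<Rightarrow> real \<Rightarrow> real \<Rightarrow> real" where
  "eps9 \<omega> r \<delta> = \<omega> * r * \<delta> / 2"

definition eps10 :: "real \<Rightarrow> real \<Rightarrow> real \<Rightarrow> real" where
  "eps10 \<omega> r \<delta> = (1 - 2 * eps9 \<omega> r \<delta>) * (1 + 1 / eps9 \<omega> r \<delta>)"

definition eps12 :: "real \<Rightarrow> real \<Rightarrow> real \<Rightarrow> real" where
  "eps12 \<omega> r \<delta> = (eps9 \<omega> r \<delta> + 2 * (eps9 \<omega> r \<delta>)\<^sup>2) / 2"

definition phi1 :: "real \<Rightarrow> real \<Rightarrow> real \<Rightarrow> real \<Rightarrow> real" where
  "phi1 \<rho>2 l \<beta> \<gamma> = (1 / 2) * (\<rho>2 * \<beta> - (3 * \<gamma> + 2 + 2 * l\<^sup>2))"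

definition phi2' :: "real \<Rightarrow> real \<Rightarrow> real \<Rightarrow> real \<Rightarrow> real \<Rightarrow> real \<Rightarrow> real" where
  "phi2' \<rho> \<rho>2 l \<beta> \<gamma> e10 =
     (3 + 4 * e10) * \<rho>\<^sup>2 * \<beta>\<^sup>2 - \<rho>2 * \<beta> * \<gamma> + (\<rho> + 2) * \<gamma>\<^sup>2 + 1 + (5 / 2 + 4 * e10) * l\<^sup>2"

definition phi3 :: "real \<Rightarrow> real \<Rightarrow> real" where
  "phi3 \<rho>2 \<gamma> = \<gamma> / 2 - (5 / 2) * (1 / \<rho>2)"

definition phi4' :: "real \<Rightarrow> real \<Rightarrow> real \<Rightarrow> real" where
  "phi4' \<rho> \<gamma> e10 = (2 + 4 * e10) * \<rho> * \<gamma>\<^sup>2 + (1 / 2) * \<rho>"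

definition phi5 :: "real \<Rightarrow> real \<Rightarrow> real \<Rightarrow> real \<Rightarrow> real" where
  "phi5 \<rho>2 l \<beta> \<gamma> =
     1 / 8 - (\<beta> + \<gamma>)\<^sup>2 / \<gamma> ^ 5 * (1 / \<rho>2) * l\<^sup>2 - 1 / (2 * \<gamma>\<^sup>2) * (1 / \<rho>2\<^sup>2) * l\<^sup>2"

definition phi6 :: "real \<Rightarrow> real \<Rightarrow> real \<Rightarrow> real \<Rightarrow> real" where
  "phi6 \<rho>2 l \<beta> \<gamma> =
     (\<beta> + \<gamma>) / (2 * \<gamma> ^ 3) * (1 / \<rho>2) * l\<^sup>2 + 1 / (2 * \<gamma>\<^sup>2) * (1 / \<rho>2\<^sup>2) * l\<^sup>2
     + (1 / 2) * (1 / \<rho>2\<^sup>2) * l\<^sup>2 + l\<^sup>2 / 2 + l / 2"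

definition phi7 :: "real \<Rightarrow> real \<Rightarrow> real \<Rightarrow> real" where
  "phi7 \<rho> \<beta> \<gamma> = (\<rho> + 1) * \<gamma> + (1 / 2) * \<rho> * \<beta>"

definition phi8' :: "real \<Rightarrow> real \<Rightarrow> real \<Rightarrow> real \<Rightarrow> real \<Rightarrow> real" where
  "phi8' \<rho> \<rho>2 \<beta> \<gamma> e10 =
     (3 + 4 * e10) * \<rho>\<^sup>2 * \<beta>\<^sup>2 + (\<rho> - 2 * \<rho>2) * \<beta> * \<gamma> + (\<rho> + 2) * \<gamma>\<^sup>2 + 1"

definition hat_kappa0' :: "real \<Rightarrow> real \<Rightarrow> real \<Rightarrow> real \<Rightarrow> real \<Rightarrow> real \<Rightarrow> real \<Rightarrow> real \<Rightarrow> real" where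
  "hat_kappa0' \<rho> \<rho>2 l \<beta> \<gamma> \<omega> r \<delta> =
     (let e10 = eps10 \<omega> r \<delta>; e12 = eps12 \<omega> r \<delta>; p7 = phi7 \<rho> \<beta> \<gamma>; p8 = phi8' \<rho> \<rho>2 \<beta> \<gamma> e10
      in Min {phi1 \<rho>2 l \<beta> \<gamma> / phi2' \<rho> \<rho>2 l \<beta> \<gamma> e10,
              phi3 \<rho>2 \<gamma> / phi4' \<rho> \<gamma> e10,
              phi5 \<rho>2 l \<beta> \<gamma> / phi6 \<rho>2 l \<beta> \<gamma>,
              (sqrt (p7\<^sup>2 + 8 * e12 * p8) - p7) / (2 * p8)})"

end

theory Submission
  imports Defs
begin

text \<open>
  Stack the agents and split every stacked vector into its average and its deviation from it.
  Let \<open>P\<close> be the pseudo-inverse of the Laplacian, \<open>z\<close> the deviation of \<open>x\<^bsub>k\<^esub>\<close>, and \<open>u\<close> the sum of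
  \<open>v\<^bsub>k\<^esub>\<close> and \<open>1 / \<gamma>\<close> times the deviation of the local gradients taken at the average. The function
  \<open>\<parallel>z\<parallel>\<^sup>2 / 2 + (\<beta> + \<gamma>) / (2 * \<gamma>) * \<langle>u, P u\<rangle> + \<langle>z, P u\<rangle> + n * (f - inf f) + \<parallel>x\<^bsub>k\<^esub> - xh\<^bsub>k\<^esub>\<parallel>\<^sup>2\<close>,
  where \<open>x\<^bsub>k\<^esub> - xh\<^bsub>k\<^esub>\<close> is the error after compression, decreases in expectation by a multiple of
  \<open>\<parallel>z\<parallel>\<^sup>2\<close> plus the squared average of the local gradients, up to a term of order \<open>(s\<^bsub>k+1\<^esub>)\<^sup>2\<close>. As the
  scales \<open>s\<^bsub>k\<^esub>\<close> decay geometrically, these terms are summable, so the total decrease is bounded.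
  The upper bound on \<open>\<alpha>\<close> makes the coefficients of \<open>\<parallel>z\<parallel>\<^sup>2\<close>, \<open>\<langle>u, P u\<rangle>\<close>, the squared
  average gradient and the squared compression error negative.
\<close>

section \<open>Inequalities in inner product spaces\<close>

text \<open>The compressor may be biased, so only the second moment of its error is available. The
  Lyapunov step is therefore a deterministic inequality for an arbitrary estimate \<open>Xh\<close>,
  with \<open>Xh - X\<close> as perturbation of a primal-dual gradient step; expectation enters only
  where compression contracts the error. Moving from \<open>X\<close> to \<open>X'\<close> changes
  the error by Young's inequality with weight \<open>e9\<close>, and compressing contracts its
  square by 1 - 2 * \<open>e9\<close>. Together they leave the factor 1 - 2 * \<open>e12\<close> on
  the old error and return \<open>e10\<close> times the squared movement of \<open>X\<close>; hence
  \<open>e10\<close> in \<open>phi2'\<close>, \<open>phi4'\<close> and \<open>phi8'\<close>. The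
  cross term between z and P u is essential: the two squares alone give no negative multiple of the
  dual form, whereas the cross term yields -\<gamma> times it to first order in \<alpha>, at the
  price of \<gamma> times the squared norm of z. Consensus pays that price through \<rho>2 \<beta>
  >= 4 \<gamma>, which \<open>kappa1\<close> encodes; the first two entries of \<open>kappa2\<close>
  then make \<open>phi1\<close> and \<open>phi3\<close> positive.\<close>

lemma neg_inner_le: "- inner x y \<le> t / 2 * (norm x)\<^sup>2 + 1 / (2 * t) * (norm y)\<^sup>2" if "0 < t" for x y :: "'a::real_inner"
proof -
  have "0 \<le> (norm (t *\<^sub>R x + y))\<^sup>2" by simp
  also have "\<dots> = t\<^sup>2 * (norm x)\<^sup>2 + 2 * t * inner x y + (norm y)\<^sup>2"
    unfolding power2_norm_eq_inner
    by (simp add: inner_simps inner_commute[of y x]) (simp add: algebra_simps power2_eq_square)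
  finally show ?thesis using that by (simp add: field_simps power2_eq_square)
qed

lemma inner_le: "inner x y \<le> t / 2 * (norm x)\<^sup>2 + 1 / (2 * t) * (norm y)\<^sup>2" if "0 < t" for x y :: "'a::real_inner"
  using neg_inner_le[OF that, of "- x" y] by simp

lemma norm_add_sq: "(norm (x + y))\<^sup>2 \<le> 2 * (norm x)\<^sup>2 + 2 * (norm y)\<^sup>2" for x y :: "'a::real_inner"
  using inner_le[of 1 x y] by (simp add: power2_norm_eq_inner inner_simps inner_commute)

text \<open>The unequal weights keep the first two coefficients below those of an even split into three.\<close>

lemma norm_add3_sq:
  "(norm (x + y + d))\<^sup>2 \<le> 5 / 2 * (norm x)\<^sup>2 + 5 / 2 * (norm y)\<^sup>2 + 5 * (norm d)\<^sup>2" for x y d :: "'a::real_inner"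
  using inner_le[of 1 x y] inner_le[of "1/2" x d] inner_le[of "1/2" y d]
  by (simp add: power2_norm_eq_inner inner_simps inner_commute)

lemma norm_add4_sq:
  "(norm (x + y + d + e))\<^sup>2 \<le> 4 * ((norm x)\<^sup>2 + (norm y)\<^sup>2 + (norm d)\<^sup>2 + (norm e)\<^sup>2)" for x y d e :: "'a::real_inner"
  using norm_add_sq[of "x + y" "d + e"] norm_add_sq[of x y] norm_add_sq[of d e] by (simp add: add.assoc)

lemma norm_sq_convex:
  fixes x y :: "'a::real_inner"
  assumes "0 \<le> t" "t \<le> 1"
  shows "(norm ((1 - t) *\<^sub>R x + t *\<^sub>R y))\<^sup>2 \<le> (1 - t) * (norm x)\<^sup>2 + t * (norm y)\<^sup>2"
proof -
  have "(1 - t) * (norm x)\<^sup>2 + t * (norm y)\<^sup>2 - (norm ((1 - t) *\<^sub>R x + t *\<^sub>R y))\<^sup>2 = t * (1 - t) * (norm (x - y))\<^sup>2"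
    unfolding power2_norm_eq_inner
    by (simp add: inner_simps inner_commute[of y x]) (simp add: algebra_simps)
  moreover have "0 \<le> t * (1 - t) * (norm (x - y))\<^sup>2" using assms by simp
  ultimately show ?thesis by linarith
qed

lemma norm_sq_vec: "(norm X)\<^sup>2 = (\<Sum>i\<in>UNIV. (norm (X $ i))\<^sup>2)" for X :: "'a::real_inner ^ 'n"
  by (simp add: power2_norm_eq_inner inner_vec_def)

lemma norm_diff_sq_le:
  fixes x y :: "'a::real_inner"
  assumes "0 < t"
  shows "(norm (x - y))\<^sup>2 \<le> (1 + t) * (norm x)\<^sup>2 + (1 + 1 / t) * (norm y)\<^sup>2"
proof -
  have "0 \<le> (norm (t *\<^sub>R x + y))\<^sup>2 / t" using assms by simp
  also have "\<dots> = t * (norm x)\<^sup>2 + 2 * inner x y + 1 / t * (norm y)\<^sup>2"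
    unfolding power2_norm_eq_inner using assms
    by (simp add: inner_simps inner_commute[of y x]) (simp add: field_simps)
  finally show ?thesis
    unfolding power2_norm_eq_inner by (simp add: inner_simps inner_commute[of y x] algebra_simps)
qed

section \<open>Spectrum of the Laplacian\<close>

text \<open>Discriminant argument for a form that need not be definite. Positivity is asked for on
  \<open>S\<close> only, since the shifted operator to which it is applied is known to be
  nonnegative only where the Rayleigh quotient was minimised.\<close>

lemma semidefinite_Cauchy_Schwarz:
  fixes T :: "'a::real_inner \<Rightarrow> 'a"
  assumes lin: "linear T" and sym: "\<And>x y. inner (T x) y = inner x (T y)"
    and S: "subspace S" and psd: "\<And>x. x \<in> S \<Longrightarrow> 0 \<le> inner x (T x)"
    and xy: "x \<in> S" "y \<in> S"
  shows "(inner x (T y))\<^sup>2 \<le> inner x (T x) * inner y (T y)"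
proof -
  let ?a = "inner x (T x)" and ?b = "inner x (T y)" and ?c = "inner y (T y)"
  have quad: "0 \<le> ?a + 2 * t * ?b + t\<^sup>2 * ?c" for t
  proof -
    have "x + t *\<^sub>R y \<in> S" using S xy by (simp add: subspace_add subspace_scale)
    then have "0 \<le> inner (x + t *\<^sub>R y) (T (x + t *\<^sub>R y))" by (rule psd)
    moreover have "inner y (T x) = ?b" using sym[of x y] by (simp add: inner_commute)
    ultimately show ?thesis
      by (simp add: linear_add[OF lin] linear_scale[OF lin] inner_simps algebra_simps power2_eq_square)
  qed
  have a: "0 \<le> ?a" and c: "0 \<le> ?c" using psd xy by auto
  show ?thesis
  proof (cases "?c = 0")
    case True
    have "?b = 0"
    proof (rule ccontr)
      assume "?b \<noteq> 0"
      \<comment> \<open>With vanishing quadratic coefficient the polynomial is affine in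
        \<open>t\<close>; this \<open>t\<close> gives it the value -1.\<close>
      then show False using quad[of "- (?a + 1) / (2 * ?b)"] a True by (simp add: field_simps)
    qed
    then show ?thesis using True by simp
  next
    case False
    then show ?thesis using quad[of "- ?b / ?c"] c
      by (simp add: field_simps power2_eq_square)
  qed
qed

text \<open>The minimiser \<open>e\<close> of the Rayleigh quotient on the unit sphere of
  \<open>S\<close> is an eigenvector without any calculus: the form of \<open>T - m\<close> is
  nonnegative on \<open>S\<close> and vanishes at \<open>e\<close>, so Cauchy-Schwarz for that form
  against the residual \<open>T e - m *\<^sub>R e\<close> forces the residual to be zero. Applied to
  an operator and to its negative, it gives both ends of the spectrum on \<open>S\<close>.\<close>

lemma selfadjoint_minimum_eigenvector:
  fixes T :: "'a::euclidean_space \<Rightarrow> 'a"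
  assumes lin: "linear T" and sym: "\<And>x y. inner (T x) y = inner x (T y)"
    and S: "subspace S" and inv: "\<And>x. x \<in> S \<Longrightarrow> T x \<in> S" and nontriv: "\<exists>x\<in>S. x \<noteq> 0"
  obtains e m where "e \<in> S" "e \<noteq> 0" "T e = m *\<^sub>R e" "\<And>x. x \<in> S \<Longrightarrow> m * (norm x)\<^sup>2 \<le> inner x (T x)"
proof -
  let ?B = "sphere 0 1 \<inter> S"
  obtain x0 where x0: "x0 \<in> S" "x0 \<noteq> 0" using nontriv by blast
  have "(1 / norm x0) *\<^sub>R x0 \<in> ?B" using x0 S by (simp add: subspace_scale)
  then have ne: "?B \<noteq> {}" by blast
  have comp: "compact ?B" by (simp add: S closed_subspace compact_Int_closed)
  have cont: "continuous_on ?B (\<lambda>x. inner x (T x))"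
    by (intro continuous_intros linear_continuous_on linear_conv_bounded_linear[THEN iffD1] lin)
  obtain e where e: "e \<in> ?B" and emin: "\<And>x. x \<in> ?B \<Longrightarrow> inner e (T e) \<le> inner x (T x)"
    using continuous_attains_inf[OF comp ne cont] by blast
  define m where "m = inner e (T e)"
  have ne1: "norm e = 1" and eS: "e \<in> S" using e by auto
  have low: "m * (norm x)\<^sup>2 \<le> inner x (T x)" if "x \<in> S" for x
  proof (cases "x = 0")
    case True then show ?thesis by simp
  next
    case False
    have "(1 / norm x) *\<^sub>R x \<in> ?B" using that False S by (simp add: subspace_scale)
    from emin[OF this] show ?thesis using False
      by (simp add: m_def linear_scale[OF lin] field_simps power2_eq_square)
  qed
  let ?T = "\<lambda>x. T x - m *\<^sub>R x"
  have lin': "linear ?T" using lin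
    by (intro linear_compose_sub) (auto simp: linear_iff algebra_simps)
  have sym': "inner (?T x) y = inner x (?T y)" for x y by (simp add: inner_simps sym)
  have "(inner (?T e) (?T e))\<^sup>2 \<le> inner (?T e) (?T (?T e)) * inner e (?T e)"
  proof -
    have TeS: "?T e \<in> S" using inv[OF eS] eS S by (simp add: subspace_diff subspace_scale)
    show ?thesis
      by (rule semidefinite_Cauchy_Schwarz[OF lin' sym' S _ TeS eS])
        (use low in \<open>auto simp: inner_simps power2_norm_eq_inner\<close>)
  qed
  moreover have "inner e (?T e) = 0" using ne1
    by (simp add: inner_simps m_def power2_norm_eq_inner[symmetric])
  ultimately have "?T e = 0" by simp
  then have "T e = m *\<^sub>R e" by simp
  moreover have "e \<noteq> 0" using ne1 by auto
  ultimately show thesis using that eS low by blast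
qed

text \<open>The Kronecker product of \<open>B\<close> with the identity of the single-agent space.
  The entry type is left general so that the same operator serves for stacked decision vectors and,
  over the complex numbers, for eigenvectors of \<open>B\<close>.\<close>

definition stack_mult :: "real ^ 'n ^ 'n \<Rightarrow> 'a::real_vector ^ 'n \<Rightarrow> 'a ^ 'n" where
  "stack_mult B X = (\<chi> i. \<Sum>j\<in>UNIV. B $ i $ j *\<^sub>R X $ j)"

text \<open>Orthogonal projection onto the vectors on which all agents agree;
  \<open>centered\<close> is the complementary projection.\<close>

definition consensus :: "'a::real_vector ^ 'n::finite \<Rightarrow> 'a ^ 'n" where
  "consensus X = (\<chi> i. average (\<lambda>j. X $ j))"

definition centered :: "'a::real_vector ^ 'n::finite \<Rightarrow> 'a ^ 'n" where
  "centered X = X - consensus X"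

lemma linear_stack_mult: "linear (stack_mult B :: 'a::real_vector ^ 'n \<Rightarrow> 'a ^ 'n::finite)"
  by (auto simp: linear_iff stack_mult_def vec_eq_iff scaleR_right_distrib sum.distrib
      scaleR_sum_right intro!: sum.cong)

lemma linear_consensus: "linear (consensus :: 'a::real_vector ^ 'n::finite \<Rightarrow> 'a ^ 'n)"
  by (auto simp: linear_iff consensus_def average_def vec_eq_iff scaleR_right_distrib sum.distrib
      scaleR_sum_right intro!: sum.cong)

lemma linear_centered: "linear (centered :: 'a::real_vector ^ 'n::finite \<Rightarrow> 'a ^ 'n)"
  unfolding centered_def [abs_def] using linear_consensus by (intro linear_compose_sub) (auto simp: linear_iff)

lemma sum_eq_average: "(\<Sum>i\<in>UNIV. z i) = real CARD('n) *\<^sub>R average z" for z :: "'n::finite \<Rightarrow> 'a::real_vector"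
  by (simp add: average_def)

lemma average_consensus [simp]: "average (\<lambda>i. consensus X $ i) = average (\<lambda>i. X $ i)"
  by (simp add: consensus_def average_def sum_constant_scaleR)

lemma consensus_idem [simp]: "consensus (consensus X) = consensus X"
  by (simp add: consensus_def[of "consensus X"] ) (simp add: consensus_def)

lemma inner_consensus: "inner (consensus X) Y = real CARD('n) * inner (average (\<lambda>i. X $ i)) (average (\<lambda>i. Y $ i))"
  for X :: "'a::real_inner ^ 'n::finite"
  by (simp add: inner_vec_def consensus_def flip: inner_sum_right)
     (simp add: sum_eq_average)

lemma consensus_sym: "inner (consensus X) Y = inner X (consensus Y)"
  for X :: "'a::real_inner ^ 'n::finite"
  using inner_consensus[of X Y] inner_consensus[of Y X] by (simp add: inner_commute)

lemma stack_mult_sym: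
  assumes "transpose B = B"
  shows "inner (stack_mult B X) Y = inner X (stack_mult B Y)"
proof -
  have B: "B $ i $ j = B $ j $ i" for i j using assms by (metis transpose_def vec_lambda_beta)
  have "inner (stack_mult B X) Y = (\<Sum>i\<in>UNIV. \<Sum>j\<in>UNIV. B $ i $ j * inner (X $ j) (Y $ i))"
    by (simp add: inner_vec_def stack_mult_def inner_sum_left)
  also have "\<dots> = (\<Sum>j\<in>UNIV. \<Sum>i\<in>UNIV. B $ i $ j * inner (X $ j) (Y $ i))" by (rule sum.swap)
  also have "\<dots> = inner X (stack_mult B Y)"
    by (simp add: inner_vec_def stack_mult_def inner_sum_right B)
  finally show ?thesis .
qed

section \<open>Graph Laplacian: symmetry, kernel and quadratic form\<close>

lemma undirected_weights_sym: "undirected_weights A \<Longrightarrow> A $ i $ j = A $ j $ i"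
  unfolding undirected_weights_def by (metis transpose_def vec_lambda_beta)

lemma transpose_laplacian: "undirected_weights A \<Longrightarrow> transpose (laplacian A) = laplacian A"
proof -
  assume "undirected_weights A"
  then have A: "A $ i $ j = A $ j $ i" for i j by (rule undirected_weights_sym)
  show ?thesis by (simp add: transpose_def laplacian_def vec_eq_iff A)
qed

lemma laplacian_row_sum: "(\<Sum>j\<in>UNIV. laplacian A $ i $ j) = 0" for A :: "real ^ 'n::finite ^ 'n"
  by (simp add: laplacian_def sum_subtractf)

lemma laplacian_const: "stack_mult (laplacian A) (\<chi> i. a) = 0"
  by (simp add: stack_mult_def vec_eq_iff laplacian_row_sum flip: scaleR_sum_left)

lemma laplacian_consensus: "stack_mult (laplacian A) (consensus X) = 0"
  unfolding consensus_def by (rule laplacian_const)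

text \<open>Zero row sums put the agreeing vectors into the kernel; symmetry turns this into
  orthogonality of the range to them. Hence exchanges over the graph never move the average of the
  agents.\<close>

lemma consensus_laplacian:
  fixes X :: "'a::real_inner ^ 'n"
  assumes "undirected_weights A"
  shows "consensus (stack_mult (laplacian A) X) = 0"
proof -
  let ?Y = "stack_mult (laplacian A) X"
  have "inner (consensus ?Y) (consensus ?Y) = inner (stack_mult (laplacian A) X) (consensus ?Y)"
    by (simp add: consensus_sym)
  also have "\<dots> = 0"
    by (simp add: stack_mult_sym[OF transpose_laplacian[OF assms]] laplacian_consensus)
  finally show ?thesis by simp
qed

text \<open>The Dirichlet energy of the graph. It gives semidefiniteness at once and reduces the
  study of the kernel to single edges; self-loops contribute nothing.\<close>

lemma laplacian_quadratic_form:
  fixes X :: "'a::real_inner ^ 'n"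
  assumes "undirected_weights A"
  shows "inner X (stack_mult (laplacian A) X)
    = (1 / 2) * (\<Sum>i\<in>UNIV. \<Sum>j\<in>UNIV. A $ i $ j * (norm (X $ i - X $ j))\<^sup>2)"
proof -
  have A: "A $ i $ j = A $ j $ i" for i j by (rule undirected_weights_sym[OF assms])
  let ?s = "\<Sum>i\<in>UNIV. \<Sum>j\<in>UNIV. A $ i $ j * inner (X $ i) (X $ i)"
  let ?c = "\<Sum>i\<in>UNIV. \<Sum>j\<in>UNIV. A $ i $ j * inner (X $ i) (X $ j)"
  have row: "(stack_mult (laplacian A) X) $ i = (\<Sum>j\<in>UNIV. A $ i $ j) *\<^sub>R X $ i - (\<Sum>j\<in>UNIV. A $ i $ j *\<^sub>R X $ j)" for i
  proof -
    have "(stack_mult (laplacian A) X) $ i =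
      (\<Sum>j\<in>UNIV. (if i = j then (\<Sum>m\<in>UNIV. A $ i $ m) *\<^sub>R X $ j else 0) - A $ i $ j *\<^sub>R X $ j)"
      unfolding stack_mult_def laplacian_def
      by (auto simp: algebra_simps intro!: sum.cong)
    then show ?thesis by (simp add: sum_subtractf)
  qed
  have lhs: "inner X (stack_mult (laplacian A) X) = ?s - ?c"
    by (simp add: inner_vec_def row inner_diff_right inner_sum_right sum_subtractf sum_distrib_right)
  have sw: "(\<Sum>i\<in>UNIV. \<Sum>j\<in>UNIV. A $ i $ j * inner (X $ j) (X $ j)) = ?s"
    by (subst sum.swap, intro sum.cong refl, subst A, rule refl)
  have "(\<Sum>i\<in>UNIV. \<Sum>j\<in>UNIV. A $ i $ j * (norm (X $ i - X $ j))\<^sup>2)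
    = ?s + (\<Sum>i\<in>UNIV. \<Sum>j\<in>UNIV. A $ i $ j * inner (X $ j) (X $ j)) - 2 * ?c"
    by (simp add: power2_norm_eq_inner inner_simps algebra_simps inner_commute
        sum.distrib sum_subtractf sum_distrib_left)
  then show ?thesis using lhs sw by simp
qed

lemma laplacian_psd:
  fixes X :: "'a::real_inner ^ 'n"
  assumes "undirected_weights A"
  shows "0 \<le> inner X (stack_mult (laplacian A) X)"
  unfolding laplacian_quadratic_form[OF assms]
  using assms by (intro mult_nonneg_nonneg sum_nonneg) (auto simp: undirected_weights_def)

text \<open>Zero energy makes the values at the two ends of each edge equal, and equality travels
  along paths. Connectedness enters the proof only through this lemma.\<close>

lemma laplacian_kernel:
  fixes X :: "'a::real_inner ^ 'n"
  assumes und: "undirected_weights A" and con: "connected_graph A"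
    and null: "inner X (stack_mult (laplacian A) X) = 0"
  shows "X $ i = X $ j"
proof -
  have nonneg: "0 \<le> A $ i $ j * (norm (X $ i - X $ j))\<^sup>2" for i j
    using und by (simp add: undirected_weights_def)
  have "(\<Sum>i\<in>UNIV. \<Sum>j\<in>UNIV. A $ i $ j * (norm (X $ i - X $ j))\<^sup>2) = 0"
    using null laplacian_quadratic_form[OF und, of X] by simp
  then have z: "A $ i $ j * (norm (X $ i - X $ j))\<^sup>2 = 0" for i j
    using nonneg by (simp add: sum_nonneg_eq_0_iff sum_nonneg)
  have edge: "X $ i = X $ j" if "(i, j) \<in> graph_edges A" for i j
    using z[of j i] that by (auto simp: graph_edges_def)
  have "(i, j) \<in> (graph_edges A)\<^sup>*" using con by (simp add: connected_graph_def)
  then show ?thesis by (induction rule: rtrancl_induct) (auto dest: edge)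
qed

text \<open>Finiteness is what gives the \<open>Max\<close> and \<open>Min\<close> over the spectrum
  their meaning. The complex vectors are viewed as a real inner product space: once eigenvalues are
  known to be real, eigenvectors of different eigenvalues are orthogonal there, and a
  finite-dimensional space holds only finitely many of them.\<close>

lemma symmetric_eigenvalues_finite:
  fixes B :: "real ^ 'n ^ 'n"
  assumes "transpose B = B"
  shows "finite (eigenvalues B)"
proof -
  let ?M = "\<chi> i j. complex_of_real (B $ i $ j)"
  have M: "?M *v u = stack_mult B u" for u :: "complex ^ 'n"
    by (simp add: matrix_vector_mult_def stack_mult_def vec_eq_iff scaleR_conv_of_real)
  have sym: "inner (?M *v u) w = inner u (?M *v w)" for u w
    unfolding M by (rule stack_mult_sym[OF assms])
  define e where "e c = (SOME u :: complex ^ 'n. u \<noteq> 0 \<and> ?M *v u = c *s u)" for c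
  have e: "e c \<noteq> 0" "?M *v e c = c *s e c" if "c \<in> eigenvalues B" for c
  proof -
    have "\<exists>u :: complex ^ 'n. u \<noteq> 0 \<and> ?M *v u = c *s u" using that by (simp add: eigenvalues_def)
    from someI_ex[OF this] show "e c \<noteq> 0" "?M *v e c = c *s e c" by (simp_all add: e_def)
  qed
  \<comment> \<open>The real inner product commutes only with real scalars, so a complex factor is
    split into a real multiple and a multiple of the quarter turn.\<close>
  have inner_smult: "inner (c *s u) w = Re c * inner u w + Im c * inner (\<i> *s u) w"
    for c and u w :: "complex ^ 'n"
    by (simp add: inner_vec_def inner_complex_def sum_distrib_left sum.distrib algebra_simps flip: sum.distrib)
  have i_skew: "inner (\<i> *s u) w = - inner u (\<i> *s w)" for u w :: "complex ^ 'n"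
    by (simp add: inner_vec_def inner_complex_def sum_negf[symmetric] algebra_simps)
  \<comment> \<open>Testing the eigenvalue equation with the quarter turn of the eigenvector gives a
    multiple of Im c on one side and its negative on the other.\<close>
  have im: "Im c = 0" if c: "c \<in> eigenvalues B" for c
  proof -
    let ?u = "e c"
    have i0: "inner (\<i> *s ?u) ?u = 0" using i_skew[of ?u ?u] by (simp add: inner_commute)
    have ii: "inner (\<i> *s ?u) (\<i> *s ?u) = inner ?u ?u"
      by (simp add: inner_vec_def inner_complex_def algebra_simps)
    have "?M *v (\<i> *s ?u) = c *s (\<i> *s ?u)"
    proof -
      have "?M *v (\<i> *s ?u) = \<i> *s (?M *v ?u)"
        by (simp add: matrix_vector_mult_def vec_eq_iff sum_distrib_left mult_ac)
      then show ?thesis using e(2)[OF c] by (simp add: vec_eq_iff)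
    qed
    then have "inner (c *s ?u) (\<i> *s ?u) = inner ?u (c *s (\<i> *s ?u))"
      using sym[of ?u "\<i> *s ?u"] e(2)[OF c] by simp
    moreover have "inner (c *s ?u) (\<i> *s ?u) = Im c * inner ?u ?u"
      using inner_smult[of c ?u "\<i> *s ?u"] i0 ii by (simp add: inner_commute)
    moreover have "inner ?u (c *s (\<i> *s ?u)) = - Im c * inner ?u ?u"
    proof -
      have "inner (\<i> *s (\<i> *s ?u)) ?u = - inner ?u ?u"
        using i_skew[of "\<i> *s ?u" ?u] ii by simp
      then show ?thesis
        using inner_smult[of c "\<i> *s ?u" ?u] i0 by (simp add: inner_commute)
    qed
    ultimately show ?thesis using e(1)[OF c] by simp
  qed
  have orth: "inner (e c) (e d) = 0" if "c \<in> eigenvalues B" "d \<in> eigenvalues B" "c \<noteq> d" for c d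
  proof -
    have "inner (c *s e c) (e d) = inner (e c) (d *s e d)"
      using sym[of "e c" "e d"] e(2)[OF that(1)] e(2)[OF that(2)] by simp
    then have "Re c * inner (e c) (e d) = Re d * inner (e c) (e d)"
      using inner_smult[of c "e c" "e d"] inner_smult[of d "e d" "e c"] im that by (simp add: inner_commute)
    moreover have "Re c \<noteq> Re d" using im that by (auto simp: complex_eq_iff)
    ultimately show ?thesis by simp
  qed
  have "inj_on e (eigenvalues B)"
    by (rule inj_onI) (metis orth e(1) inner_eq_zero_iff)
  moreover have "finite (e ` eigenvalues B)"
    by (rule pairwise_orthogonal_imp_finite) (auto simp: pairwise_def orthogonal_def intro: orth)
  ultimately show ?thesis by (rule finite_imageD[rotated])
qed

text \<open>The coordinates decouple: for any coordinate \<open>k\<close> in which \<open>X\<close>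
  is not zero, the \<open>k\<close>-th entries of all agents form an eigenvector of \<open>B\<close>
  itself.\<close>

lemma stack_eigenvalue:
  fixes X :: "(real ^ 'd) ^ 'n"
  assumes "X \<noteq> 0" and eig: "stack_mult B X = m *\<^sub>R X"
  shows "complex_of_real m \<in> eigenvalues B"
proof -
  obtain i k where ik: "X $ i $ k \<noteq> 0" using assms(1) by (auto simp: vec_eq_iff)
  let ?u = "\<chi> j. complex_of_real (X $ j $ k)"
  have "(\<Sum>j\<in>UNIV. B $ i $ j * X $ j $ k) = m * X $ i $ k" for i
    using arg_cong[OF eig, of "\<lambda>Y. Y $ i $ k"] by (simp add: stack_mult_def)
  then have "(\<chi> i j. complex_of_real (B $ i $ j)) *v ?u = complex_of_real m *s ?u"
    by (simp add: matrix_vector_mult_def vec_eq_iff flip: of_real_mult of_real_sum)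
  moreover have "?u \<noteq> 0" using ik by (auto simp: vec_eq_iff)
  ultimately show ?thesis unfolding eigenvalues_def by blast
qed

lemma laplacian_spectral_bounds:
  fixes A :: "real ^ 'n ^ 'n" and X :: "(real ^ 'd) ^ 'n"
  assumes agents: "2 \<le> CARD('n)" and und: "undirected_weights A" and con: "connected_graph A"
  defines "\<rho> \<equiv> spectral_radius (laplacian A)" and "\<rho>2 \<equiv> least_pos_eigenvalue (laplacian A)"
  shows "0 < \<rho>2" and "\<rho>2 \<le> \<rho>"
    and "\<rho>2 * (norm (centered X))\<^sup>2 \<le> inner X (stack_mult (laplacian A) X)"
    and "inner X (stack_mult (laplacian A) X) \<le> \<rho> * (norm (centered X))\<^sup>2"
proof -
  let ?L = "stack_mult (laplacian A) :: (real ^ 'd) ^ 'n \<Rightarrow> (real ^ 'd) ^ 'n"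
  define S where "S = {X :: (real ^ 'd) ^ 'n. consensus X = 0}"
  have subS: "subspace S"
    unfolding S_def subspace_def
    by (auto simp: linear_0[OF linear_consensus] linear_add[OF linear_consensus] linear_scale[OF linear_consensus])
  have lin: "linear ?L" by (rule linear_stack_mult)
  have sym: "inner (?L X) Y = inner X (?L Y)" for X Y by (rule stack_mult_sym[OF transpose_laplacian[OF und]])
  have inv: "?L X \<in> S" for X by (simp add: S_def consensus_laplacian[OF und])
  have cenS: "centered X \<in> S" for X by (simp add: S_def centered_def linear_diff[OF linear_consensus])
  have nontriv: "\<exists>X\<in>S. X \<noteq> 0"
  proof -
    \<comment> \<open>Two distinct agents with opposite values; this is where at least two agents
      are required.\<close>
    obtain i j :: 'n where ij: "i \<noteq> j"
      using agents by (metis card_2_iff' ex_card UNIV_I)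
    define X :: "(real ^ 'd) ^ 'n" where "X = (\<chi> k. if k = i then 1 else if k = j then - 1 else 0)"
    have "(\<Sum>k\<in>UNIV. X $ k) = (\<Sum>k\<in>UNIV. (if k = i then 1 else 0) + (if k = j then - 1 else 0))"
      by (rule sum.cong) (auto simp: X_def ij)
    also have "\<dots> = 0" by (subst sum.distrib) simp
    finally have "X \<in> S" by (simp add: S_def consensus_def average_def vec_eq_iff)
    moreover have "X \<noteq> 0" by (auto simp: X_def vec_eq_iff intro!: exI[of _ i])
    ultimately show ?thesis by blast
  qed
  have fin: "finite (eigenvalues (laplacian A))"
    by (rule symmetric_eigenvalues_finite[OF transpose_laplacian[OF und]])
  obtain e m where e: "e \<in> S" "e \<noteq> 0" "?L e = m *\<^sub>R e"
    and low: "\<And>X. X \<in> S \<Longrightarrow> m * (norm X)\<^sup>2 \<le> inner X (?L X)"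
    using selfadjoint_minimum_eigenvector[OF lin sym subS inv nontriv] by metis
  \<comment> \<open>The minimum for the negative of \<open>?L\<close> is minus the maximum for
    \<open>?L\<close>.\<close>
  obtain e' m' where e': "e' \<in> S" "e' \<noteq> 0" "- ?L e' = m' *\<^sub>R e'"
    and up: "\<And>X. X \<in> S \<Longrightarrow> m' * (norm X)\<^sup>2 \<le> inner X (- ?L X)"
    using selfadjoint_minimum_eigenvector[OF linear_compose_neg[OF lin] _ subS _ nontriv]
      sym inv subS by (metis (no_types, lifting) inner_minus_left inner_minus_right subspace_neg)
  have ev: "complex_of_real m \<in> eigenvalues (laplacian A)" by (rule stack_eigenvalue[OF e(2,3)])
  have "?L e' = (- m') *\<^sub>R e'" using e'(3) by (metis add.inverse_inverse scaleR_minus_left)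
  then have ev': "complex_of_real (- m') \<in> eigenvalues (laplacian A)" by (rule stack_eigenvalue[OF e'(2)])
  have "0 < m"
  proof -
    have eq: "inner e (?L e) = m * (norm e)\<^sup>2" by (simp add: e power2_norm_eq_inner)
    \<comment> \<open>A null vector is constant by connectedness and has zero average, hence
      vanishes.\<close>
    have "inner e (?L e) \<noteq> 0"
    proof
      assume "inner e (?L e) = 0"
      then have const: "e $ i = e $ j" for i j by (rule laplacian_kernel[OF und con])
      have "e $ i = average (\<lambda>j. e $ j)" for i
      proof -
        have "(\<Sum>j\<in>UNIV. e $ j) = (\<Sum>j::'n\<in>UNIV. e $ i)" by (rule sum.cong[OF refl const])
        then have "average (\<lambda>j. e $ j) = (1 / real CARD('n)) *\<^sub>R (real CARD('n) *\<^sub>R e $ i)"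
          by (simp only: average_def sum_constant_scaleR)
        then show ?thesis by simp
      qed
      then have "consensus e = e" by (simp add: consensus_def vec_eq_iff)
      then show False using e by (simp add: S_def)
    qed
    then have "m \<noteq> 0" "0 \<le> m * (norm e)\<^sup>2" using laplacian_psd[OF und, of e] eq by auto
    then show ?thesis using e(2) by (auto simp: zero_le_mult_iff)
  qed
  have finpos: "finite {c. 0 < c \<and> complex_of_real c \<in> eigenvalues (laplacian A)}"
  proof (rule finite_imageD)
    show "finite (complex_of_real ` {c. 0 < c \<and> complex_of_real c \<in> eigenvalues (laplacian A)})"
      by (rule finite_subset[OF _ fin]) auto
  qed (simp add: inj_on_def)
  have r2le: "\<rho>2 \<le> m" unfolding \<rho>2_def least_pos_eigenvalue_def
    using finpos ev \<open>0 < m\<close> by (intro Min_le) auto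
  have "\<rho>2 \<in> {c. 0 < c \<and> complex_of_real c \<in> eigenvalues (laplacian A)}"
    unfolding \<rho>2_def least_pos_eigenvalue_def
    using finpos ev \<open>0 < m\<close> by (intro Min_in) auto
  then show pos: "0 < \<rho>2" by simp
  have "cmod (complex_of_real m) \<le> \<rho>" and "cmod (complex_of_real (- m')) \<le> \<rho>"
    unfolding \<rho>_def spectral_radius_def using fin ev ev' by (blast intro: Max_ge finite_imageI)+
  then have rge: "m \<le> \<rho>" "- m' \<le> \<rho>" by (auto simp: abs_le_iff simp flip: of_real_minus)
  then show "\<rho>2 \<le> \<rho>" using r2le by simp
  have LX: "inner X (?L X) = inner (centered X) (?L (centered X))"
  proof -
    have "?L (centered X) = ?L X"
      by (simp add: centered_def linear_diff[OF lin] laplacian_consensus)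
    moreover have "inner (consensus X) (?L X) = 0"
      by (simp add: consensus_sym consensus_laplacian[OF und])
    ultimately show ?thesis by (simp add: centered_def inner_diff_left)
  qed
  show "\<rho>2 * (norm (centered X))\<^sup>2 \<le> inner X (?L X)"
    using low[OF cenS[of X]] mult_right_mono[OF r2le, of "(norm (centered X))\<^sup>2"] by (simp add: LX)
  show "inner X (?L X) \<le> \<rho> * (norm (centered X))\<^sup>2"
    using up[OF cenS[of X]] mult_right_mono[OF rge(2), of "(norm (centered X))\<^sup>2"] by (simp add: LX)
qed

section \<open>Descent of the quadratic part of the Lyapunov function\<close>

text \<open>Everything that the descent estimate uses of the graph, stated for an operator
  \<open>L\<close> and the orthogonal projection \<open>K\<close> onto the complement of its kernel,
  so that the estimate runs without components or agents.\<close>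

locale laplacian_operator =
  fixes L K :: "'a::euclidean_space \<Rightarrow> 'a" and \<rho> \<rho>2 :: real
  assumes linL: "linear L" and linK: "linear K"
    and symL: "inner (L x) y = inner x (L y)" and symK: "inner (K x) y = inner x (K y)"
    and KK [simp]: "K (K x) = K x" and LK [simp]: "L (K x) = L x" and KL [simp]: "K (L x) = L x"
    and rho2_pos: "0 < \<rho>2" and rho2_le: "\<rho>2 \<le> \<rho>"
    and rayleigh_low: "\<rho>2 * (norm (K x))\<^sup>2 \<le> inner x (L x)"
    and rayleigh_up: "inner x (L x) \<le> \<rho> * (norm (K x))\<^sup>2"
begin

lemma rho_pos: "0 < \<rho>" using rho2_pos rho2_le by simp

lemmas lin_simps = linear_add[OF linL] linear_diff[OF linL] linear_scale[OF linL] linear_0[OF linL]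
  linear_neg[OF linL] linear_add[OF linK] linear_diff[OF linK] linear_scale[OF linK] linear_0[OF linK]
  linear_neg[OF linK]

lemma norm_K_le: "(norm (K x))\<^sup>2 \<le> (norm x)\<^sup>2"
proof -
  have "(norm (K x))\<^sup>2 = inner x (K x)" by (simp add: power2_norm_eq_inner symK)
  also have "\<dots> \<le> norm x * norm (K x)" by (rule norm_cauchy_schwarz)
  finally have "norm (K x) * norm (K x) \<le> norm x * norm (K x)" by (simp add: power2_eq_square)
  then have "norm (K x) \<le> norm x"
    by (cases "norm (K x) = 0") (auto simp del: norm_eq_zero simp: mult_le_cancel_right)
  then show ?thesis by (simp add: power_mono)
qed

lemma norm_split: "(norm x)\<^sup>2 = (norm (K x))\<^sup>2 + (norm (x - K x))\<^sup>2"
  by (simp add: power2_norm_eq_inner inner_simps symK)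

lemma psdL: "0 \<le> inner x (L x)"
  using rayleigh_low[of x] rho2_pos by (meson order_trans mult_nonneg_nonneg less_imp_le zero_le_power2)

text \<open>Young's inequality in the seminorm of \<open>L\<close>, which avoids the factor that a
  passage through the Euclidean norm would cost.\<close>

lemma cs_L: "inner x (L y) \<le> t / 2 * inner x (L x) + 1 / (2 * t) * inner y (L y)" if "0 < t"
proof -
  have "0 \<le> inner (t *\<^sub>R x - y) (L (t *\<^sub>R x - y))" by (rule psdL)
  also have "\<dots> = t\<^sup>2 * inner x (L x) - 2 * t * inner x (L y) + inner y (L y)"
    by (simp add: lin_simps inner_simps power2_eq_square algebra_simps)
       (simp add: inner_commute[of y] symL)
  finally have "2 * t * inner x (L y) \<le> t\<^sup>2 * inner x (L x) + inner y (L y)" by simp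
  then show ?thesis using that by (simp add: field_simps power2_eq_square)
qed

text \<open>The operator inequality L^2 <= \<rho> L without a square root of \<open>L\<close>: pair
  \<open>x\<close> with \<open>L x\<close> in the form of \<open>L\<close>; weight \<rho> and the
  Rayleigh bound at \<open>L x\<close> reproduce half of the left side, which is absorbed.\<close>

lemma norm_L_le: "(norm (L x))\<^sup>2 \<le> \<rho> * inner x (L x)"
proof -
  have "(norm (L x))\<^sup>2 = inner (L x) (L x)" by (simp add: power2_norm_eq_inner)
  also have "\<dots> = inner x (L (L x))" by (rule symL)
  also have "\<dots> \<le> \<rho> / 2 * inner x (L x) + 1 / (2 * \<rho>) * inner (L x) (L (L x))"
    by (rule cs_L[OF rho_pos])
  also have "inner (L x) (L (L x)) \<le> \<rho> * (norm (L x))\<^sup>2" using rayleigh_up[of "L x"] by simp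
  finally show ?thesis using rho_pos by (simp add: field_simps)
qed

lemma norm_L_le': "(norm (L x))\<^sup>2 \<le> \<rho>\<^sup>2 * (norm (K x))\<^sup>2"
  using order_trans[OF norm_L_le mult_left_mono[OF rayleigh_up less_imp_le[OF rho_pos]]]
  by (simp add: power2_eq_square mult_ac)

section \<open>Pseudo-inverse of the Laplacian\<close>

definition P :: "'a \<Rightarrow> 'a" where
  "P = (SOME P. linear P \<and> (\<forall>x. K (P x) = P x) \<and> (\<forall>x. L (P x) = K x) \<and> (\<forall>x. P (L x) = K x))"

text \<open>Adding the projection onto the kernel makes \<open>L\<close> invertible;
  \<open>K\<close> composed with that inverse inverts \<open>L\<close> on the range of
  \<open>K\<close> and annihilates the kernel.\<close>

lemma P_exists: "\<exists>P. linear P \<and> (\<forall>x. K (P x) = P x) \<and> (\<forall>x. L (P x) = K x) \<and> (\<forall>x. P (L x) = K x)"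
proof -
  let ?T = "\<lambda>x. L x + (x - K x)"
  have lT: "linear ?T" by (auto simp: linear_iff lin_simps algebra_simps)
  have "inj ?T"
  proof (subst linear_inj_iff_eq_0[OF lT], intro allI impI)
    fix x assume T0: "?T x = 0"
    have "K (?T x) = L x" by (simp add: lin_simps)
    then have Lx: "L x = 0" using T0 by (simp add: lin_simps)
    then have "\<rho>2 * (norm (K x))\<^sup>2 \<le> 0" using rayleigh_low[of x] by simp
    then have "K x = 0" using rho2_pos by (simp add: mult_le_0_iff)
    then show "x = 0" using T0 Lx by simp
  qed
  then obtain g where g: "linear g" "\<And>x. g (?T x) = x" "\<And>x. ?T (g x) = x"
    using linear_injective_isomorphism[OF lT] by auto
  let ?P = "\<lambda>x. K (g x)"
  have "linear ?P" using linear_compose[OF g(1) linK] by (simp add: o_def)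
  moreover have "L (?P x) = K x" for x
    using arg_cong[OF g(3)[of x], of K] by (simp add: lin_simps)
  moreover have "?P (L x) = K x" for x
    using arg_cong[OF g(2)[of "K x"], of K] by simp
  ultimately show ?thesis by (intro exI[of _ ?P]) simp
qed

lemma linP: "linear P" and KP [simp]: "K (P x) = P x" and LP [simp]: "L (P x) = K x"
  and PL [simp]: "P (L x) = K x"
  using someI_ex[OF P_exists] unfolding P_def[symmetric] by auto

lemma symP: "inner (P x) y = inner x (P y)"
proof -
  have "inner (P x) y = inner (P x) (L (P y))" using symK[of "P x" y] by simp
  also have "\<dots> = inner x (P y)" by (metis symL LP symK KP)
  finally show ?thesis .
qed

text \<open>Moves the form of \<open>P\<close> into the form of \<open>L\<close>, so that
  \<open>cs_L\<close> and the Rayleigh bounds apply to dual quantities.\<close>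

lemma P_form: "inner x (P x) = inner (P x) (L (P x))"
  using symK[of "P x" x] by (simp add: inner_commute)

lemma norm_P_le: "(norm (P x))\<^sup>2 \<le> 1 / \<rho>2 * inner x (P x)"
  using rayleigh_low[of "P x"] rho2_pos P_form[of x] by (simp add: field_simps)

lemma psdP: "0 \<le> inner x (P x)" unfolding P_form by (rule psdL)

lemma norm_K_le_P: "(norm (K x))\<^sup>2 \<le> \<rho> * inner x (P x)"
  using norm_L_le[of "P x"] P_form[of x] by simp

text \<open>Comes from expanding the square of \<open>x - \<rho>2 *\<^sub>R P x\<close>: by
  \<open>norm_P_le\<close> the last term cancels at most half of the mixed term.\<close>

lemma P_form_le: "inner x (P x) \<le> 1 / \<rho>2 * (norm x)\<^sup>2"
proof -
  have "0 \<le> (norm (x - \<rho>2 *\<^sub>R P x))\<^sup>2" by simp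
  also have "\<dots> = (norm x)\<^sup>2 - 2 * \<rho>2 * inner x (P x) + \<rho>2\<^sup>2 * (norm (P x))\<^sup>2"
    by (simp add: power2_norm_eq_inner inner_simps) (simp add: power2_eq_square algebra_simps symP)
  also have "\<dots> \<le> (norm x)\<^sup>2 - 2 * \<rho>2 * inner x (P x) + \<rho>2\<^sup>2 * (1 / \<rho>2 * inner x (P x))"
    using norm_P_le[of x] by (intro add_left_mono mult_left_mono) auto
  finally show ?thesis using rho2_pos by (simp add: field_simps power2_eq_square)
qed

lemma norm_P_le': "(norm (P x))\<^sup>2 \<le> 1 / \<rho>2\<^sup>2 * (norm x)\<^sup>2"
proof -
  have "1 / \<rho>2 * inner x (P x) \<le> 1 / \<rho>2 * (1 / \<rho>2 * (norm x)\<^sup>2)"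
    using P_form_le rho2_pos by (intro mult_left_mono) auto
  then show ?thesis using norm_P_le[of x] by (simp add: power2_eq_square)
qed

text \<open>
  With \<open>c = (\<beta> + \<gamma>) / \<gamma>\<close> the terms in \<open>\<langle>z, u\<rangle>\<close> of first order in \<open>\<alpha>\<close> cancel.
\<close>

definition Q :: "real \<Rightarrow> 'a \<Rightarrow> 'a \<Rightarrow> real" where
  "Q c z u = 1 / 2 * (norm z)\<^sup>2 + c / 2 * inner u (P u) + inner z (P u)"

text \<open>Half the square of \<open>z + P u\<close> covers the first and the mixed term; what is
  missing is half the squared norm of \<open>P u\<close>, which the dual term dominates once
  \<open>c\<close> is at least 1 / \<rho>2.\<close>

lemma Q_nonneg:
  assumes "1 / \<rho>2 \<le> c" shows "0 \<le> Q c z u"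
proof -
  have "- inner z (P u) \<le> 1 / 2 * (norm z)\<^sup>2 + 1 / 2 * (norm (P u))\<^sup>2"
    using inner_ge_zero[of "z + P u"] by (simp add: power2_norm_eq_inner inner_simps inner_commute)
  moreover have "1 / 2 * (norm (P u))\<^sup>2 \<le> c / 2 * inner u (P u)"
    using norm_P_le[of u] mult_right_mono[OF assms psdP[of u]] by simp
  ultimately show ?thesis by (simp add: Q_def)
qed

text \<open>An exact expansion; all estimates are left to \<open>Q_descent\<close>. Here
  \<open>h\<close> is the compression error, \<open>q\<close> the centered gradient difference
  between the local points and their mean, and \<open>D\<close> the change that the moving average
  causes in the gradient part of \<open>u\<close>. For \<open>h\<close> the balance of
  \<open>c\<close> is incomplete: \<gamma> times the inner product of \<open>h\<close> and
  \<open>u\<close> survives.\<close>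

lemma Q_step:
  fixes \<alpha> \<beta> \<gamma> c :: real
  assumes z: "K z = z" and u: "K u = u" and D: "K D = D" and q: "K q = q"
    and c: "\<beta> = c * \<gamma> - \<gamma>"
    and a: "a = \<beta> *\<^sub>R L z + \<beta> *\<^sub>R L h + \<gamma> *\<^sub>R u + q"
  shows "Q c (z - \<alpha> *\<^sub>R a) (u + (\<alpha> * \<gamma>) *\<^sub>R L (z + h) + D) - Q c z u =
    \<alpha> * (- \<beta> * inner z (L z) - \<beta> * inner z (L h) - inner z q + \<gamma> * (norm z)\<^sup>2 + \<gamma> * inner z h
         + \<gamma> * inner h u - \<gamma> * inner u (P u) - inner q (P u))
    + c * inner (P u) D + inner z (P D) + \<alpha>\<^sup>2 / 2 * (norm a)\<^sup>2
    + \<alpha>\<^sup>2 * \<gamma> * ((\<gamma> - \<beta>) / 2 * inner (z + h) (L (z + h)) - \<gamma> * inner u (z + h) - inner q (z + h))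
    + \<alpha> * \<gamma> * inner (z + h) D - \<alpha> * \<gamma> * inner u (P D) - \<alpha> * inner q (P D) + c / 2 * inner D (P D)"
proof -
  let ?G = "L (z + h)"
  \<comment> \<open>Applying \<open>P\<close> to \<open>L (z + h)\<close> returns
    \<open>z + K h\<close>, not \<open>z + h\<close>; the distinction disappears in every pairing
    with a centered vector.\<close>
  define k where "k = K h"
  have Pu: "P (u + (\<alpha> * \<gamma>) *\<^sub>R ?G + D) = P u + (\<alpha> * \<gamma>) *\<^sub>R (z + k) + P D"
    by (simp add: linear_add[OF linP] linear_scale[OF linP] lin_simps z k_def)
  have a': "a = \<beta> *\<^sub>R ?G + \<gamma> *\<^sub>R u + q" by (simp add: a lin_simps algebra_simps)
  have kk: "inner y k = inner y h" if "K y = y" for y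
    using that symK[of y h] by (simp add: k_def)
  have G: "inner ?G (P y) = inner (z + h) y" if "K y = y" for y
    using that by (simp add: symL)
  have Gk: "inner ?G (z + k) = inner (z + h) ?G"
    using kk[of ?G] by (simp add: inner_add_right inner_add_left inner_commute)
  have up: "inner (u + (\<alpha> * \<gamma>) *\<^sub>R ?G + D) (P (u + (\<alpha> * \<gamma>) *\<^sub>R ?G + D))
     = inner u (P u) + 2 * \<alpha> * \<gamma> * inner (z + h) u + 2 * inner (P u) D
       + (\<alpha> * \<gamma>)\<^sup>2 * inner (z + h) ?G + 2 * \<alpha> * \<gamma> * inner (z + h) D + inner D (P D)"
  proof -
    have 1: "inner u (z + k) = inner (z + h) u" "inner D (z + k) = inner (z + h) D"
      using kk[OF u] kk[OF D] by (simp_all add: inner_simps inner_commute)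
    have 2: "inner u (P D) = inner (P u) D" "inner D (P u) = inner (P u) D"
      using symP[of u D] by (simp_all add: inner_commute)
    show ?thesis unfolding Pu
      by (simp only: inner_add_left[of "_ + _" D] inner_add_left[of u] inner_add_right[of _ "_ + _" "P D"]
          inner_add_right[of _ "P u"] inner_scaleR_left inner_scaleR_right 1 2 Gk G[OF u] G[OF D])
        (simp add: algebra_simps power2_eq_square)
  qed
  have cross: "inner (z - \<alpha> *\<^sub>R a) (P (u + (\<alpha> * \<gamma>) *\<^sub>R ?G + D))
    = inner z (P u) + \<alpha> * \<gamma> * ((norm z)\<^sup>2 + inner z h) + inner z (P D)
     - \<alpha> * inner a (P u) - \<alpha>\<^sup>2 * \<gamma> * inner a (z + h) - \<alpha> * inner a (P D)"
  proof -
    have Ka: "K a = a" by (simp add: a' lin_simps u q)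
    show ?thesis unfolding Pu
      by (simp add: inner_simps kk[OF z] kk[OF Ka] power2_norm_eq_inner) (simp add: algebra_simps power2_eq_square)
  qed
  have au: "inner a (P u) = \<beta> * inner (z + h) u + \<gamma> * inner u (P u) + inner q (P u)"
    unfolding a' using G[OF u] by (simp add: inner_add_left inner_scaleR_left)
  have aD: "inner a (P D) = \<beta> * inner (z + h) D + \<gamma> * inner u (P D) + inner q (P D)"
    unfolding a' using G[OF D] by (simp add: inner_add_left inner_scaleR_left)
  have az: "inner a (z + h) = \<beta> * inner (z + h) ?G + \<gamma> * inner u (z + h) + inner q (z + h)"
    unfolding a' by (simp only: inner_add_left[of "_ *\<^sub>R _"] inner_add_left[of "_ + _"] inner_scaleR_left)
      (simp add: inner_commute)
  have na: "(norm (z - \<alpha> *\<^sub>R a))\<^sup>2 = (norm z)\<^sup>2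
     - 2 * \<alpha> * (\<beta> * inner z (L z) + \<beta> * inner z (L h) + \<gamma> * inner u z + inner z q) + \<alpha>\<^sup>2 * (norm a)\<^sup>2"
  proof -
    have "inner z a = \<beta> * inner z (L z) + \<beta> * inner z (L h) + \<gamma> * inner u z + inner z q"
      by (simp add: a inner_simps inner_commute)
    moreover have "(norm (z - \<alpha> *\<^sub>R a))\<^sup>2 = (norm z)\<^sup>2 - 2 * \<alpha> * inner z a + \<alpha>\<^sup>2 * (norm a)\<^sup>2"
      unfolding power2_norm_eq_inner
      by (simp add: inner_simps inner_commute[of a z]) (simp add: algebra_simps power2_eq_square)
    ultimately show ?thesis by simp
  qed
  have zu: "inner (z + h) u = inner u z + inner h u" by (simp add: inner_simps inner_commute)
  show ?thesis
    unfolding Q_def up cross au aD az na zu c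
    by (simp add: field_simps power2_eq_square)
qed

text \<open>
  \<open>N\<close> is the squared norm of the stacked average gradient and \<open>q - K q\<close> the difference between
  that average and the average at the mean. The contribution \<open>e10 * \<alpha>\<^sup>2 * N\<close> of the compression
  error has no counterpart in \<open>phi6\<close>: it is paid for by the gap between \<open>1 / 2\<close> and the
  \<open>1 / 8\<close> in \<open>phi5\<close>.
\<close>

lemma Q_descent:
  fixes \<alpha> \<beta> \<gamma> c l N e10 e12 :: real
  assumes z: "K z = z" and u: "K u = u" and D: "K D = D"
    and q: "(norm q)\<^sup>2 \<le> l\<^sup>2 * (norm z)\<^sup>2" and nD: "(norm D)\<^sup>2 \<le> l\<^sup>2 * \<alpha>\<^sup>2 / \<gamma>\<^sup>2 * N"
    and N: "0 \<le> N" and alpha: "0 < \<alpha>" "\<alpha> \<le> 1 / 6" and gamma: "0 < \<gamma>" "\<gamma> \<le> \<rho>2 * \<beta> / 4"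
    and c: "\<beta> = c * \<gamma> - \<gamma>" and e10: "0 \<le> e10" "\<alpha> * e10 \<le> 1 / 4"
    and a: "a = \<beta> *\<^sub>R L z + \<beta> *\<^sub>R L h + \<gamma> *\<^sub>R u + K q"
  shows "Q c (z - \<alpha> *\<^sub>R a) (u + (\<alpha> * \<gamma>) *\<^sub>R L (z + h) + D) - Q c z u
      - \<alpha> / 2 * N + \<alpha> / 2 * (norm (q - K q))\<^sup>2 + l * \<alpha>\<^sup>2 / 2 * N
      + e10 * (\<alpha>\<^sup>2 * ((norm a)\<^sup>2 + N)) - 2 * e12 * (norm h)\<^sup>2
    \<le> - \<alpha> * (phi1 \<rho>2 l \<beta> \<gamma> - \<alpha> * phi2' \<rho> \<rho>2 l \<beta> \<gamma> e10) * (norm z)\<^sup>2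
      - \<alpha> * (phi3 \<rho>2 \<gamma> - \<alpha> * phi4' \<rho> \<gamma> e10) * inner u (P u)
      - \<alpha> * (phi5 \<rho>2 l \<beta> \<gamma> - \<alpha> * phi6 \<rho>2 l \<beta> \<gamma>) * N
      - (2 * e12 - \<alpha> * phi7 \<rho> \<beta> \<gamma> - \<alpha>\<^sup>2 * phi8' \<rho> \<rho>2 \<beta> \<gamma> e10) * (norm h)\<^sup>2"
proof -
  define nz nh U dK dH nP DP where "nz = (norm z)\<^sup>2" and "nh = (norm h)\<^sup>2" and "U = inner u (P u)"
    and "dK = (norm (K q))\<^sup>2" and "dH = (norm (q - K q))\<^sup>2" and "nP = (norm (P D))\<^sup>2" and "DP = inner D (P D)"
  note defs = nz_def nh_def U_def dK_def dH_def nP_def DP_def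
  \<comment> \<open>Times \<open>\<alpha>\<^sup>2 * N\<close> these bound the form of
    \<open>P\<close> at \<open>D\<close> and the squared norm of \<open>P D\<close>.\<close>
  define X1 X2 where "X1 = l\<^sup>2 / (\<gamma>\<^sup>2 * \<rho>2)" and "X2 = l\<^sup>2 / (\<gamma>\<^sup>2 * \<rho>2\<^sup>2)"
  have nonneg: "0 \<le> nz" "0 \<le> nh" "0 \<le> U" "0 \<le> dK" "0 \<le> dH" "0 \<le> nP" "0 \<le> DP"
    by (simp_all add: defs psdP)
  have bpos: "0 < \<beta>"
  proof -
    have "0 < \<rho>2 * \<beta>" using gamma by simp
    then show ?thesis using rho2_pos by (simp add: zero_less_mult_iff)
  qed
  have cpos: "0 < c"
    using c bpos gamma(1) by (metis add_pos_pos diff_add_cancel zero_less_mult_pos2)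
  let ?G = "L (z + h)"
  \<comment> \<open>The centered part of \<open>q\<close> and its average are orthogonal, so they
    share a single Lipschitz budget.\<close>
  have dsum: "dK + dH \<le> l\<^sup>2 * nz" using q norm_split[of q] by (simp add: defs)
  have DPb: "DP \<le> \<alpha>\<^sup>2 * X1 * N"
  proof -
    have "DP \<le> 1 / \<rho>2 * (norm D)\<^sup>2" unfolding DP_def by (rule P_form_le)
    also have "\<dots> \<le> 1 / \<rho>2 * (l\<^sup>2 * \<alpha>\<^sup>2 / \<gamma>\<^sup>2 * N)" using nD rho2_pos by (intro mult_left_mono) auto
    finally show ?thesis by (simp add: X1_def mult_ac)
  qed
  have PDb: "nP \<le> \<alpha>\<^sup>2 * X2 * N"
  proof -
    have "nP \<le> 1 / \<rho>2\<^sup>2 * (norm D)\<^sup>2" unfolding nP_def by (rule norm_P_le')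
    also have "\<dots> \<le> 1 / \<rho>2\<^sup>2 * (l\<^sup>2 * \<alpha>\<^sup>2 / \<gamma>\<^sup>2 * N)" using nD by (intro mult_left_mono) auto
    finally show ?thesis by (simp add: X2_def mult_ac)
  qed
  have nzh: "(norm (z + h))\<^sup>2 \<le> 2 * nz + 2 * nh" unfolding defs by (rule norm_add_sq)
  have Kzh: "(norm (K (z + h)))\<^sup>2 \<le> 2 * nz + 2 * nh" by (rule order_trans[OF norm_K_le nzh])
  have nG: "(norm ?G)\<^sup>2 \<le> \<rho>\<^sup>2 * (2 * nz + 2 * nh)"
    by (rule order_trans[OF norm_L_le' mult_left_mono[OF Kzh]]) simp
  have nu: "(norm u)\<^sup>2 \<le> \<rho> * U" using norm_K_le_P[of u] by (simp add: u U_def)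
  have w: "(norm (P u))\<^sup>2 \<le> 1 / \<rho>2 * U" unfolding U_def by (rule norm_P_le)
  have hLh: "inner h (L h) \<le> \<rho> * nh"
    using rayleigh_up[of h] mult_left_mono[OF norm_K_le[of h] less_imp_le[OF rho_pos]] by (simp add: nh_def)
  have zLz: "\<rho>2 * nz \<le> inner z (L z)" using rayleigh_low[of z] by (simp add: z nz_def)
  have aG: "a = \<beta> *\<^sub>R ?G + \<gamma> *\<^sub>R u + K q" by (simp add: a lin_simps algebra_simps)

  \<comment> \<open>Half of the consensus term is spent on the compression error; the other half is
    the \<open>\<rho>2 * \<beta>\<close> in \<open>phi1\<close>.\<close>
  have f1: "- \<beta> * inner z (L z) - \<beta> * inner z (L h) \<le> - (\<rho>2 * \<beta> / 2) * nz + \<rho> * \<beta> / 2 * nh"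
  proof -
    have "- inner z (L h) \<le> 1 / 2 * inner z (L z) + 1 / 2 * inner h (L h)"
      using cs_L[of 1 "- z" h] by (simp add: lin_simps)
    then have "- inner z (L z) - inner z (L h) \<le> - (\<rho>2 / 2) * nz + \<rho> / 2 * nh" using zLz hLh by simp
    from mult_left_mono[OF this less_imp_le[OF bpos]] show ?thesis by (simp add: algebra_simps)
  qed
  have f2: "- inner z (K q) \<le> 1 / 2 * nz + 1 / 2 * dK" using neg_inner_le[of 1 z "K q"] by (simp add: defs)
  have f3: "\<gamma> * inner z h \<le> \<gamma> * (1 / 2 * nz + 1 / 2 * nh)"
    using inner_le[of 1 z h] gamma by (intro mult_left_mono) (auto simp: defs)
  \<comment> \<open>The centered \<open>u\<close> equals \<open>L (P u)\<close>, so the estimate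
    runs in the form of \<open>L\<close> and charges only \<gamma> / 4 to the dual form.\<close>
  have f4: "\<gamma> * inner h u \<le> \<gamma> * (\<rho> * nh + 1 / 4 * U)"
  proof -
    have "inner h (L (P u)) \<le> inner h (L h) + 1 / 4 * inner (P u) (L (P u))" using cs_L[of 2 h "P u"] by simp
    then have "inner h u \<le> \<rho> * nh + 1 / 4 * U" using hLh by (simp add: u U_def P_form[of u])
    then show ?thesis using gamma by (intro mult_left_mono) auto
  qed
  have f6: "- inner (K q) (P u) \<le> 1 / 4 * dK + 1 / \<rho>2 * U"
    using neg_inner_le[of "1/2" "K q" "P u"] w by (simp add: defs)
  have f7: "c * inner (P u) D \<le> \<alpha> * (\<gamma> / 4 * U + c\<^sup>2 / \<gamma> * X1 * N)"
  proof -
    \<comment> \<open>This weight charges a second \<gamma> / 4, up to the common factor \<alpha>,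
      to the dual form; of the available \<gamma> the half in \<open>phi3\<close> remains.\<close>
    define t where "t = \<alpha> * \<gamma> / (2 * c)"
    have t: "0 < t" using alpha gamma cpos by (simp add: t_def)
    have "inner (P u) (L (P D)) \<le> t / 2 * inner (P u) (L (P u)) + 1 / (2 * t) * inner (P D) (L (P D))"
      by (rule cs_L[OF t])
    then have "inner (P u) D \<le> t / 2 * U + 1 / (2 * t) * DP"
      by (simp add: D U_def DP_def P_form[of u] P_form[of D])
    also have "\<dots> \<le> t / 2 * U + 1 / (2 * t) * (\<alpha>\<^sup>2 * X1 * N)" using t by (intro add_left_mono mult_left_mono DPb) simp
    finally have "c * inner (P u) D \<le> c * (t / 2 * U + 1 / (2 * t) * (\<alpha>\<^sup>2 * X1 * N))"
      using cpos by (simp add: mult_left_mono)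
    also have "\<dots> = \<alpha> * (\<gamma> / 4 * U + c\<^sup>2 / \<gamma> * X1 * N)"
      using alpha gamma cpos by (simp add: t_def field_simps power2_eq_square)
    finally show ?thesis .
  qed
  have f8: "inner z (P D) \<le> \<alpha> * (1 / 2 * nz + X2 / 2 * N)"
  proof -
    have "inner z (P D) \<le> \<alpha> / 2 * nz + 1 / (2 * \<alpha>) * nP" unfolding defs by (rule inner_le[OF alpha(1)])
    also have "\<dots> \<le> \<alpha> / 2 * nz + 1 / (2 * \<alpha>) * (\<alpha>\<^sup>2 * X2 * N)" using alpha by (intro add_left_mono mult_left_mono PDb) simp
    also have "\<dots> = \<alpha> * (1 / 2 * nz + X2 / 2 * N)" using alpha by (simp add: field_simps power2_eq_square)
    finally show ?thesis .
  qed
  \<comment> \<open>Grouping \<open>L (z + h)\<close> costs more in \<open>z\<close> and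
    \<open>h\<close> than a split into four terms, but only 5/4 in the dual form; with the 1/2 from
    \<open>s3\<close> this stays below the 2 in \<open>phi4'\<close>.\<close>
  have s1: "1 / 2 * (norm a)\<^sup>2 \<le> 5 / 2 * \<rho>\<^sup>2 * \<beta>\<^sup>2 * (nz + nh) + 5 / 4 * \<rho> * \<gamma>\<^sup>2 * U + 5 / 2 * dK"
  proof -
    have "(norm a)\<^sup>2 \<le> 5 / 2 * (\<beta>\<^sup>2 * (norm ?G)\<^sup>2) + 5 / 2 * (\<gamma>\<^sup>2 * (norm u)\<^sup>2) + 5 * dK"
      using norm_add3_sq[of "\<beta> *\<^sub>R ?G" "\<gamma> *\<^sub>R u" "K q"] by (simp add: aG dK_def power_mult_distrib)
    also have "\<dots> \<le> 5 / 2 * (\<beta>\<^sup>2 * (\<rho>\<^sup>2 * (2 * nz + 2 * nh))) + 5 / 2 * (\<gamma>\<^sup>2 * (\<rho> * U)) + 5 * dK"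
      using nG nu by (intro add_mono mult_left_mono order_refl) auto
    finally show ?thesis by (simp add: algebra_simps add_divide_distrib)
  qed
  \<comment> \<open>The terms multiplied by \<open>e10\<close> leave no room: \<open>L z\<close> and
    \<open>L h\<close> are separated to obtain the factor 4 of \<open>phi2'\<close> and
    \<open>phi8'\<close>, where the grouped estimate would give 5.\<close>
  have s1': "(norm a)\<^sup>2 \<le> 4 * (\<rho>\<^sup>2 * \<beta>\<^sup>2 * (nz + nh) + \<rho> * \<gamma>\<^sup>2 * U + dK)"
  proof -
    have "(norm a)\<^sup>2 \<le> 4 * (\<beta>\<^sup>2 * (norm (L z))\<^sup>2 + \<beta>\<^sup>2 * (norm (L h))\<^sup>2 + \<gamma>\<^sup>2 * (norm u)\<^sup>2 + dK)"
      using norm_add4_sq[of "\<beta> *\<^sub>R L z" "\<beta> *\<^sub>R L h" "\<gamma> *\<^sub>R u" "K q"] by (simp add: a dK_def power_mult_distrib)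
    also have "\<dots> \<le> 4 * (\<beta>\<^sup>2 * (\<rho>\<^sup>2 * nz) + \<beta>\<^sup>2 * (\<rho>\<^sup>2 * nh) + \<gamma>\<^sup>2 * (\<rho> * U) + dK)"
      using nu norm_L_le'[of z] order_trans[OF norm_L_le'[of h] mult_left_mono[OF norm_K_le[of h]]]
      by (intro mult_left_mono add_mono order_refl) (auto simp: z defs)
    finally show ?thesis by (simp add: algebra_simps)
  qed
  have s2: "(\<gamma> - \<beta>) / 2 * inner (z + h) ?G \<le> \<gamma> * \<rho> * (nz + nh)"
  proof -
    have "(\<gamma> - \<beta>) / 2 * inner (z + h) ?G \<le> \<gamma> / 2 * inner (z + h) ?G"
      using psdL[of "z + h"] bpos by (intro mult_right_mono) auto
    also have "\<dots> \<le> \<gamma> / 2 * (\<rho> * (2 * nz + 2 * nh))"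
      using order_trans[OF rayleigh_up[of "z + h"] mult_left_mono[OF Kzh]] rho_pos gamma
      by (intro mult_left_mono) auto
    finally show ?thesis by (simp add: algebra_simps)
  qed
  have s3: "- \<gamma> * inner u (z + h) \<le> \<gamma> * (1 / 2 * \<rho> * U + nz + nh)"
  proof -
    have "- inner u (z + h) \<le> 1 / 2 * \<rho> * U + nz + nh" using neg_inner_le[of 1 u "z + h"] nu nzh by simp
    from mult_left_mono[OF this less_imp_le[OF gamma(1)]] show ?thesis by simp
  qed
  have s4: "\<gamma> * (- inner (K q) (z + h)) \<le> 1 / 2 * dK + \<gamma>\<^sup>2 * (nz + nh)"
  proof -
    have "- inner (K q) (\<gamma> *\<^sub>R (z + h)) \<le> 1 / 2 * dK + 1 / 2 * (norm (\<gamma> *\<^sub>R (z + h)))\<^sup>2"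
      using neg_inner_le[of 1 "K q" "\<gamma> *\<^sub>R (z + h)"] by (simp only: dK_def) simp
    also have "(norm (\<gamma> *\<^sub>R (z + h)))\<^sup>2 \<le> \<gamma>\<^sup>2 * (2 * nz + 2 * nh)"
      using nzh by (simp add: power_mult_distrib mult_left_mono)
    finally show ?thesis by (simp add: algebra_simps)
  qed
  \<comment> \<open>Putting \<gamma> on the side of \<open>D\<close> cancels the 1 / \<gamma> in the
    bound on \<open>D\<close>.\<close>
  have s5: "\<alpha> * \<gamma> * inner (z + h) D \<le> \<alpha>\<^sup>2 * (nz + nh + l\<^sup>2 / 2 * N)"
  proof -
    have "inner (\<alpha> *\<^sub>R (z + h)) (\<gamma> *\<^sub>R D) \<le> 1 / 2 * (norm (\<alpha> *\<^sub>R (z + h)))\<^sup>2 + 1 / 2 * (norm (\<gamma> *\<^sub>R D))\<^sup>2"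
      using inner_le[of 1 "\<alpha> *\<^sub>R (z + h)" "\<gamma> *\<^sub>R D"] by simp
    also have "(norm (\<alpha> *\<^sub>R (z + h)))\<^sup>2 \<le> \<alpha>\<^sup>2 * (2 * nz + 2 * nh)"
      using nzh by (simp add: power_mult_distrib mult_left_mono)
    also have "(norm (\<gamma> *\<^sub>R D))\<^sup>2 \<le> \<gamma>\<^sup>2 * (l\<^sup>2 * \<alpha>\<^sup>2 / \<gamma>\<^sup>2 * N)"
      using nD by (simp only: norm_scaleR power_mult_distrib power2_abs mult_left_mono zero_le_power2)
    also have "\<dots> = l\<^sup>2 * \<alpha>\<^sup>2 * N" using gamma by simp
    finally show ?thesis by (simp add: algebra_simps)
  qed
  have s6: "\<alpha> * \<gamma> * (- inner u (P D)) \<le> \<alpha>\<^sup>2 * (1 / 2 * \<rho> * U + \<gamma>\<^sup>2 * X2 / 2 * N)"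
  proof -
    have "- inner (\<alpha> *\<^sub>R u) (\<gamma> *\<^sub>R P D) \<le> 1 / 2 * (norm (\<alpha> *\<^sub>R u))\<^sup>2 + 1 / 2 * (norm (\<gamma> *\<^sub>R P D))\<^sup>2"
      using neg_inner_le[of 1 "\<alpha> *\<^sub>R u" "\<gamma> *\<^sub>R P D"] by simp
    also have "(norm (\<alpha> *\<^sub>R u))\<^sup>2 \<le> \<alpha>\<^sup>2 * (\<rho> * U)"
      using nu by (simp add: power_mult_distrib mult_left_mono)
    also have "(norm (\<gamma> *\<^sub>R P D))\<^sup>2 \<le> \<gamma>\<^sup>2 * (\<alpha>\<^sup>2 * X2 * N)"
      using PDb by (simp add: nP_def power_mult_distrib mult_left_mono)
    finally show ?thesis by (simp add: algebra_simps)
  qed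
  have s7: "\<alpha> * (- inner (K q) (P D)) \<le> \<alpha>\<^sup>2 * (1 / 2 * dK + X2 / 2 * N)"
  proof -
    have "- inner (\<alpha> *\<^sub>R K q) (P D) \<le> 1 / 2 * (norm (\<alpha> *\<^sub>R K q))\<^sup>2 + 1 / 2 * nP"
      using neg_inner_le[of 1 "\<alpha> *\<^sub>R K q" "P D"] by (simp add: nP_def)
    then show ?thesis using PDb by (simp add: power_mult_distrib dK_def algebra_simps)
  qed
  have s8: "c / 2 * DP \<le> \<alpha>\<^sup>2 * (c * X1 / 2 * N)"
    using mult_left_mono[OF DPb, of "c / 2"] cpos by (simp add: algebra_simps)

  have first: "\<alpha> * (- \<beta> * inner z (L z) - \<beta> * inner z (L h) - inner z (K q) + \<gamma> * nz + \<gamma> * inner z h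
         + \<gamma> * inner h u - \<gamma> * U - inner (K q) (P u))
     \<le> \<alpha> * ((- \<rho>2 * \<beta> / 2 + 3 * \<gamma> / 2 + 1 / 2) * nz + (\<rho> * \<beta> / 2 + \<gamma> / 2 + \<gamma> * \<rho>) * nh
         + (1 / \<rho>2 - 3 * \<gamma> / 4) * U + 3 / 4 * dK)"
    using f1 f2 f3 f4 f6 alpha by (intro mult_left_mono) (auto simp: algebra_simps)
  have "\<gamma> * ((\<gamma> - \<beta>) / 2 * inner (z + h) ?G - \<gamma> * inner u (z + h) - inner (K q) (z + h))
     = \<gamma> * ((\<gamma> - \<beta>) / 2 * inner (z + h) ?G) + \<gamma> * (- \<gamma> * inner u (z + h)) + \<gamma> * (- inner (K q) (z + h))"
    by (simp add: algebra_simps)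
  also have "\<dots> \<le> \<gamma> * (\<gamma> * \<rho> * (nz + nh)) + \<gamma> * (\<gamma> * (1 / 2 * \<rho> * U + nz + nh)) + (1 / 2 * dK + \<gamma>\<^sup>2 * (nz + nh))"
    using gamma(1) by (intro add_mono s4 mult_left_mono[OF s2] mult_left_mono[OF s3]) auto
  finally have "1 / 2 * (norm a)\<^sup>2 + \<gamma> * ((\<gamma> - \<beta>) / 2 * inner (z + h) ?G - \<gamma> * inner u (z + h) - inner (K q) (z + h))
     \<le> (5 / 2 * \<rho>\<^sup>2 * \<beta>\<^sup>2 + (\<rho> + 2) * \<gamma>\<^sup>2) * (nz + nh) + 7 / 4 * \<rho> * \<gamma>\<^sup>2 * U + 3 * dK"
    using s1 by (simp add: algebra_simps add_divide_distrib power2_eq_square)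
  from mult_left_mono[OF this, of "\<alpha>\<^sup>2"]
  have second: "\<alpha>\<^sup>2 / 2 * (norm a)\<^sup>2
      + \<alpha>\<^sup>2 * \<gamma> * ((\<gamma> - \<beta>) / 2 * inner (z + h) ?G - \<gamma> * inner u (z + h) - inner (K q) (z + h))
     \<le> \<alpha>\<^sup>2 * ((5 / 2 * \<rho>\<^sup>2 * \<beta>\<^sup>2 + (\<rho> + 2) * \<gamma>\<^sup>2) * (nz + nh) + 7 / 4 * \<rho> * \<gamma>\<^sup>2 * U + 3 * dK)"
    by (simp add: distrib_left mult.assoc)
  have third: "e10 * (\<alpha>\<^sup>2 * ((norm a)\<^sup>2 + N))
     \<le> \<alpha>\<^sup>2 * (4 * e10 * (\<rho>\<^sup>2 * \<beta>\<^sup>2 * (nz + nh) + \<rho> * \<gamma>\<^sup>2 * U + dK)) + \<alpha> * N / 4"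
  proof -
    have "e10 * \<alpha>\<^sup>2 * (norm a)\<^sup>2 \<le> e10 * \<alpha>\<^sup>2 * (4 * (\<rho>\<^sup>2 * \<beta>\<^sup>2 * (nz + nh) + \<rho> * \<gamma>\<^sup>2 * U + dK))"
      using s1' e10 by (intro mult_left_mono) auto
    moreover have "\<alpha> * (\<alpha> * e10) * N \<le> \<alpha> * (1 / 4) * N"
      using e10 alpha N by (intro mult_right_mono mult_left_mono) auto
    ultimately show ?thesis by (simp add: algebra_simps power2_eq_square)
  qed
  \<comment> \<open>All gradient differences are charged to \<open>m\<close>. The second order sum
    7/2 exceeds the 5/2 of \<open>phi2'\<close>; as \<alpha> is small, the excess fits into the
    quarter of \<open>\<alpha> * m\<close> that the first order terms leave over.\<close>
  define m where "m = l\<^sup>2 * nz"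
  have lip: "3 / 4 * \<alpha> * dK + \<alpha> / 2 * dH + \<alpha>\<^sup>2 * (7 / 2 + 4 * e10) * dK \<le> \<alpha> * m + \<alpha>\<^sup>2 * (5 / 2 + 4 * e10) * m"
  proof -
    have m: "dK \<le> m" "dK + dH \<le> m" using dsum nonneg by (simp_all add: m_def)
    have "3 / 4 * \<alpha> * dK + \<alpha> / 2 * dH \<le> 3 / 4 * \<alpha> * (dK + dH)" using alpha nonneg by (simp add: algebra_simps)
    also have "\<dots> \<le> 3 / 4 * \<alpha> * m" using m alpha by (intro mult_left_mono) auto
    finally have 1: "3 / 4 * \<alpha> * dK + \<alpha> / 2 * dH \<le> 3 / 4 * \<alpha> * m" .
    have 2: "\<alpha>\<^sup>2 * (7 / 2 + 4 * e10) * dK \<le> \<alpha>\<^sup>2 * (7 / 2 + 4 * e10) * m"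
      using m e10 by (intro mult_left_mono) auto
    have "\<alpha> * \<alpha> * m \<le> \<alpha> * (1 / 4) * m" using alpha m nonneg by (intro mult_right_mono mult_left_mono) auto
    with 1 2 show ?thesis by (simp add: algebra_simps power2_eq_square)
  qed
  \<comment> \<open>The bound \<gamma> <= \<rho>2 \<beta> / 4 makes the mixed product at most half
    of \<open>\<rho>\<^sup>2 * \<beta>\<^sup>2\<close>, the room between the 5/2 obtained so far and
    the 3 in \<open>phi2'\<close> and \<open>phi8'\<close>.\<close>
  have bg: "\<rho>2 * \<beta> * \<gamma> \<le> 1 / 2 * \<rho>\<^sup>2 * \<beta>\<^sup>2" and bg0: "0 \<le> \<beta> * \<gamma>"
  proof -
    have "\<rho>2 * \<beta> * \<gamma> \<le> \<rho>2 * \<beta> * (\<rho>2 * \<beta> / 4)" using rho2_pos bpos gamma by (intro mult_left_mono) auto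
    also have "\<dots> = 1 / 4 * (\<rho>2\<^sup>2 * \<beta>\<^sup>2)" by (simp add: power2_eq_square)
    also have "\<dots> \<le> 1 / 2 * (\<rho>\<^sup>2 * \<beta>\<^sup>2)"
    proof -
      have "\<rho>2\<^sup>2 * \<beta>\<^sup>2 \<le> \<rho>\<^sup>2 * \<beta>\<^sup>2" using rho2_le rho2_pos by (intro mult_right_mono power_mono) auto
      moreover have "0 \<le> \<rho>\<^sup>2 * \<beta>\<^sup>2" by simp
      ultimately show ?thesis by linarith
    qed
    finally show "\<rho>2 * \<beta> * \<gamma> \<le> 1 / 2 * \<rho>\<^sup>2 * \<beta>\<^sup>2" by simp
    show "0 \<le> \<beta> * \<gamma>" using bpos gamma by simp
  qed
  have "5 / 2 * \<rho>\<^sup>2 * \<beta>\<^sup>2 \<le> 3 * \<rho>\<^sup>2 * \<beta>\<^sup>2 - \<rho>2 * \<beta> * \<gamma>" using bg by linarith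
  then have cz: "\<alpha>\<^sup>2 * (5 / 2 * \<rho>\<^sup>2 * \<beta>\<^sup>2) * nz \<le> \<alpha>\<^sup>2 * (3 * \<rho>\<^sup>2 * \<beta>\<^sup>2 - \<rho>2 * \<beta> * \<gamma>) * nz"
    by (intro mult_right_mono mult_left_mono nonneg zero_le_power2)
  have "\<rho>2 * (\<beta> * \<gamma>) \<le> \<rho> * (\<beta> * \<gamma>)" using rho2_le bg0 by (rule mult_right_mono)
  then have "5 / 2 * \<rho>\<^sup>2 * \<beta>\<^sup>2 \<le> 3 * \<rho>\<^sup>2 * \<beta>\<^sup>2 + (\<rho> - 2 * \<rho>2) * \<beta> * \<gamma>"
    using bg by (simp add: algebra_simps)
  then have ch: "\<alpha>\<^sup>2 * (5 / 2 * \<rho>\<^sup>2 * \<beta>\<^sup>2) * nh \<le> \<alpha>\<^sup>2 * (3 * \<rho>\<^sup>2 * \<beta>\<^sup>2 + (\<rho> - 2 * \<rho>2) * \<beta> * \<gamma>) * nh"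
    by (intro mult_right_mono mult_left_mono nonneg zero_le_power2)
  have cg: "\<beta> + \<gamma> = c * \<gamma>" using c by simp
  have p5: "phi5 \<rho>2 l \<beta> \<gamma> = 1 / 8 - c\<^sup>2 / \<gamma> * X1 - X2 / 2"
    unfolding phi5_def cg X1_def X2_def using gamma rho2_pos
    by (simp add: field_simps power2_eq_square eval_nat_numeral)
  have p6: "phi6 \<rho>2 l \<beta> \<gamma> = c * X1 / 2 + X2 / 2 + \<gamma>\<^sup>2 * X2 / 2 + l\<^sup>2 / 2 + l / 2"
    unfolding phi6_def cg X1_def X2_def using gamma rho2_pos
    by (simp add: field_simps power2_eq_square eval_nat_numeral)
  define ir where "ir = 1 / \<rho>2"
  \<comment> \<open>The constants are not tight. What remains over is 1/8 of the first quantity, 1/2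
    of the second, 3/2 of the third and 1/4 of the fourth.\<close>
  have slack: "0 \<le> \<alpha> * N" "0 \<le> \<alpha> * \<gamma> * nh" "0 \<le> \<alpha> * (1 / \<rho>2) * U" "0 \<le> \<alpha>\<^sup>2 * \<rho> * \<gamma>\<^sup>2 * U"
    using alpha N gamma nonneg rho_pos rho2_pos by simp_all
  have "Q c (z - \<alpha> *\<^sub>R a) (u + (\<alpha> * \<gamma>) *\<^sub>R ?G + D) - Q c z u
      - \<alpha> / 2 * N + \<alpha> / 2 * dH + l * \<alpha>\<^sup>2 / 2 * N + e10 * (\<alpha>\<^sup>2 * ((norm a)\<^sup>2 + N)) - 2 * e12 * nh
    \<le> \<alpha> * ((- \<rho>2 * \<beta> / 2 + 3 * \<gamma> / 2 + 1 / 2) * nz + (\<rho> * \<beta> / 2 + \<gamma> / 2 + \<gamma> * \<rho>) * nh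
         + (1 / \<rho>2 - 3 * \<gamma> / 4) * U + 3 / 4 * dK)
      + \<alpha> * (\<gamma> / 4 * U + c\<^sup>2 / \<gamma> * X1 * N) + \<alpha> * (1 / 2 * nz + X2 / 2 * N)
      + \<alpha>\<^sup>2 * ((5 / 2 * \<rho>\<^sup>2 * \<beta>\<^sup>2 + (\<rho> + 2) * \<gamma>\<^sup>2) * (nz + nh) + 7 / 4 * \<rho> * \<gamma>\<^sup>2 * U + 3 * dK)
      + \<alpha>\<^sup>2 * (nz + nh + l\<^sup>2 / 2 * N) + \<alpha>\<^sup>2 * (1 / 2 * \<rho> * U + \<gamma>\<^sup>2 * X2 / 2 * N)
      + \<alpha>\<^sup>2 * (1 / 2 * dK + X2 / 2 * N) + \<alpha>\<^sup>2 * (c * X1 / 2 * N)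
      - \<alpha> / 2 * N + \<alpha> / 2 * dH + l * \<alpha>\<^sup>2 / 2 * N
      + (\<alpha>\<^sup>2 * (4 * e10 * (\<rho>\<^sup>2 * \<beta>\<^sup>2 * (nz + nh) + \<rho> * \<gamma>\<^sup>2 * U + dK)) + \<alpha> * N / 4) - 2 * e12 * nh"
    using first second third f7 f8 s5 s6 s7 s8
    unfolding Q_step[OF z u D KK c a] nz_def[symmetric] nh_def[symmetric] U_def[symmetric] DP_def[symmetric]
    by linarith
  also have "\<dots> \<le> - \<alpha> * (phi1 \<rho>2 l \<beta> \<gamma> - \<alpha> * phi2' \<rho> \<rho>2 l \<beta> \<gamma> e10) * nz
      - \<alpha> * (phi3 \<rho>2 \<gamma> - \<alpha> * phi4' \<rho> \<gamma> e10) * U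
      - \<alpha> * (phi5 \<rho>2 l \<beta> \<gamma> - \<alpha> * phi6 \<rho>2 l \<beta> \<gamma>) * N
      - (2 * e12 - \<alpha> * phi7 \<rho> \<beta> \<gamma> - \<alpha>\<^sup>2 * phi8' \<rho> \<rho>2 \<beta> \<gamma> e10) * nh"
    using lip cz ch slack
    unfolding p5 p6 phi1_def phi2'_def phi3_def phi4'_def phi7_def phi8'_def m_def ir_def[symmetric]
    by (simp add: algebra_simps add_divide_distrib power2_eq_square)
  finally show ?thesis unfolding nz_def nh_def U_def dH_def .
qed

end

section \<open>Step sizes\<close>

text \<open>The first three entries of \<open>hat_kappa0'\<close> are quotients with positive
  denominators, the fourth is the positive root of a quadratic; each gives one of the last four
  claims. The bounds 1/6 and 1/4 also come from the root.\<close>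

lemma step_size_conditions:
  fixes \<rho> \<rho>2 l r \<delta> \<alpha> \<beta> \<gamma> \<omega> \<tau>1 :: real
  assumes rho: "0 < \<rho>2" "\<rho>2 \<le> \<rho>" and l: "0 < l"
    and r: "0 < r" and d: "0 < \<delta>" "\<delta> \<le> 1" and omega: "0 < \<omega>" "\<omega> \<le> 1 / r"
    and alpha: "0 < \<alpha>" "\<alpha> < hat_kappa0' \<rho> \<rho>2 l \<beta> \<gamma> \<omega> r \<delta>"
    and tau1: "kappa1 \<rho>2 \<le> \<tau>1" and beta: "\<beta> = \<tau>1 * \<gamma>" and gamma: "kappa2 \<rho>2 l < \<gamma>"
  shows "0 < eps9 \<omega> r \<delta>" and "eps9 \<omega> r \<delta> \<le> 1 / 2" and "0 \<le> eps10 \<omega> r \<delta>"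
    and "0 < \<gamma>" and "\<gamma> \<le> \<rho>2 * \<beta> / 4" and "\<alpha> \<le> 1 / 6" and "\<alpha> * eps10 \<omega> r \<delta> \<le> 1 / 4"
    and "0 < phi1 \<rho>2 l \<beta> \<gamma> - \<alpha> * phi2' \<rho> \<rho>2 l \<beta> \<gamma> (eps10 \<omega> r \<delta>)"
    and "0 < phi3 \<rho>2 \<gamma> - \<alpha> * phi4' \<rho> \<gamma> (eps10 \<omega> r \<delta>)"
    and "0 < phi5 \<rho>2 l \<beta> \<gamma> - \<alpha> * phi6 \<rho>2 l \<beta> \<gamma>"
    and "0 < 2 * eps12 \<omega> r \<delta> - \<alpha> * phi7 \<rho> \<beta> \<gamma> - \<alpha>\<^sup>2 * phi8' \<rho> \<rho>2 \<beta> \<gamma> (eps10 \<omega> r \<delta>)"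
proof -
  define e e10 e12 where "e = eps9 \<omega> r \<delta>" and "e10 = eps10 \<omega> r \<delta>" and "e12 = eps12 \<omega> r \<delta>"
  define p2 p4 p6 p7 p8 where "p2 = phi2' \<rho> \<rho>2 l \<beta> \<gamma> e10" and "p4 = phi4' \<rho> \<gamma> e10"
    and "p6 = phi6 \<rho>2 l \<beta> \<gamma>" and "p7 = phi7 \<rho> \<beta> \<gamma>" and "p8 = phi8' \<rho> \<rho>2 \<beta> \<gamma> e10"
  have "\<omega> * r \<le> 1" using omega r by (simp add: field_simps)
  then have wrd: "\<omega> * r * \<delta> \<le> 1 * 1" using d omega r by (intro mult_mono) auto
  have e: "0 < e" "e \<le> 1 / 2" using omega r d wrd by (simp_all add: e_def eps9_def)
  have e10: "0 \<le> e10" using e by (simp add: e10_def eps10_def flip: e_def)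
  have e12: "2 * e12 = e + 2 * e\<^sup>2" by (simp add: e12_def eps12_def flip: e_def)
  have g2: "2 < \<gamma>"
  proof -
    have "2 + 2 * l\<^sup>2 \<le> kappa2 \<rho>2 l" unfolding kappa2_def by (rule Max_ge) auto
    moreover have "0 \<le> l\<^sup>2" by simp
    ultimately show ?thesis using gamma by linarith
  qed
  have b: "\<gamma> \<le> \<rho>2 * \<beta> / 4"
  proof -
    have "4 / \<rho>2 * \<gamma> \<le> \<beta>" unfolding beta using tau1 g2 by (intro mult_right_mono) (auto simp: kappa1_def)
    then show ?thesis using rho by (simp add: field_simps)
  qed
  have bpos: "0 < \<beta>"
  proof -
    have "0 < \<rho>2 * \<beta>" using b g2 by simp
    then show ?thesis using rho by (simp add: zero_less_mult_iff)
  qed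
  have rb: "\<rho>2 * \<beta> \<le> \<rho> * \<beta>" using rho bpos by simp
  have rbg: "\<rho>2 * \<beta> * \<gamma> \<le> \<rho>\<^sup>2 * \<beta>\<^sup>2"
  proof -
    have "\<gamma> \<le> \<rho> * \<beta>" using b rb g2 by linarith
    then have "\<rho>2 * \<beta> * \<gamma> \<le> (\<rho> * \<beta>) * (\<rho> * \<beta>)" using rb bpos rho g2 by (intro mult_mono) auto
    then show ?thesis by (simp add: power2_eq_square mult_ac)
  qed
  have bb: "0 \<le> 4 * e10 * \<rho>\<^sup>2 * \<beta>\<^sup>2" "0 \<le> 4 * e10 * l\<^sup>2" "0 \<le> \<rho>\<^sup>2 * \<beta>\<^sup>2" "0 \<le> \<rho> * \<gamma>\<^sup>2" "0 \<le> \<rho> * \<beta> * \<gamma>" "0 \<le> l\<^sup>2" "0 \<le> \<gamma>\<^sup>2"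
    using e10 rho bpos g2 by simp_all
  have p2pos: "0 < p2"
  proof -
    have "p2 = (3 * (\<rho>\<^sup>2 * \<beta>\<^sup>2) - \<rho>2 * \<beta> * \<gamma>) + 4 * e10 * \<rho>\<^sup>2 * \<beta>\<^sup>2 + \<rho> * \<gamma>\<^sup>2 + 2 * \<gamma>\<^sup>2 + 1 + 5 / 2 * l\<^sup>2 + 4 * e10 * l\<^sup>2"
      by (simp add: p2_def phi2'_def algebra_simps)
    then show ?thesis using rbg bb by linarith
  qed
  have p4pos: "0 < p4"
    using e10 rho g2 by (simp add: p4_def phi4'_def add_nonneg_pos)
  have p6pos: "0 < p6"
    unfolding p6_def phi6_def using bpos g2 rho l by (intro add_nonneg_pos) auto
  have p8pos: "0 < p8"
  proof -
    have "p8 = 3 * (\<rho>\<^sup>2 * \<beta>\<^sup>2) - 2 * (\<rho>2 * \<beta> * \<gamma>) + 4 * e10 * \<rho>\<^sup>2 * \<beta>\<^sup>2 + \<rho> * \<beta> * \<gamma> + \<rho> * \<gamma>\<^sup>2 + 2 * \<gamma>\<^sup>2 + 1"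
      by (simp add: p8_def phi8'_def algebra_simps)
    then show ?thesis using rbg bb by linarith
  qed
  \<comment> \<open>Since \<rho> \<beta> >= 4 \<gamma>, \<open>p7\<close> is at least 3 \<gamma>,
    and \<gamma> exceeds 2.\<close>
  have p7: "6 < p7"
  proof -
    have "4 * \<gamma> \<le> \<rho> * \<beta>" using b rb by simp
    moreover have "0 < \<rho> * \<gamma>" using rho g2 by simp
    ultimately show ?thesis using g2 by (simp add: p7_def phi7_def algebra_simps)
  qed
  have "\<alpha> < Min {phi1 \<rho>2 l \<beta> \<gamma> / p2, phi3 \<rho>2 \<gamma> / p4, phi5 \<rho>2 l \<beta> \<gamma> / p6,
      (sqrt (p7\<^sup>2 + 8 * e12 * p8) - p7) / (2 * p8)}"
    using alpha(2) by (simp add: hat_kappa0'_def Let_def p2_def p4_def p6_def p7_def p8_def e10_def e12_def)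
  then have lt: "\<alpha> < phi1 \<rho>2 l \<beta> \<gamma> / p2" "\<alpha> < phi3 \<rho>2 \<gamma> / p4" "\<alpha> < phi5 \<rho>2 l \<beta> \<gamma> / p6"
    "\<alpha> < (sqrt (p7\<^sup>2 + 8 * e12 * p8) - p7) / (2 * p8)" by simp_all
  \<comment> \<open>\<alpha> lies below the positive root of p8 t^2 + p7 t - 2 e12, whose
    discriminant is p7^2 + 8 e12 p8.\<close>
  have c4: "0 < 2 * e12 - \<alpha> * p7 - \<alpha>\<^sup>2 * p8"
  proof -
    have s: "2 * p8 * \<alpha> + p7 < sqrt (p7\<^sup>2 + 8 * e12 * p8)" using lt(4) p8pos by (simp add: field_simps)
    have nn: "0 \<le> 2 * p8 * \<alpha> + p7" using p8pos alpha p7 by simp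
    have "0 \<le> e + 2 * e\<^sup>2" using e by simp
    then have "0 \<le> p7\<^sup>2 + 8 * e12 * p8" using p8pos e12 by simp
    then have "(2 * p8 * \<alpha> + p7)\<^sup>2 < p7\<^sup>2 + 8 * e12 * p8"
      using power_strict_mono[OF s nn, of 2] by simp
    then have "0 < p8 * (2 * e12 - \<alpha> * p7 - \<alpha>\<^sup>2 * p8)" by (simp add: power2_eq_square algebra_simps)
    then show ?thesis using p8pos by (simp add: zero_less_mult_iff)
  qed
  have ae: "6 * \<alpha> \<le> e + 2 * e\<^sup>2"
  proof -
    have "0 \<le> \<alpha>\<^sup>2 * p8" using p8pos by simp
    moreover have "\<alpha> * 6 \<le> \<alpha> * p7" using p7 alpha by (intro mult_left_mono) auto
    ultimately show ?thesis using c4 e12 by linarith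
  qed
  have ee: "e\<^sup>2 \<le> e / 2" using e mult_left_mono[OF e(2), of e] by (simp add: power2_eq_square)
  show "\<alpha> \<le> 1 / 6" using ae ee e by linarith
  \<comment> \<open>Multiplying \<open>e10\<close> by e + 2 e^2 cancels its pole at 0 and leaves (1
    - 4 e^2) (1 + e), so the bound does not degrade for weak compressors.\<close>
  show "\<alpha> * eps10 \<omega> r \<delta> \<le> 1 / 4"
  proof -
    have "6 * \<alpha> * e10 \<le> (e + 2 * e\<^sup>2) * e10" using ae e10 by (rule mult_right_mono)
    also have "\<dots> = (1 - 4 * e\<^sup>2) * (1 + e)" using e(1)
      by (simp add: e10_def eps10_def flip: e_def) (simp add: field_simps power2_eq_square)
    also have "\<dots> \<le> 1 * (3 / 2)" using e by (intro mult_mono) auto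
    finally show ?thesis by (simp add: e10_def)
  qed
  show "0 < eps9 \<omega> r \<delta>" "eps9 \<omega> r \<delta> \<le> 1 / 2" "0 \<le> eps10 \<omega> r \<delta>"
    using e e10 by (simp_all add: e_def e10_def)
  show "0 < \<gamma>" "\<gamma> \<le> \<rho>2 * \<beta> / 4" using g2 b by simp_all
  show "0 < phi1 \<rho>2 l \<beta> \<gamma> - \<alpha> * phi2' \<rho> \<rho>2 l \<beta> \<gamma> (eps10 \<omega> r \<delta>)"
    using lt(1) p2pos by (simp add: pos_less_divide_eq p2_def e10_def)
  show "0 < phi3 \<rho>2 \<gamma> - \<alpha> * phi4' \<rho> \<gamma> (eps10 \<omega> r \<delta>)"
    using lt(2) p4pos by (simp add: pos_less_divide_eq p4_def e10_def)
  show "0 < phi5 \<rho>2 l \<beta> \<gamma> - \<alpha> * phi6 \<rho>2 l \<beta> \<gamma>"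
    using lt(3) p6pos by (simp add: pos_less_divide_eq p6_def)
  show "0 < 2 * eps12 \<omega> r \<delta> - \<alpha> * phi7 \<rho> \<beta> \<gamma> - \<alpha>\<^sup>2 * phi8' \<rho> \<rho>2 \<beta> \<gamma> (eps10 \<omega> r \<delta>)"
    using c4 by (simp add: e12_def p7_def p8_def e10_def)
qed

section \<open>Gradients of smooth functions\<close>

lemma gradient_eqI:
  fixes F :: "'a::euclidean_space \<Rightarrow> real"
  assumes "GDERIV F x :> D" shows "gradient F x = D"
proof -
  have "D' = D" if "GDERIV F x :> D'" for D'
  proof -
    have "(\<lambda>h. inner h D') = (\<lambda>h. inner h D)"
      using that assms by (auto simp: gderiv_def intro: has_derivative_unique)
    then have "inner h (D' - D) = 0" for h by (metis inner_diff_right right_minus_eq)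
    then show ?thesis by (metis inner_eq_zero_iff right_minus_eq)
  qed
  then show ?thesis unfolding gradient_def using assms by (intro the_equality)
qed

lemma GDERIV_gradient:
  fixes F :: "'a::euclidean_space \<Rightarrow> real"
  assumes "F differentiable (at x)" shows "GDERIV F x :> gradient F x"
proof -
  obtain F' where F': "(F has_derivative F') (at x)" using assms by (auto simp: differentiable_def)
  have lin: "linear F'" using F' by (simp add: has_derivative_linear)
  have "F' h = inner h (\<Sum>b\<in>Basis. F' b *\<^sub>R b)" for h
  proof -
    have "F' h = F' (\<Sum>b\<in>Basis. inner h b *\<^sub>R b)" by (simp add: euclidean_representation)
    also have "\<dots> = (\<Sum>b\<in>Basis. inner h b * F' b)" by (simp add: linear_sum[OF lin] linear_scale[OF lin])
    finally show ?thesis by (simp add: inner_sum_right mult.commute)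
  qed
  then have F'_eq: "F' = (\<lambda>h. inner h (\<Sum>b\<in>Basis. F' b *\<^sub>R b))" by (rule ext)
  have "GDERIV F x :> (\<Sum>b\<in>Basis. F' b *\<^sub>R b)"
    unfolding gderiv_def F'_eq[symmetric] by (rule F')
  then show ?thesis using gradient_eqI by metis
qed

lemma GDERIV_average:
  fixes f :: "'n::finite \<Rightarrow> 'a::real_inner \<Rightarrow> real"
  assumes "\<And>i. GDERIV (f i) x :> D i"
  shows "GDERIV (\<lambda>z. average (\<lambda>i. f i z)) x :> average D"
proof -
  have "((\<lambda>z. (1 / real CARD('n)) *\<^sub>R (\<Sum>i\<in>UNIV. f i z)) has_derivative
      (\<lambda>h. (1 / real CARD('n)) *\<^sub>R (\<Sum>i\<in>UNIV. inner h (D i)))) (at x)"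
    using assms by (intro has_derivative_scaleR_right has_derivative_sum) (auto simp: gderiv_def)
  then show ?thesis by (simp add: gderiv_def average_def inner_sum_right)
qed

text \<open>The descent lemma. Along the segment, the gap between \<open>F\<close> and its quadratic
  model has nonpositive derivative, so no integral of the gradient is formed.\<close>

lemma smooth_upper_bound:
  fixes F :: "'a::real_inner \<Rightarrow> real"
  assumes G: "\<And>z. GDERIV F z :> G z" and lip: "\<And>z z'. norm (G z - G z') \<le> l * norm (z - z')"
  shows "F y \<le> F x + inner (G x) (y - x) + l / 2 * (norm (y - x))\<^sup>2"
proof -
  let ?h = "y - x"
  let ?phi = "\<lambda>t. F (x + t *\<^sub>R ?h) - t * inner (G x) ?h - l / 2 * t\<^sup>2 * (norm ?h)\<^sup>2"
  have "?phi 1 \<le> ?phi 0"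
  proof (rule DERIV_nonpos_imp_nonincreasing[of 0 1 ?phi])
    fix t :: real assume t: "0 \<le> t" "t \<le> 1"
    have "((\<lambda>t. F (x + t *\<^sub>R ?h)) has_derivative (\<lambda>s. inner (s *\<^sub>R ?h) (G (x + t *\<^sub>R ?h)))) (at t)"
      using G[of "x + t *\<^sub>R ?h"] unfolding gderiv_def
      by (rule has_derivative_compose[rotated]) (auto intro!: derivative_eq_intros)
    then have 1: "((\<lambda>t. F (x + t *\<^sub>R ?h)) has_field_derivative inner ?h (G (x + t *\<^sub>R ?h))) (at t)"
      by (simp add: has_field_derivative_def mult.commute[of _ "inner _ _"])
    have "(?phi has_field_derivative (inner ?h (G (x + t *\<^sub>R ?h)) - inner (G x) ?h - l * t * (norm ?h)\<^sup>2)) (at t)"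
      by (auto intro!: derivative_eq_intros 1)
    moreover have "inner ?h (G (x + t *\<^sub>R ?h)) - inner (G x) ?h - l * t * (norm ?h)\<^sup>2 \<le> 0"
    proof -
      have "inner ?h (G (x + t *\<^sub>R ?h)) - inner (G x) ?h = inner ?h (G (x + t *\<^sub>R ?h) - G x)"
        by (simp add: inner_diff_right inner_commute)
      also have "\<dots> \<le> norm ?h * norm (G (x + t *\<^sub>R ?h) - G x)" by (rule norm_cauchy_schwarz)
      also have "\<dots> \<le> norm ?h * (l * norm (t *\<^sub>R ?h))"
        using lip[of "x + t *\<^sub>R ?h" x] by (intro mult_left_mono) auto
      also have "\<dots> = l * t * (norm ?h)\<^sup>2" using t by (simp add: power2_eq_square)
      finally show ?thesis by simp
    qed
    ultimately show "\<exists>d. DERIV ?phi t :> d \<and> d \<le> 0" by blast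
  qed simp
  then show ?thesis by simp
qed

section \<open>Square integrable random vectors and compression\<close>

text \<open>Membership in L2. For a finite measure the class is closed under linear and Lipschitz
  maps, and inner products of members are integrable; integrability of the quadratic Lyapunov terms
  thus reduces to that of the iterates.\<close>

definition sq_integrable :: "'w measure \<Rightarrow> ('w \<Rightarrow> 'a::euclidean_space) \<Rightarrow> bool" where
  "sq_integrable M X \<longleftrightarrow> X \<in> borel_measurable M \<and> integrable M (\<lambda>w. (norm (X w))\<^sup>2)"

lemma sq_integrable_cong:
  "(\<And>w. w \<in> space M \<Longrightarrow> X w = Y w) \<Longrightarrow> sq_integrable M X \<longleftrightarrow> sq_integrable M Y"
  unfolding sq_integrable_def
  by (intro conj_cong measurable_cong Bochner_Integration.integrable_cong) auto

lemma sq_integrable_dominated: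
  assumes "X \<in> borel_measurable M" "integrable M g" "\<And>w. w \<in> space M \<Longrightarrow> (norm (X w))\<^sup>2 \<le> g w"
  shows "sq_integrable M X"
  unfolding sq_integrable_def
proof
  show "integrable M (\<lambda>w. (norm (X w))\<^sup>2)"
  proof (rule Bochner_Integration.integrable_bound[OF assms(2)])
    show "(\<lambda>w. (norm (X w))\<^sup>2) \<in> borel_measurable M" using assms(1) by measurable
    show "AE w in M. norm ((norm (X w))\<^sup>2) \<le> norm (g w)"
    proof (rule AE_I2)
      fix w assume "w \<in> space M"
      then show "norm ((norm (X w))\<^sup>2) \<le> norm (g w)" using assms(3)[of w] by simp
    qed
  qed
qed fact

lemma sq_integrable_add:
  assumes "sq_integrable M X" "sq_integrable M Y"
  shows "sq_integrable M (\<lambda>w. X w + Y w)"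
proof (rule sq_integrable_dominated)
  show "(\<lambda>w. X w + Y w) \<in> borel_measurable M" using assms by (auto simp: sq_integrable_def)
  show "integrable M (\<lambda>w. 2 * (norm (X w))\<^sup>2 + 2 * (norm (Y w))\<^sup>2)" using assms by (auto simp: sq_integrable_def)
  show "(norm (X w + Y w))\<^sup>2 \<le> 2 * (norm (X w))\<^sup>2 + 2 * (norm (Y w))\<^sup>2" for w
  proof -
    have "0 \<le> (norm (X w - Y w))\<^sup>2" by simp
    then show ?thesis by (simp add: power2_norm_eq_inner inner_simps inner_commute)
  qed
qed

lemma sq_integrable_const: "finite_measure M \<Longrightarrow> sq_integrable M (\<lambda>_. a)"
  by (simp add: sq_integrable_def finite_measure.integrable_const)

lemma sq_integrable_linear:
  assumes "linear T" "sq_integrable M X" shows "sq_integrable M (\<lambda>w. T (X w))"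
proof -
  have bl: "bounded_linear T" using assms(1) by (simp add: linear_conv_bounded_linear)
  obtain B where B: "\<And>x. norm (T x) \<le> norm x * B" using bounded_linear.bounded[OF bl] by blast
  show ?thesis
  proof (rule sq_integrable_dominated)
    have "T \<in> borel_measurable borel"
      by (rule borel_measurable_continuous_onI) (rule linear_continuous_on[OF bl])
    then show "(\<lambda>w. T (X w)) \<in> borel_measurable M" using assms(2) by (auto simp: sq_integrable_def)
    show "integrable M (\<lambda>w. (norm (X w))\<^sup>2 * B\<^sup>2)" using assms(2) by (auto simp: sq_integrable_def)
    show "(norm (T (X w)))\<^sup>2 \<le> (norm (X w))\<^sup>2 * B\<^sup>2" for w
      using power_mono[OF B[of "X w"] norm_ge_zero, of 2] by (simp add: power_mult_distrib)
  qed
qed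

lemma sq_integrable_scaleR: "sq_integrable M X \<Longrightarrow> sq_integrable M (\<lambda>w. a *\<^sub>R X w)"
  by (rule sq_integrable_linear[of "\<lambda>x. a *\<^sub>R x"]) (auto simp: linear_iff algebra_simps)

lemma sq_integrable_diff:
  "sq_integrable M X \<Longrightarrow> sq_integrable M Y \<Longrightarrow> sq_integrable M (\<lambda>w. X w - Y w)"
  using sq_integrable_add[of M X "\<lambda>w. (-1) *\<^sub>R Y w"] sq_integrable_scaleR[of M Y "-1"] by simp

lemma sq_integrable_lipschitz:
  assumes fm: "finite_measure M" and X: "sq_integrable M X"
    and lip: "\<And>y z. norm (G y - G z) \<le> l * norm (y - z)"
  shows "sq_integrable M (\<lambda>w. G (X w))"
proof -
  have "continuous_on UNIV G"
  proof (rule continuous_on_iff[THEN iffD2], intro ballI allI impI)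
    fix x and e :: real assume e: "0 < e"
    show "\<exists>d>0. \<forall>x'\<in>UNIV. dist x' x < d \<longrightarrow> dist (G x') (G x) < e"
    proof (intro exI[of _ "e / (\<bar>l\<bar> + 1)"] conjI ballI impI)
      show "0 < e / (\<bar>l\<bar> + 1)" using e by simp
      fix y assume d: "dist y x < e / (\<bar>l\<bar> + 1)"
      have "dist (G y) (G x) \<le> (\<bar>l\<bar> + 1) * dist y x"
        unfolding dist_norm by (rule order_trans[OF lip mult_right_mono]) auto
      also have "\<dots> < e" using d by (simp add: pos_less_divide_eq mult.commute)
      finally show "dist (G y) (G x) < e" .
    qed
  qed
  then have meas: "G \<in> borel_measurable borel" by (rule borel_measurable_continuous_onI)
  have "sq_integrable M (\<lambda>w. G (X w) - G 0)"
  proof (rule sq_integrable_dominated)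
    show "(\<lambda>w. G (X w) - G 0) \<in> borel_measurable M" using meas X by (auto simp: sq_integrable_def)
    show "integrable M (\<lambda>w. l\<^sup>2 * (norm (X w))\<^sup>2)" using X by (auto simp: sq_integrable_def)
    show "(norm (G (X w) - G 0))\<^sup>2 \<le> l\<^sup>2 * (norm (X w))\<^sup>2" for w
      using power_mono[OF lip[of "X w" 0] norm_ge_zero, of 2] by (simp add: power_mult_distrib)
  qed
  from sq_integrable_add[OF this sq_integrable_const[OF fm, of "G 0"]] show ?thesis by simp
qed

lemma integrable_inner_sq_integrable:
  assumes X: "sq_integrable M X" and Y: "sq_integrable M Y"
  shows "integrable M (\<lambda>w. inner (X w) (Y w))"
proof (rule Bochner_Integration.integrable_bound)
  show "integrable M (\<lambda>w. (norm (X w))\<^sup>2 + (norm (Y w))\<^sup>2)" using assms by (auto simp: sq_integrable_def)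
  show "(\<lambda>w. inner (X w) (Y w)) \<in> borel_measurable M" using assms by (auto simp: sq_integrable_def)
  show "AE w in M. norm (inner (X w) (Y w)) \<le> norm ((norm (X w))\<^sup>2 + (norm (Y w))\<^sup>2)"
  proof (rule AE_I2)
    fix w
    have "\<bar>inner (X w) (Y w)\<bar> \<le> norm (X w) * norm (Y w)" by (rule Cauchy_Schwarz_ineq2)
    also have "\<dots> \<le> (norm (X w))\<^sup>2 + (norm (Y w))\<^sup>2"
      using sum_squares_bound[of "norm (X w)" "norm (Y w)"]
        mult_nonneg_nonneg[OF norm_ge_zero[of "X w"] norm_ge_zero[of "Y w"]] by linarith
    finally show "norm (inner (X w) (Y w)) \<le> norm ((norm (X w))\<^sup>2 + (norm (Y w))\<^sup>2)" by simp
  qed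
qed

lemma sq_integrable_vec:
  fixes X :: "'w \<Rightarrow> (real ^ 'd) ^ 'n"
  assumes "\<And>i. sq_integrable M (\<lambda>w. X w $ i)"
  shows "sq_integrable M X"
proof -
  have n: "(norm (X w))\<^sup>2 = (\<Sum>i\<in>UNIV. (norm (X w $ i))\<^sup>2)" for w
    by (simp add: power2_norm_eq_inner inner_vec_def)
  have "X \<in> borel_measurable M"
  proof (subst borel_measurable_euclidean_space, intro ballI)
    fix b :: "(real ^ 'd) ^ 'n" assume "b \<in> Basis"
    have "(\<lambda>w. X w $ i) \<in> borel_measurable M" for i using assms by (simp add: sq_integrable_def)
    then have "(\<lambda>w. \<Sum>i\<in>UNIV. inner (X w $ i) (b $ i)) \<in> borel_measurable M"
      by (intro borel_measurable_sum borel_measurable_inner borel_measurable_const)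
    then show "(\<lambda>w. inner (X w) b) \<in> borel_measurable M" by (simp add: inner_vec_def)
  qed
  then show ?thesis using assms by (auto simp: sq_integrable_def n)
qed

text \<open>Independence makes the joint law of seed and argument a product, and Fubini lets the
  compressor inequality be applied for each frozen argument. Nonnegative integrals are used until
  the bound is known, since integrability of the error is part of the claim.\<close>

lemma compressor_second_moment:
  fixes Cmp :: "'s \<Rightarrow> real ^ 'd \<Rightarrow> real ^ 'd"
  assumes gb: "globally_bounded_compressor D Cmp r \<delta> C" and M: "prob_space M"
    and zeta: "\<zeta> \<in> measurable M D" "distr M D \<zeta> = D"
    and indep: "prob_space.indep_set M {\<zeta> -` S \<inter> space M | S. S \<in> sets D} {z -` B \<inter> space M | B. B \<in> sets borel}"
    and z: "sq_integrable M z" and d: "\<delta> \<le> 1" and C: "0 \<le> C"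
  shows "sq_integrable M (\<lambda>w. (1 / r) *\<^sub>R Cmp (\<zeta> w) (z w) - z w)"
    and "(\<integral>w. (norm ((1 / r) *\<^sub>R Cmp (\<zeta> w) (z w) - z w))\<^sup>2 \<partial>M) \<le> (1 - \<delta>) * (\<integral>w. (norm (z w))\<^sup>2 \<partial>M) + C"
proof -
  interpret M: prob_space M by fact
  have D: "prob_space D" and Cm: "(\<lambda>(\<zeta>, x). Cmp \<zeta> x) \<in> borel_measurable (D \<Otimes>\<^sub>M borel)"
    and int: "\<And>x. integrable D (\<lambda>\<zeta>. (norm ((1 / r) *\<^sub>R Cmp \<zeta> x - x))\<^sup>2)"
    and le: "\<And>x. (\<integral>\<zeta>. (norm ((1 / r) *\<^sub>R Cmp \<zeta> x - x))\<^sup>2 \<partial>D) \<le> (1 - \<delta>) * (norm x)\<^sup>2 + C"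
    using gb by (auto simp: globally_bounded_compressor_def)
  have zm [measurable]: "z \<in> borel_measurable M" and z2: "integrable M (\<lambda>w. (norm (z w))\<^sup>2)"
    using z by (auto simp: sq_integrable_def)
  have zetam [measurable]: "\<zeta> \<in> measurable M D" by fact
  let ?Z = "distr M borel z"
  interpret D: prob_space D by fact
  interpret Z: prob_space ?Z by (rule M.prob_space_distr) simp
  interpret DZ: pair_sigma_finite D ?Z ..
  define \<phi> where "\<phi> p = ennreal ((norm ((1 / r) *\<^sub>R (case p of (\<zeta>, x) \<Rightarrow> Cmp \<zeta> x) - snd p))\<^sup>2)" for p
  have phi_m [measurable]: "\<phi> \<in> borel_measurable (D \<Otimes>\<^sub>M borel)" unfolding \<phi>_def using Cm by measurable
  have phi_m': "\<phi> \<in> borel_measurable (D \<Otimes>\<^sub>M ?Z)"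
    by (subst measurable_cong_sets[OF sets_pair_measure_cong[OF refl sets_distr] refl]) (rule phi_m)
  have pair: "distr M (D \<Otimes>\<^sub>M borel) (\<lambda>w. (\<zeta> w, z w)) = D \<Otimes>\<^sub>M ?Z"
  proof (rule sym, rule pair_measure_eqI)
    show "sigma_finite_measure D" "sigma_finite_measure ?Z" by unfold_locales
    show "sets (D \<Otimes>\<^sub>M ?Z) = sets (distr M (D \<Otimes>\<^sub>M borel) (\<lambda>w. (\<zeta> w, z w)))"
      by (simp cong: sets_pair_measure_cong)
    fix S B assume S: "S \<in> sets D" and B: "B \<in> sets ?Z"
    then have B': "B \<in> sets borel" by simp
    have "emeasure D S = emeasure (distr M D \<zeta>) S" by (simp add: zeta(2))
    also have "\<dots> = ennreal (M.prob (\<zeta> -` S \<inter> space M))"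
      using S by (simp add: emeasure_distr M.emeasure_eq_measure)
    finally have 1: "emeasure D S = ennreal (M.prob (\<zeta> -` S \<inter> space M))" .
    have 2: "emeasure ?Z B = ennreal (M.prob (z -` B \<inter> space M))"
      using B' by (simp add: emeasure_distr M.emeasure_eq_measure)
    have "M.prob ((\<zeta> -` S \<inter> space M) \<inter> (z -` B \<inter> space M)) = M.prob (\<zeta> -` S \<inter> space M) * M.prob (z -` B \<inter> space M)"
      by (rule M.indep_setD[OF indep]) (use S B' in blast)+
    moreover have "(\<lambda>w. (\<zeta> w, z w)) -` (S \<times> B) \<inter> space M = (\<zeta> -` S \<inter> space M) \<inter> (z -` B \<inter> space M)" by auto
    ultimately show "emeasure D S * emeasure ?Z B = emeasure (distr M (D \<Otimes>\<^sub>M borel) (\<lambda>w. (\<zeta> w, z w))) (S \<times> B)"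
      using S B' 1 2 by (simp add: emeasure_distr M.emeasure_eq_measure ennreal_mult)
  qed
  let ?E = "\<lambda>w. (1 / r) *\<^sub>R Cmp (\<zeta> w) (z w) - z w"
  have Cmeas: "(\<lambda>w. Cmp (\<zeta> w) (z w)) \<in> borel_measurable M"
    using measurable_compose[of "\<lambda>w. (\<zeta> w, z w)" M, OF _ Cm] by simp
  then have meas: "?E \<in> borel_measurable M" by measurable
  have "(\<integral>\<^sup>+w. ennreal ((norm (?E w))\<^sup>2) \<partial>M) = (\<integral>\<^sup>+w. \<phi> (\<zeta> w, z w) \<partial>M)" by (simp add: \<phi>_def)
  also have "\<dots> = (\<integral>\<^sup>+p. \<phi> p \<partial>distr M (D \<Otimes>\<^sub>M borel) (\<lambda>w. (\<zeta> w, z w)))"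
    by (subst nn_integral_distr) auto
  also have "\<dots> = (\<integral>\<^sup>+x. (\<integral>\<^sup>+\<zeta>. \<phi> (\<zeta>, x) \<partial>D) \<partial>?Z)"
    unfolding pair by (rule DZ.nn_integral_snd[symmetric]) (rule phi_m')
  also have "\<dots> \<le> (\<integral>\<^sup>+x. ennreal ((1 - \<delta>) * (norm x)\<^sup>2 + C) \<partial>?Z)"
  proof (rule nn_integral_mono)
    fix x
    have "(\<integral>\<^sup>+\<zeta>. \<phi> (\<zeta>, x) \<partial>D) = ennreal (\<integral>\<zeta>. (norm ((1 / r) *\<^sub>R Cmp \<zeta> x - x))\<^sup>2 \<partial>D)"
      unfolding \<phi>_def by (simp only: prod.case snd_conv) (rule nn_integral_eq_integral[OF int], simp)
    also have "\<dots> \<le> ennreal ((1 - \<delta>) * (norm x)\<^sup>2 + C)" by (rule ennreal_leI[OF le])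
    finally show "(\<integral>\<^sup>+\<zeta>. \<phi> (\<zeta>, x) \<partial>D) \<le> ennreal ((1 - \<delta>) * (norm x)\<^sup>2 + C)" .
  qed
  also have "\<dots> = (\<integral>\<^sup>+w. ennreal ((1 - \<delta>) * (norm (z w))\<^sup>2 + C) \<partial>M)"
    by (subst nn_integral_distr) auto
  also have "\<dots> = ennreal (\<integral>w. (1 - \<delta>) * (norm (z w))\<^sup>2 + C \<partial>M)"
    using z2 d C by (intro nn_integral_eq_integral) auto
  also have "(\<integral>w. (1 - \<delta>) * (norm (z w))\<^sup>2 + C \<partial>M) = (1 - \<delta>) * (\<integral>w. (norm (z w))\<^sup>2 \<partial>M) + C"
    using z2 by (simp add: M.prob_space)
  finally have bound: "(\<integral>\<^sup>+w. ennreal ((norm (?E w))\<^sup>2) \<partial>M) \<le> ennreal ((1 - \<delta>) * (\<integral>w. (norm (z w))\<^sup>2 \<partial>M) + C)" .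
  have "(\<integral>\<^sup>+w. ennreal (norm ((norm (?E w))\<^sup>2)) \<partial>M) < \<infinity>"
    using le_less_trans[OF bound ennreal_less_top] by simp
  then have inte: "integrable M (\<lambda>w. (norm (?E w))\<^sup>2)"
    using meas by (intro integrableI_bounded) auto
  then show "sq_integrable M ?E" using meas by (simp add: sq_integrable_def)
  have "ennreal (\<integral>w. (norm (?E w))\<^sup>2 \<partial>M) \<le> ennreal ((1 - \<delta>) * (\<integral>w. (norm (z w))\<^sup>2 \<partial>M) + C)"
    using bound by (subst nn_integral_eq_integral[OF inte, symmetric]) auto
  moreover have "0 \<le> (1 - \<delta>) * (\<integral>w. (norm (z w))\<^sup>2 \<partial>M) + C" using d C by simp
  ultimately show "(\<integral>w. (norm (?E w))\<^sup>2 \<partial>M) \<le> (1 - \<delta>) * (\<integral>w. (norm (z w))\<^sup>2 \<partial>M) + C"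
    by (simp add: ennreal_le_iff)
qed

text \<open>The new error is the convex combination, with weight \<open>\<omega> * r\<close>, of the
  old error and -s times the compressor error; \<omega> <= 1 / r is what makes it convex. Scaling by
  s turns the constant C into C s^2, and the factors combine to 1 - \<omega> r + \<omega> r (1 -
  \<delta>).\<close>

lemma compression_error_contraction:
  fixes Cmp :: "'s \<Rightarrow> real ^ 'd \<Rightarrow> real ^ 'd"
  assumes gb: "globally_bounded_compressor D Cmp r \<delta> C" and M: "prob_space M"
    and zeta: "\<zeta> \<in> measurable M D" "distr M D \<zeta> = D"
    and indep: "prob_space.indep_set M {\<zeta> -` S \<inter> space M | S. S \<in> sets D}
      {(\<lambda>w. (1 / s) *\<^sub>R e w) -` B \<inter> space M | B. B \<in> sets borel}"
    and e: "sq_integrable M e" and d: "\<delta> \<le> 1" and C: "0 \<le> C"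
    and r: "0 < r" and omega: "0 < \<omega>" "\<omega> \<le> 1 / r" and s: "0 < s"
  shows "sq_integrable M (\<lambda>w. e w - (\<omega> * s) *\<^sub>R Cmp (\<zeta> w) ((1 / s) *\<^sub>R e w))"
    and "(\<integral>w. (norm (e w - (\<omega> * s) *\<^sub>R Cmp (\<zeta> w) ((1 / s) *\<^sub>R e w)))\<^sup>2 \<partial>M)
      \<le> (1 - \<omega> * r * \<delta>) * (\<integral>w. (norm (e w))\<^sup>2 \<partial>M) + \<omega> * r * C * s\<^sup>2"
proof -
  let ?z = "\<lambda>w. (1 / s) *\<^sub>R e w"
  let ?E = "\<lambda>w. (1 / r) *\<^sub>R Cmp (\<zeta> w) (?z w) - ?z w"
  let ?H = "\<lambda>w. e w - (\<omega> * s) *\<^sub>R Cmp (\<zeta> w) (?z w)"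
  note m = compressor_second_moment[OF gb M zeta indep sq_integrable_scaleR[OF e] d C]
  have e2: "integrable M (\<lambda>w. (norm (e w))\<^sup>2)" and E2: "integrable M (\<lambda>w. (norm (?E w))\<^sup>2)"
    using e m(1) by (auto simp: sq_integrable_def)
  have H: "?H w = (1 - \<omega> * r) *\<^sub>R e w + (\<omega> * r) *\<^sub>R (- s *\<^sub>R ?E w)" for w
    using r s by (simp add: algebra_simps)
  have wr: "0 \<le> \<omega> * r" "\<omega> * r \<le> 1" using r omega by (simp_all add: field_simps)
  show sq: "sq_integrable M ?H" unfolding H
    by (intro sq_integrable_add sq_integrable_scaleR e m(1))
  have pt: "(norm (?H w))\<^sup>2 \<le> (1 - \<omega> * r) * (norm (e w))\<^sup>2 + \<omega> * r * (s\<^sup>2 * (norm (?E w))\<^sup>2)" for w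
    using norm_sq_convex[OF wr, of "e w" "- s *\<^sub>R ?E w"] unfolding H
    by (simp only: norm_scaleR power_mult_distrib power2_abs power2_minus)
  have "(\<integral>w. (norm (?H w))\<^sup>2 \<partial>M) \<le> (\<integral>w. (1 - \<omega> * r) * (norm (e w))\<^sup>2 + \<omega> * r * (s\<^sup>2 * (norm (?E w))\<^sup>2) \<partial>M)"
    using sq e2 E2 pt by (intro integral_mono) (auto simp: sq_integrable_def)
  also have "\<dots> = (1 - \<omega> * r) * (\<integral>w. (norm (e w))\<^sup>2 \<partial>M) + \<omega> * r * (s\<^sup>2 * (\<integral>w. (norm (?E w))\<^sup>2 \<partial>M))"
    using e2 E2 by (subst Bochner_Integration.integral_add) auto
  also have "\<dots> \<le> (1 - \<omega> * r) * (\<integral>w. (norm (e w))\<^sup>2 \<partial>M)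
      + \<omega> * r * (s\<^sup>2 * ((1 - \<delta>) * (\<integral>w. (norm (?z w))\<^sup>2 \<partial>M) + C))"
    using m(2) wr by (intro add_left_mono mult_left_mono) auto
  also have "(\<integral>w. (norm (?z w))\<^sup>2 \<partial>M) = (\<integral>w. (norm (e w))\<^sup>2 \<partial>M) / s\<^sup>2"
    using s by (simp add: power_divide)
  also have "(1 - \<omega> * r) * (\<integral>w. (norm (e w))\<^sup>2 \<partial>M) + \<omega> * r * (s\<^sup>2 * ((1 - \<delta>) * ((\<integral>w. (norm (e w))\<^sup>2 \<partial>M) / s\<^sup>2) + C))
     = (1 - \<omega> * r * \<delta>) * (\<integral>w. (norm (e w))\<^sup>2 \<partial>M) + \<omega> * r * C * s\<^sup>2"
    using s by (simp add: field_simps)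
  finally show "(\<integral>w. (norm (?H w))\<^sup>2 \<partial>M) \<le> (1 - \<omega> * r * \<delta>) * (\<integral>w. (norm (e w))\<^sup>2 \<partial>M) + \<omega> * r * C * s\<^sup>2" .
qed

lemma linear_vec_nth: "linear (\<lambda>X :: 'a::real_vector ^ 'n. X $ i)"
  by (simp add: linear_iff)

section \<open>Pathwise Lyapunov descent\<close>

lemma laplacian_operator_laplacian:
  fixes A :: "real ^ 'n ^ 'n"
  assumes "2 \<le> CARD('n)" "undirected_weights A" "connected_graph A"
  shows "laplacian_operator (stack_mult (laplacian A) :: (real ^ 'd) ^ 'n \<Rightarrow> (real ^ 'd) ^ 'n) centered
    (spectral_radius (laplacian A)) (least_pos_eigenvalue (laplacian A))"
proof (rule laplacian_operator.intro)
  fix X Y :: "(real ^ 'd) ^ 'n"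
  let ?L = "stack_mult (laplacian A) :: (real ^ 'd) ^ 'n \<Rightarrow> (real ^ 'd) ^ 'n"
  show "linear ?L" "linear (centered :: (real ^ 'd) ^ 'n \<Rightarrow> (real ^ 'd) ^ 'n)"
    by (rule linear_stack_mult linear_centered)+
  show "inner (?L X) Y = inner X (?L Y)"
    by (rule stack_mult_sym[OF transpose_laplacian[OF assms(2)]])
  show "inner (centered X) Y = inner X (centered Y)"
    by (simp add: centered_def inner_simps consensus_sym)
  show "centered (centered X) = centered X"
    by (simp add: centered_def linear_diff[OF linear_consensus])
  show "?L (centered X) = ?L X"
    by (simp add: centered_def linear_diff[OF linear_stack_mult] laplacian_consensus)
  show "centered (?L X) = ?L X" by (simp add: centered_def consensus_laplacian[OF assms(2)])
qed (rule laplacian_spectral_bounds[OF assms])+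

locale unified_compression =
  fixes A :: "real ^ 'n ^ 'n"
    and f :: "'n \<Rightarrow> real ^ 'd \<Rightarrow> real"
    and F :: "real ^ 'd \<Rightarrow> real"
    and l \<rho> \<rho>2 r \<delta> \<alpha> \<beta> \<gamma> \<omega> \<tau>1 :: real
  assumes agents: "2 \<le> CARD('n)"
    and und: "undirected_weights A" and con: "connected_graph A"
    and rho: "\<rho> = spectral_radius (laplacian A)"
    and rho2: "\<rho>2 = least_pos_eigenvalue (laplacian A)"
    and diff: "\<And>i z. f i differentiable (at z)"
    and l_pos: "0 < l"
    and smooth: "\<And>i z z'. norm (gradient (f i) z - gradient (f i) z') \<le> l * norm (z - z')"
    and F_def: "F = (\<lambda>z. average (\<lambda>i. f i z))"
    and F_bdd: "bdd_below (range F)"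
    and r_pos: "0 < r" and delta: "0 < \<delta>" "\<delta> \<le> 1"
    and alpha: "0 < \<alpha>" "\<alpha> < hat_kappa0' \<rho> \<rho>2 l \<beta> \<gamma> \<omega> r \<delta>"
    and tau1: "kappa1 \<rho>2 \<le> \<tau>1"
    and beta: "\<beta> = \<tau>1 * \<gamma>"
    and gamma: "kappa2 \<rho>2 l < \<gamma>"
    and omega: "0 < \<omega>" "\<omega> \<le> 1 / r"
begin

abbreviation L :: "(real ^ 'd) ^ 'n \<Rightarrow> (real ^ 'd) ^ 'n" where "L \<equiv> stack_mult (laplacian A)"

sublocale lap: laplacian_operator L centered \<rho> \<rho>2
  unfolding rho rho2 by (rule laplacian_operator_laplacian[OF agents und con])

lemmas steps = step_size_conditions[OF lap.rho2_pos lap.rho2_le l_pos r_pos delta omega alpha tau1 beta gamma]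

abbreviation "e9 \<equiv> eps9 \<omega> r \<delta>"
abbreviation "e10 \<equiv> eps10 \<omega> r \<delta>"
abbreviation "e12 \<equiv> eps12 \<omega> r \<delta>"
abbreviation "Finf \<equiv> (INF z. F z)"

section \<open>Stacked gradients and the Lyapunov function\<close>

definition grads :: "(real ^ 'd) ^ 'n \<Rightarrow> (real ^ 'd) ^ 'n" where
  "grads X = (\<chi> i. gradient (f i) (X $ i))"

definition mean :: "(real ^ 'd) ^ 'n \<Rightarrow> real ^ 'd" where
  "mean X = average (\<lambda>i. X $ i)"

text \<open>Distance of \<open>V\<close> from the value that would balance the local gradients at
  the current average. Gradients are taken at the average rather than at \<open>X\<close>, so this
  reference moves only when the average does.\<close>

definition dual :: "(real ^ 'd) ^ 'n \<Rightarrow> (real ^ 'd) ^ 'n \<Rightarrow> (real ^ 'd) ^ 'n" where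
  "dual X V = V + (1 / \<gamma>) *\<^sub>R centered (grads (consensus X))"

definition lyap :: "(real ^ 'd) ^ 'n \<Rightarrow> (real ^ 'd) ^ 'n \<Rightarrow> real" where
  "lyap X V = lap.Q ((\<beta> + \<gamma>) / \<gamma>) (centered X) (dual X V) + real CARD('n) * (F (mean X) - Finf)"

text \<open>The gradients are taken at the agents' own points, since their average is what moves the
  mean; \<open>residual_le_stationarity\<close> passes to the gradient at the mean.\<close>

definition stationarity :: "(real ^ 'd) ^ 'n \<Rightarrow> real" where
  "stationarity X = (norm (centered X))\<^sup>2 + (norm (consensus (grads X)))\<^sup>2"

definition decrease :: real where
  "decrease = \<alpha> * min (phi1 \<rho>2 l \<beta> \<gamma> - \<alpha> * phi2' \<rho> \<rho>2 l \<beta> \<gamma> e10) (phi5 \<rho>2 l \<beta> \<gamma> - \<alpha> * phi6 \<rho>2 l \<beta> \<gamma>)"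

lemma decrease_pos: "0 < decrease"
  using alpha steps by (simp add: decrease_def)

lemma linear_mean: "linear mean"
  by (auto simp: linear_iff mean_def average_def scaleR_right_distrib sum.distrib scaleR_sum_right
      intro!: sum.cong)

lemma inner_consensus_mean: "inner (consensus X) (consensus Y) = real CARD('n) * inner (mean X) (mean Y)"
  by (simp add: inner_consensus mean_def)

lemma norm_consensus_mean: "(norm (consensus X))\<^sup>2 = real CARD('n) * (norm (mean X))\<^sup>2"
  by (simp add: power2_norm_eq_inner inner_consensus_mean)

lemma GDERIV_F: "GDERIV F z :> average (\<lambda>i. gradient (f i) z)"
  unfolding F_def by (rule GDERIV_average[OF GDERIV_gradient[OF diff]])

lemma gradient_F: "gradient F z = average (\<lambda>i. gradient (f i) z)"
  by (rule gradient_eqI[OF GDERIV_F])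

lemma gradient_F_mean: "gradient F (mean X) = mean (grads (consensus X))"
  by (simp add: gradient_F mean_def grads_def consensus_def)

lemma gradient_F_lipschitz: "norm (gradient F z - gradient F z') \<le> l * norm (z - z')"
proof -
  have "gradient F z - gradient F z' = (1 / real CARD('n)) *\<^sub>R (\<Sum>i\<in>UNIV. gradient (f i) z - gradient (f i) z')"
    by (simp add: gradient_F average_def sum_subtractf scaleR_diff_right)
  also have "norm \<dots> = (1 / real CARD('n)) * norm (\<Sum>i\<in>UNIV. gradient (f i) z - gradient (f i) z')" by simp
  also have "\<dots> \<le> (1 / real CARD('n)) * (\<Sum>i\<in>(UNIV::'n set). l * norm (z - z'))"
    by (intro mult_left_mono sum_norm_le smooth) auto
  finally show ?thesis by simp
qed

lemma F_upper: "F z' \<le> F z + inner (gradient F z) (z' - z) + l / 2 * (norm (z' - z))\<^sup>2"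
  by (rule smooth_upper_bound[OF GDERIV_F[folded gradient_F] gradient_F_lipschitz])

lemma Finf_le: "Finf \<le> F z"
  using F_bdd by (simp add: cINF_lower)

lemma grads_lipschitz_sq: "(norm (grads X - grads Y))\<^sup>2 \<le> l\<^sup>2 * (norm (X - Y))\<^sup>2"
proof -
  have "(norm (gradient (f i) (X $ i) - gradient (f i) (Y $ i)))\<^sup>2 \<le> l\<^sup>2 * (norm (X $ i - Y $ i))\<^sup>2" for i
    using power_mono[OF smooth[of i "X $ i" "Y $ i"] norm_ge_zero, of 2] by (simp add: power_mult_distrib)
  then show ?thesis by (simp add: norm_sq_vec grads_def sum_distrib_left sum_mono)
qed

lemma grads_lipschitz: "norm (grads X - grads Y) \<le> l * norm (X - Y)"
proof (rule power2_le_imp_le)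
  show "(norm (grads X - grads Y))\<^sup>2 \<le> (l * norm (X - Y))\<^sup>2"
    unfolding power_mult_distrib by (rule grads_lipschitz_sq)
  show "0 \<le> l * norm (X - Y)" using l_pos by simp
qed

lemma lyap_ge: "real CARD('n) * (F (mean X) - Finf) \<le> lyap X V"
proof -
  have "1 / \<rho>2 \<le> (\<beta> + \<gamma>) / \<gamma>"
  proof -
    have "1 / \<rho>2 \<le> \<beta> / \<gamma>" using steps(4,5) lap.rho2_pos by (simp add: field_simps)
    then show ?thesis using steps(4) by (simp add: add_divide_distrib)
  qed
  from lap.Q_nonneg[OF this] show ?thesis by (simp add: lyap_def)
qed

text \<open>Descent lemma for the mean, multiplied by the number of agents to match stacked norms.
  The step uses the average of the local gradients, not the gradient at the mean; polarising their
  inner product leaves their difference as the error, and the square of the latter gradient is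
  dropped.\<close>

lemma objective_step:
  assumes "mean X' = mean X - \<alpha> *\<^sub>R mean (grads X)"
  shows "real CARD('n) * F (mean X') \<le> real CARD('n) * F (mean X) - \<alpha> / 2 * (norm (consensus (grads X)))\<^sup>2
     + \<alpha> / 2 * (norm (consensus (grads X - grads (consensus X))))\<^sup>2
     + l * \<alpha>\<^sup>2 / 2 * (norm (consensus (grads X)))\<^sup>2"
proof -
  let ?g = "mean (grads X)" and ?h = "mean (grads (consensus X))"
  have "F (mean X') \<le> F (mean X) - \<alpha> * inner ?h ?g + l * \<alpha>\<^sup>2 / 2 * (norm ?g)\<^sup>2"
    using F_upper[of "mean X'" "mean X"] by (simp add: assms gradient_F_mean power_mult_distrib)
  moreover have "- inner ?h ?g \<le> - 1 / 2 * (norm ?g)\<^sup>2 + 1 / 2 * (norm (?g - ?h))\<^sup>2"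
    using inner_ge_zero[of ?h]
    by (simp add: power2_norm_eq_inner inner_simps inner_commute add_divide_distrib diff_divide_distrib)
  from mult_left_mono[OF this less_imp_le[OF alpha(1)]]
  have "- \<alpha> * inner ?h ?g \<le> - \<alpha> / 2 * (norm ?g)\<^sup>2 + \<alpha> / 2 * (norm (?g - ?h))\<^sup>2"
    by (simp add: algebra_simps)
  ultimately have "F (mean X') \<le> F (mean X) - \<alpha> / 2 * (norm ?g)\<^sup>2 + \<alpha> / 2 * (norm (?g - ?h))\<^sup>2
      + l * \<alpha>\<^sup>2 / 2 * (norm ?g)\<^sup>2" by simp
  from mult_left_mono[OF this, of "real CARD('n)"] show ?thesis
    by (simp add: norm_consensus_mean linear_diff[OF linear_mean] algebra_simps)
qed

text \<open>Holds for every estimate \<open>Xh\<close>, whatever the compressor did. The weight 1 -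
  2 * \<open>e9\<close> on the left is the contraction that the next compression achieves in
  expectation, so the two inequalities chain.\<close>

lemma lyap_step:
  assumes V: "consensus V = 0"
    and X': "X' = X - \<alpha> *\<^sub>R (\<beta> *\<^sub>R L Xh + \<gamma> *\<^sub>R V + grads X)"
    and V': "V' = V + (\<alpha> * \<gamma>) *\<^sub>R L Xh"
  shows "lyap X' V' + (1 - 2 * e9) * (norm (X' - Xh))\<^sup>2
    \<le> lyap X V + (norm (X - Xh))\<^sup>2 - decrease * stationarity X"
proof -
  define c z h g0 q u D a where "c = (\<beta> + \<gamma>) / \<gamma>" and "z = centered X" and "h = Xh - X"
    and "g0 = grads (consensus X)" and "q = grads X - g0" and "u = dual X V"
    and "D = (1 / \<gamma>) *\<^sub>R centered (grads (consensus X') - g0)"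
    and "a = \<beta> *\<^sub>R L z + \<beta> *\<^sub>R L h + \<gamma> *\<^sub>R u + centered q"
  define N where "N = (norm (consensus (grads X)))\<^sup>2"
  have g: "0 < \<gamma>" by (rule steps(4))
  have KV: "centered V = V" by (simp add: centered_def V)
  have Kz: "centered z = z" and KD: "centered D = D" and Ku: "centered u = u"
    by (simp_all add: z_def D_def u_def dual_def lap.lin_simps KV)
  have LXh: "L Xh = L (z + h)" by (simp add: z_def h_def lap.lin_simps)
  have Ka: "centered a = a" by (simp add: a_def lap.lin_simps Ku)
  have gu: "\<gamma> *\<^sub>R u = \<gamma> *\<^sub>R V + centered g0"
    using g by (simp add: u_def dual_def g0_def algebra_simps)
  \<comment> \<open>The direction decomposes orthogonally: \<open>a\<close> moves only the
    disagreement, the averaged gradient only the mean.\<close>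
  have split: "\<beta> *\<^sub>R L Xh + \<gamma> *\<^sub>R V + grads X = a + consensus (grads X)"
  proof -
    have "grads X = centered g0 + centered q + consensus (grads X)"
      by (simp add: q_def lap.lin_simps centered_def[of "grads X"])
    then show ?thesis
      unfolding a_def gu LXh by (simp add: lap.lin_simps algebra_simps)
  qed
  have X'_eq: "X' = X - \<alpha> *\<^sub>R (a + consensus (grads X))" unfolding X' split ..
  have cen_cons: "centered (consensus Y) = 0" for Y :: "(real ^ 'd) ^ 'n"
    by (simp add: centered_def)
  have cons_cen: "consensus (centered Y) = 0" for Y :: "(real ^ 'd) ^ 'n"
    by (simp add: centered_def linear_diff[OF linear_consensus])
  have zX': "centered X' = z - \<alpha> *\<^sub>R a"
    by (simp add: X'_eq lap.lin_simps cen_cons Ka z_def)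
  have ca: "consensus a = 0" using cons_cen[of a] by (simp add: Ka)
  have cX': "consensus X' = consensus X - \<alpha> *\<^sub>R consensus (grads X)"
    by (simp add: X'_eq linear_diff[OF linear_consensus] linear_add[OF linear_consensus]
        linear_scale[OF linear_consensus] ca)
  have ma: "mean a = 0"
  proof -
    have "real CARD('n) * (norm (mean a))\<^sup>2 = 0" using norm_consensus_mean[of a] by (simp add: ca)
    then show ?thesis by simp
  qed
  have mX': "mean X' = mean X - \<alpha> *\<^sub>R mean (grads X)"
  proof -
    have "mean (consensus (grads X)) = mean (grads X)" by (simp add: mean_def)
    then show ?thesis
      by (simp add: X'_eq linear_diff[OF linear_mean] linear_add[OF linear_mean] linear_scale[OF linear_mean] ma)
  qed
  have uX': "dual X' V' = u + (\<alpha> * \<gamma>) *\<^sub>R L (z + h) + D"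
    by (simp add: dual_def u_def V' LXh D_def g0_def lap.lin_simps algebra_simps)
  have nq: "(norm q)\<^sup>2 \<le> l\<^sup>2 * (norm z)\<^sup>2"
    using grads_lipschitz_sq[of X "consensus X"] by (simp add: q_def g0_def z_def centered_def)
  have nD: "(norm D)\<^sup>2 \<le> l\<^sup>2 * \<alpha>\<^sup>2 / \<gamma>\<^sup>2 * N"
  proof -
    have "(norm (centered (grads (consensus X') - g0)))\<^sup>2 \<le> (norm (grads (consensus X') - g0))\<^sup>2"
      by (rule lap.norm_K_le)
    also have "\<dots> \<le> l\<^sup>2 * (norm (consensus X' - consensus X))\<^sup>2" unfolding g0_def by (rule grads_lipschitz_sq)
    also have "\<dots> = l\<^sup>2 * (\<alpha>\<^sup>2 * N)" by (simp add: cX' N_def power_mult_distrib)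
    finally have "(1 / \<gamma>\<^sup>2) * (norm (centered (grads (consensus X') - g0)))\<^sup>2 \<le> (1 / \<gamma>\<^sup>2) * (l\<^sup>2 * (\<alpha>\<^sup>2 * N))"
      by (intro mult_left_mono) auto
    then show ?thesis by (simp add: D_def power_divide)
  qed
  have cg: "\<beta> = c * \<gamma> - \<gamma>" using g by (simp add: c_def)
  have N0: "0 \<le> N" by (simp add: N_def)
  note Qd = lap.Q_descent[OF Kz Ku KD nq nD N0 alpha(1) steps(6) g steps(5) cg steps(3,7) a_def, of e12]
  have cq: "q - centered q = consensus (grads X - grads (consensus X))"
    by (simp add: centered_def q_def g0_def)
  have obj: "real CARD('n) * F (mean X') \<le> real CARD('n) * F (mean X) - \<alpha> / 2 * N + \<alpha> / 2 * (norm (q - centered q))\<^sup>2 + l * \<alpha>\<^sup>2 / 2 * N"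
    unfolding cq N_def by (rule objective_step[OF mX'])
  have dX: "(norm (X' - X))\<^sup>2 = \<alpha>\<^sup>2 * ((norm a)\<^sup>2 + N)"
  proof -
    have "(norm (a + consensus (grads X)))\<^sup>2 = (norm a)\<^sup>2 + N"
      using lap.norm_split[of "a + consensus (grads X)"] by (simp add: lap.lin_simps cen_cons Ka N_def)
    then show ?thesis by (simp add: X'_eq power_mult_distrib)
  qed
  \<comment> \<open>Young's inequality with weight \<open>e9\<close>: (1 - 2 e9) (1 + e9) = 1 - 2
    e12 and (1 - 2 e9) (1 + 1 / e9) = e10.\<close>
  have comp: "(1 - 2 * e9) * (norm (X' - Xh))\<^sup>2
     \<le> (1 - 2 * e12) * (norm h)\<^sup>2 + e10 * (\<alpha>\<^sup>2 * ((norm a)\<^sup>2 + N))"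
  proof -
    have "(norm (X' - Xh))\<^sup>2 = (norm (h - (X' - X)))\<^sup>2"
      by (simp add: h_def norm_minus_commute)
    also have "\<dots> \<le> (1 + e9) * (norm h)\<^sup>2 + (1 + 1 / e9) * (norm (X' - X))\<^sup>2"
      by (rule norm_diff_sq_le[OF steps(1)])
    finally have "(1 - 2 * e9) * (norm (X' - Xh))\<^sup>2
       \<le> (1 - 2 * e9) * ((1 + e9) * (norm h)\<^sup>2 + (1 + 1 / e9) * (norm (X' - X))\<^sup>2)"
      using steps(2) by (intro mult_left_mono) auto
    also have "\<dots> = (1 - 2 * e12) * (norm h)\<^sup>2 + e10 * (norm (X' - X))\<^sup>2"
      using steps(1) by (simp add: eps12_def eps10_def field_simps power2_eq_square)
    finally show ?thesis by (simp only: dX)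
  qed
  let ?p1 = "phi1 \<rho>2 l \<beta> \<gamma> - \<alpha> * phi2' \<rho> \<rho>2 l \<beta> \<gamma> e10" and ?p5 = "phi5 \<rho>2 l \<beta> \<gamma> - \<alpha> * phi6 \<rho>2 l \<beta> \<gamma>"
  have "decrease * (norm z)\<^sup>2 \<le> \<alpha> * ?p1 * (norm z)\<^sup>2" "decrease * N \<le> \<alpha> * ?p5 * N"
    using alpha N0 by (auto simp: decrease_def intro!: mult_right_mono mult_left_mono)
  moreover have "0 \<le> \<alpha> * (phi3 \<rho>2 \<gamma> - \<alpha> * phi4' \<rho> \<gamma> e10) * inner u (lap.P u)"
    using alpha steps(9) lap.psdP by (intro mult_nonneg_nonneg) auto
  moreover have "0 \<le> (2 * e12 - \<alpha> * phi7 \<rho> \<beta> \<gamma> - \<alpha>\<^sup>2 * phi8' \<rho> \<rho>2 \<beta> \<gamma> e10) * (norm h)\<^sup>2"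
    using steps(11) by (intro mult_nonneg_nonneg) auto
  moreover have "lyap X' V' - lyap X V = lap.Q c (z - \<alpha> *\<^sub>R a) (u + (\<alpha> * \<gamma>) *\<^sub>R L (z + h) + D) - lap.Q c z u
     + (real CARD('n) * F (mean X') - real CARD('n) * F (mean X))"
    unfolding lyap_def uX' zX' c_def[symmetric] z_def[symmetric] u_def[symmetric] by (simp add: algebra_simps)
  moreover have "decrease * stationarity X = decrease * (norm z)\<^sup>2 + decrease * N"
    by (simp add: stationarity_def z_def N_def distrib_left)
  moreover have "(norm (X - Xh))\<^sup>2 = (norm h)\<^sup>2" by (simp add: h_def norm_minus_commute)
  moreover have "(1 - 2 * e12) * (norm h)\<^sup>2 = (norm h)\<^sup>2 - 2 * e12 * (norm h)\<^sup>2" by (simp add: algebra_simps)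
  ultimately show ?thesis using Qd obj comp by (simp only: minus_mult_left[symmetric])
qed

text \<open>The gradient at the mean differs from the averaged local gradients by a Lipschitz
  multiple of the disagreement; 3 + 2 l^2 dominates both the factor 2 of the gradients and the 1 + 2
  l^2 of the disagreement.\<close>

lemma residual_le_stationarity:
  "(norm (gradient F (mean X)))\<^sup>2 + average (\<lambda>i. (norm (X $ i - mean X))\<^sup>2)
    \<le> (3 + 2 * l\<^sup>2) / real CARD('n) * stationarity X"
proof -
  let ?M = "(norm (consensus (grads (consensus X))))\<^sup>2" and ?N = "(norm (consensus (grads X)))\<^sup>2"
  let ?q = "grads X - grads (consensus X)"
  have "(norm (consensus ?q))\<^sup>2 \<le> l\<^sup>2 * (norm (centered X))\<^sup>2"
  proof -
    have "(norm (consensus ?q))\<^sup>2 \<le> (norm ?q)\<^sup>2" using lap.norm_split[of ?q] by (simp add: centered_def)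
    also have "\<dots> \<le> l\<^sup>2 * (norm (X - consensus X))\<^sup>2" by (rule grads_lipschitz_sq)
    finally show ?thesis by (simp add: centered_def)
  qed
  moreover have "?M \<le> 2 * ?N + 2 * (norm (consensus ?q))\<^sup>2"
    using norm_diff_sq_le[of 1 "consensus (grads X)" "consensus ?q"] by (simp add: linear_diff[OF linear_consensus])
  moreover have "real CARD('n) * (norm (gradient F (mean X)))\<^sup>2 = ?M"
    by (simp add: gradient_F_mean norm_consensus_mean)
  moreover have "real CARD('n) * average (\<lambda>i. (norm (X $ i - mean X))\<^sup>2) = (norm (centered X))\<^sup>2"
    by (simp add: norm_sq_vec average_def centered_def consensus_def mean_def)
  ultimately have "real CARD('n) * ((norm (gradient F (mean X)))\<^sup>2 + average (\<lambda>i. (norm (X $ i - mean X))\<^sup>2))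
     \<le> 2 * ?N + 2 * (l\<^sup>2 * (norm (centered X))\<^sup>2) + (norm (centered X))\<^sup>2" by (simp add: distrib_left)
  also have "\<dots> \<le> (3 + 2 * l\<^sup>2) * stationarity X"
    by (simp add: stationarity_def algebra_simps)
  finally show ?thesis by (simp add: field_simps)
qed

end

section \<open>Expected Lyapunov descent\<close>

locale stochastic_unified_compression = unified_compression A f F l \<rho> \<rho>2 r \<delta> \<alpha> \<beta> \<gamma> \<omega> \<tau>1
  for A :: "real ^ 'n ^ 'n" and f :: "'n \<Rightarrow> real ^ 'd \<Rightarrow> real" and F l \<rho> \<rho>2 r \<delta> \<alpha> \<beta> \<gamma> \<omega> \<tau>1 +
  fixes M :: "'w measure"
    and D :: "'s measure"
    and Cmp :: "'s \<Rightarrow> real ^ 'd \<Rightarrow> real ^ 'd"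
    and \<xi> :: "'n \<Rightarrow> nat \<Rightarrow> 'w \<Rightarrow> 's"
    and x v xh y q :: "'n \<Rightarrow> nat \<Rightarrow> 'w \<Rightarrow> real ^ 'd"
    and x0 :: "'n \<Rightarrow> real ^ 'd"
    and s :: "nat \<Rightarrow> real"
    and C \<epsilon> s0 :: real
  assumes C_pos: "0 < C"
    and compressor: "globally_bounded_compressor D Cmp r \<delta> C"
    and prob: "prob_space M"
    and seeds: "compressor_seeds M D \<xi>"
    and run: "\<And>w. w \<in> space M \<Longrightarrow>
      unified_compression_run (laplacian A) (\<lambda>i. gradient (f i)) \<alpha> \<beta> \<gamma> \<omega> s
        (\<lambda>i k. Cmp (\<xi> i k w)) x0
        (\<lambda>i k. x i k w) (\<lambda>i k. v i k w) (\<lambda>i k. xh i k w) (\<lambda>i k. y i k w) (\<lambda>i k. q i k w)"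
    and s0: "0 < s0"
    and eps: "0 < \<epsilon>" "\<epsilon> < 1"
    and s_def: "\<And>k. s k = s0 * \<epsilon> ^ k"
begin

sublocale M: prob_space M by (rule prob)

lemma s_pos: "0 < s k" using s0 eps by (simp add: s_def)

section \<open>The run in stacked form\<close>

abbreviation pxh :: "'n \<Rightarrow> nat \<Rightarrow> 'w \<Rightarrow> real ^ 'd" where "pxh i k w \<equiv> prev (\<lambda>m. xh i m w) k"
abbreviation py :: "'n \<Rightarrow> nat \<Rightarrow> 'w \<Rightarrow> real ^ 'd" where "py i k w \<equiv> prev (\<lambda>m. y i m w) k"

lemma run_eqs:
  assumes "w \<in> space M"
  shows "x i 0 w = x0 i" "v i 0 w = 0"
    "q i k w = Cmp (\<xi> i k w) ((1 / s k) *\<^sub>R (x i k w - pxh i k w))"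
    "xh i k w = pxh i k w + (\<omega> * s k) *\<^sub>R q i k w"
    "y i k w = py i k w + (\<omega> * s k) *\<^sub>R (\<Sum>j\<in>UNIV. laplacian A $ i $ j *\<^sub>R q j k w)"
    "x i (Suc k) w = x i k w - \<alpha> *\<^sub>R (\<beta> *\<^sub>R y i k w + \<gamma> *\<^sub>R v i k w + gradient (f i) (x i k w))"
    "v i (Suc k) w = v i k w + (\<alpha> * \<gamma>) *\<^sub>R y i k w"
  using run[OF assms] unfolding unified_compression_run_def by blast+

definition X :: "nat \<Rightarrow> 'w \<Rightarrow> (real ^ 'd) ^ 'n" where "X k w = (\<chi> i. x i k w)"
definition V :: "nat \<Rightarrow> 'w \<Rightarrow> (real ^ 'd) ^ 'n" where "V k w = (\<chi> i. v i k w)"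
definition Xh :: "nat \<Rightarrow> 'w \<Rightarrow> (real ^ 'd) ^ 'n" where "Xh k w = (\<chi> i. xh i k w)"
text \<open>\<open>pXh k\<close> is the estimate before the compression step of iteration \<open>k\<close>.\<close>

definition pXh :: "nat \<Rightarrow> 'w \<Rightarrow> (real ^ 'd) ^ 'n" where "pXh k w = (\<chi> i. pxh i k w)"

lemma pXh_simps [simp]: "pXh 0 w = 0" "pXh (Suc k) w = Xh k w"
  by (simp_all add: pXh_def Xh_def prev_def vec_eq_iff)

text \<open>\<open>y\<close> accumulates the Laplacian of the same increments that \<open>xh\<close>
  accumulates, and both start from 0. This makes the run an inexact primal-dual gradient
  method.\<close>

lemma y_eq: "w \<in> space M \<Longrightarrow> y i k w = L (Xh k w) $ i"
proof (induction k arbitrary: i)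
  case 0
  then show ?case
    by (simp add: run_eqs(5)[OF 0, of i 0] run_eqs(4)[OF 0, of _ 0] stack_mult_def Xh_def prev_def scaleR_sum_right mult.commute)
next
  case (Suc k)
  have "y i (Suc k) w = L (Xh k w) $ i + (\<omega> * s (Suc k)) *\<^sub>R (\<Sum>j\<in>UNIV. laplacian A $ i $ j *\<^sub>R q j (Suc k) w)"
    using Suc by (simp add: run_eqs(5)[OF Suc.prems, of i "Suc k"] prev_def)
  also have "\<dots> = L (Xh (Suc k) w) $ i"
    by (simp add: stack_mult_def Xh_def run_eqs(4)[OF Suc.prems, of _ "Suc k"] prev_def
        scaleR_sum_right scaleR_right_distrib sum.distrib mult.commute)
  finally show ?case .
qed

lemma X_Suc: "w \<in> space M \<Longrightarrow> X (Suc k) w = X k w - \<alpha> *\<^sub>R (\<beta> *\<^sub>R L (Xh k w) + \<gamma> *\<^sub>R V k w + grads (X k w))"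
  by (simp add: X_def V_def grads_def vec_eq_iff run_eqs(6) y_eq)

lemma V_Suc: "w \<in> space M \<Longrightarrow> V (Suc k) w = V k w + (\<alpha> * \<gamma>) *\<^sub>R L (Xh k w)"
  by (simp add: V_def vec_eq_iff run_eqs(7) y_eq)

lemma X_0: "w \<in> space M \<Longrightarrow> X 0 w = (\<chi> i. x0 i)" and V_0: "w \<in> space M \<Longrightarrow> V 0 w = 0"
  by (simp_all add: X_def V_def vec_eq_iff run_eqs(1,2))

text \<open>Starting from 0, \<open>V\<close> moves only within the range of the Laplacian; this
  makes \<open>dual\<close> a centered vector.\<close>

lemma consensus_V: "w \<in> space M \<Longrightarrow> consensus (V k w) = 0"
  by (induction k) (simp_all add: V_0 V_Suc linear_0[OF linear_consensus] linear_add[OF linear_consensus]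
      linear_scale[OF linear_consensus] consensus_laplacian[OF und])

section \<open>Dependence of the iterates on past seeds\<close>

definition past :: "nat \<Rightarrow> 'w measure" where
  "past k = sigma (space M) {\<xi> j m -` S \<inter> space M | j m S. m < k \<and> S \<in> sets D}"

lemma space_past [simp]: "space (past k) = space M" by (simp add: past_def space_measure_of_conv)

lemma sets_past: "sets (past k) = past_events M D \<xi> k"
  unfolding past_def past_events_def by (rule sets_measure_of) auto

lemma seed_measurable: "\<xi> i k \<in> measurable M D"
  using seeds by (simp add: compressor_seeds_def)

lemma past_mono: "subalgebra (past (Suc k)) (past k)"
proof -
  have "sets (past k) \<subseteq> sets (past (Suc k))"
    unfolding sets_past past_events_def by (rule sigma_sets_mono') (use less_SucI in blast)
  then show ?thesis by (simp add: subalgebra_def)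
qed

lemma seed_past: "\<xi> i k \<in> measurable (past (Suc k)) D"
proof (rule measurableI)
  show "\<xi> i k w \<in> space D" if "w \<in> space (past (Suc k))" for w
    using that seed_measurable by (auto dest: measurable_space)
  show "\<xi> i k -` S \<inter> space (past (Suc k)) \<in> sets (past (Suc k))" if "S \<in> sets D" for S
    unfolding sets_past past_events_def using that by (intro sigma_sets.Basic) auto
qed

lemma gradient_measurable: "gradient (f i) \<in> borel_measurable borel"
proof (rule borel_measurable_continuous_onI)
  have "l-lipschitz_on UNIV (gradient (f i))"
    using l_pos smooth by (auto intro!: lipschitz_onI simp: dist_norm)
  then show "continuous_on UNIV (gradient (f i))" by (rule lipschitz_on_continuous_on)
qed

lemma compressor_measurable: "(\<lambda>(\<zeta>, x). Cmp \<zeta> x) \<in> borel_measurable (D \<Otimes>\<^sub>M borel)"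
  using compressor by (simp add: globally_bounded_compressor_def)

text \<open>Adaptedness: before the compressor calls of iteration \<open>k\<close>, only seeds of
  iterations below \<open>k\<close> have been used. The shifted \<open>pxh\<close> and
  \<open>py\<close> are needed because \<open>xh\<close> and \<open>y\<close> at index
  \<open>k\<close> already involve the seeds of iteration \<open>k\<close>.\<close>

lemma past_measurable:
  "x i k \<in> borel_measurable (past k) \<and> v i k \<in> borel_measurable (past k) \<and>
   pxh i k \<in> borel_measurable (past k) \<and> py i k \<in> borel_measurable (past k)"
proof (induction k arbitrary: i)
  case 0
  have "x i 0 \<in> borel_measurable (past 0)"
    by (subst measurable_cong[of _ _ "\<lambda>_. x0 i"]) (simp_all add: run_eqs(1))
  moreover have "v i 0 \<in> borel_measurable (past 0)"
    by (subst measurable_cong[of _ _ "\<lambda>_. 0"]) (simp_all add: run_eqs(2))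
  ultimately show ?case by (simp add: prev_def)
next
  case (Suc k)
  let ?N = "past (Suc k)"
  note up = measurable_from_subalg[OF past_mono]
  have m [measurable]: "x j k \<in> borel_measurable ?N" "v j k \<in> borel_measurable ?N"
    "pxh j k \<in> borel_measurable ?N" "py j k \<in> borel_measurable ?N" for j
    using Suc.IH[of j] by (blast intro: up)+
  have "(\<lambda>w. Cmp (\<xi> j k w) ((1 / s k) *\<^sub>R (x j k w - pxh j k w))) \<in> borel_measurable ?N" for j
  proof -
    have "(\<lambda>w. (\<xi> j k w, (1 / s k) *\<^sub>R (x j k w - pxh j k w))) \<in> measurable ?N (D \<Otimes>\<^sub>M borel)"
      using seed_past by measurable
    from measurable_compose[OF this compressor_measurable] show ?thesis by simp
  qed
  then have q [measurable]: "q j k \<in> borel_measurable ?N" for j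
    by (subst measurable_cong[OF run_eqs(3)]) simp_all
  have xh: "xh i k \<in> borel_measurable ?N"
  proof (subst measurable_cong[OF run_eqs(4)])
    show "(\<lambda>w. pxh i k w + (\<omega> * s k) *\<^sub>R q i k w) \<in> borel_measurable ?N" by measurable
  qed simp
  have y [measurable]: "y i k \<in> borel_measurable ?N"
  proof (subst measurable_cong[OF run_eqs(5)])
    show "(\<lambda>w. py i k w + (\<omega> * s k) *\<^sub>R (\<Sum>j\<in>UNIV. laplacian A $ i $ j *\<^sub>R q j k w)) \<in> borel_measurable ?N"
      by measurable
  qed simp
  have g [measurable]: "(\<lambda>w. gradient (f i) (x i k w)) \<in> borel_measurable ?N"
    using measurable_compose[OF m(1) gradient_measurable] .
  have "x i (Suc k) \<in> borel_measurable ?N"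
  proof (subst measurable_cong[OF run_eqs(6)])
    show "(\<lambda>w. x i k w - \<alpha> *\<^sub>R (\<beta> *\<^sub>R y i k w + \<gamma> *\<^sub>R v i k w + gradient (f i) (x i k w))) \<in> borel_measurable ?N"
      by measurable
  qed simp
  moreover have "v i (Suc k) \<in> borel_measurable ?N"
  proof (subst measurable_cong[OF run_eqs(7)])
    show "(\<lambda>w. v i k w + (\<alpha> * \<gamma>) *\<^sub>R y i k w) \<in> borel_measurable ?N" by measurable
  qed simp
  ultimately show ?case using xh y by (simp add: prev_def)
qed

lemma seed_indep:
  assumes "z \<in> borel_measurable (past k)"
  shows "M.indep_set {\<xi> i k -` S \<inter> space M | S. S \<in> sets D} {z -` B \<inter> space M | B. B \<in> sets (borel :: (real ^ 'd) measure)}"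
proof -
  have "{z -` B \<inter> space M | B. B \<in> sets borel} \<subseteq> past_events M D \<xi> k"
    using assms by (auto simp flip: sets_past dest: measurable_sets)
  moreover have "M.indep_set {\<xi> i k -` S \<inter> space M | S. S \<in> sets D} (past_events M D \<xi> k)"
    using seeds by (simp add: compressor_seeds_def)
  ultimately show ?thesis
    unfolding M.indep_set_def
    by (elim M.indep_sets_mono_sets) (auto split: bool.splits)
qed

lemma compression:
  assumes "sq_integrable M (\<lambda>w. x i k w - pxh i k w)"
  shows "sq_integrable M (\<lambda>w. x i k w - xh i k w)"
    and "(\<integral>w. (norm (x i k w - xh i k w))\<^sup>2 \<partial>M)
      \<le> (1 - 2 * e9) * (\<integral>w. (norm (x i k w - pxh i k w))\<^sup>2 \<partial>M) + \<omega> * r * C * (s k)\<^sup>2"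
proof -
  let ?e = "\<lambda>w. x i k w - pxh i k w"
  have "(\<lambda>w. (1 / s k) *\<^sub>R ?e w) \<in> borel_measurable (past k)"
  proof -
    have [measurable]: "x i k \<in> borel_measurable (past k)" "pxh i k \<in> borel_measurable (past k)"
      using past_measurable[of i k] by blast+
    show ?thesis by measurable
  qed
  note ind = seed_indep[OF this, of i]
  have dist: "distr M D (\<xi> i k) = D" using seeds by (simp add: compressor_seeds_def)
  note c = compression_error_contraction[OF compressor prob seed_measurable dist ind assms delta(2)
      less_imp_le[OF C_pos] r_pos omega s_pos]
  have eq: "x i k w - xh i k w = ?e w - (\<omega> * s k) *\<^sub>R Cmp (\<xi> i k w) ((1 / s k) *\<^sub>R ?e w)"
    if "w \<in> space M" for w
    by (simp add: run_eqs(3)[OF that, of i k] run_eqs(4)[OF that, of i k])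
  show "sq_integrable M (\<lambda>w. x i k w - xh i k w)"
    using c(1) by (subst sq_integrable_cong[OF eq])
  have "(\<integral>w. (norm (x i k w - xh i k w))\<^sup>2 \<partial>M)
    = (\<integral>w. (norm (?e w - (\<omega> * s k) *\<^sub>R Cmp (\<xi> i k w) ((1 / s k) *\<^sub>R ?e w)))\<^sup>2 \<partial>M)"
    by (rule Bochner_Integration.integral_cong) (simp_all add: eq)
  then show "(\<integral>w. (norm (x i k w - xh i k w))\<^sup>2 \<partial>M)
      \<le> (1 - 2 * e9) * (\<integral>w. (norm (?e w))\<^sup>2 \<partial>M) + \<omega> * r * C * (s k)\<^sup>2"
    using c(2) by (simp add: eps9_def)
qed

text \<open>The squared norm is a sum over agents, so the individual bounds add up and dependence
  between seeds of one iteration is harmless.\<close>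

lemma compression_stacked:
  assumes "sq_integrable M (X k)" "sq_integrable M (pXh k)"
  shows "sq_integrable M (Xh k)"
    and "(\<integral>w. (norm (X k w - Xh k w))\<^sup>2 \<partial>M)
      \<le> (1 - 2 * e9) * (\<integral>w. (norm (X k w - pXh k w))\<^sup>2 \<partial>M) + real CARD('n) * \<omega> * r * C * (s k)\<^sup>2"
proof -
  have xi: "sq_integrable M (\<lambda>w. x i k w)" "sq_integrable M (\<lambda>w. pxh i k w)" for i
    using sq_integrable_linear[OF linear_vec_nth[of i] assms(1)]
      sq_integrable_linear[OF linear_vec_nth[of i] assms(2)]
    by (simp_all add: X_def pXh_def)
  note e = sq_integrable_diff[OF xi]
  note c = compression[OF e]
  have "sq_integrable M (\<lambda>w. xh i k w)" for i
    using sq_integrable_diff[OF xi(1)[of i] c(1)[of i]] by simp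
  then show "sq_integrable M (Xh k)" by (intro sq_integrable_vec) (simp add: Xh_def)
  have "(\<integral>w. (norm (X k w - Xh k w))\<^sup>2 \<partial>M) = (\<Sum>i\<in>UNIV. \<integral>w. (norm (x i k w - xh i k w))\<^sup>2 \<partial>M)"
    using c(1) by (simp add: norm_sq_vec X_def Xh_def sq_integrable_def)
  also have "\<dots> \<le> (\<Sum>i\<in>UNIV. (1 - 2 * e9) * (\<integral>w. (norm (x i k w - pxh i k w))\<^sup>2 \<partial>M) + \<omega> * r * C * (s k)\<^sup>2)"
    by (rule sum_mono) (rule c(2))
  also have "\<dots> = (1 - 2 * e9) * (\<Sum>i\<in>UNIV. \<integral>w. (norm (x i k w - pxh i k w))\<^sup>2 \<partial>M) + real CARD('n) * \<omega> * r * C * (s k)\<^sup>2"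
    by (simp add: sum.distrib sum_distrib_left)
  also have "(\<Sum>i\<in>UNIV. \<integral>w. (norm (x i k w - pxh i k w))\<^sup>2 \<partial>M) = (\<integral>w. (norm (X k w - pXh k w))\<^sup>2 \<partial>M)"
    using e by (simp add: norm_sq_vec X_def pXh_def sq_integrable_def)
  finally show "(\<integral>w. (norm (X k w - Xh k w))\<^sup>2 \<partial>M)
      \<le> (1 - 2 * e9) * (\<integral>w. (norm (X k w - pXh k w))\<^sup>2 \<partial>M) + real CARD('n) * \<omega> * r * C * (s k)\<^sup>2" .
qed

text \<open>The estimate from the previous iteration is part of the induction because the compressor
  bound presupposes a square integrable argument.\<close>

lemma sq_integrable_iterates:
  "sq_integrable M (X k) \<and> sq_integrable M (V k) \<and> sq_integrable M (pXh k)"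
proof (induction k)
  case 0
  note c = sq_integrable_const[OF M.finite_measure_axioms]
  have "sq_integrable M (X 0)" by (subst sq_integrable_cong[OF X_0]) (simp_all add: c)
  moreover have "sq_integrable M (V 0)" by (subst sq_integrable_cong[OF V_0]) (simp_all add: c)
  moreover have "sq_integrable M (pXh 0)" by (subst sq_integrable_cong[of M _ "\<lambda>_. 0"]) (simp_all add: c)
  ultimately show ?case by blast
next
  case (Suc k)
  then have X: "sq_integrable M (X k)" and V: "sq_integrable M (V k)" and P: "sq_integrable M (pXh k)" by auto
  note Xh = compression_stacked(1)[OF X P]
  note LXh = sq_integrable_linear[OF lap.linL Xh]
  note g = sq_integrable_lipschitz[OF M.finite_measure_axioms X grads_lipschitz]
  have "sq_integrable M (X (Suc k))"
    by (subst sq_integrable_cong[OF X_Suc], assumption)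
      (intro sq_integrable_diff sq_integrable_add sq_integrable_scaleR X V LXh g)
  moreover have "sq_integrable M (V (Suc k))"
    by (subst sq_integrable_cong[OF V_Suc], assumption)
      (intro sq_integrable_add sq_integrable_scaleR V LXh)
  moreover have "sq_integrable M (pXh (Suc k))"
    using Xh by (subst sq_integrable_cong[of M _ "Xh k"]) simp_all
  ultimately show ?case by blast
qed

lemmas sq_X = sq_integrable_iterates[THEN conjunct1]
  and sq_V = sq_integrable_iterates[THEN conjunct2, THEN conjunct1]
  and sq_pXh = sq_integrable_iterates[THEN conjunct2, THEN conjunct2]
lemmas sq_Xh = compression_stacked(1)[OF sq_X sq_pXh]

lemma sq_grads: "sq_integrable M Z \<Longrightarrow> sq_integrable M (\<lambda>w. grads (Z w))"
  by (rule sq_integrable_lipschitz[OF M.finite_measure_axioms _ grads_lipschitz])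

text \<open>The gap is squeezed between 0 and the quadratic model of \<open>F\<close> at the
  origin.\<close>

lemma integrable_objective_gap:
  assumes Z: "sq_integrable M Z"
  shows "integrable M (\<lambda>w. F (Z w) - Finf)"
proof (rule Bochner_Integration.integrable_bound)
  let ?g = "\<lambda>w. F 0 + inner (gradient F 0) (Z w) + l / 2 * (norm (Z w))\<^sup>2 - Finf"
  show "integrable M ?g"
    using integrable_inner_sq_integrable[OF sq_integrable_const[OF M.finite_measure_axioms, of "gradient F 0"] Z] Z
    by (auto simp: sq_integrable_def)
  have "continuous_on UNIV F"
    using GDERIV_F by (intro continuous_at_imp_continuous_on ballI) (auto simp: gderiv_def dest: has_derivative_continuous)
  then have "F \<in> borel_measurable borel" by (rule borel_measurable_continuous_onI)
  then show "(\<lambda>w. F (Z w) - Finf) \<in> borel_measurable M" using Z by (auto simp: sq_integrable_def)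
  show "AE w in M. norm (F (Z w) - Finf) \<le> norm (?g w)"
  proof (rule AE_I2)
    fix w
    have "F (Z w) \<le> F 0 + inner (gradient F 0) (Z w) + l / 2 * (norm (Z w))\<^sup>2" using F_upper[of "Z w" 0] by simp
    then show "norm (F (Z w) - Finf) \<le> norm (?g w)" using Finf_le[of "Z w"] by simp
  qed
qed

lemma sq_mean: "sq_integrable M (\<lambda>w. mean (X k w))"
  by (rule sq_integrable_linear[OF linear_mean sq_X])

lemma integrable_lyap: "integrable M (\<lambda>w. lyap (X k w) (V k w))"
proof -
  have z: "sq_integrable M (\<lambda>w. centered (X k w))" by (rule sq_integrable_linear[OF lap.linK sq_X])
  have "sq_integrable M (\<lambda>w. consensus (X k w))" by (rule sq_integrable_linear[OF linear_consensus sq_X])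
  from sq_integrable_linear[OF lap.linK sq_grads[OF this]]
  have u: "sq_integrable M (\<lambda>w. dual (X k w) (V k w))"
    unfolding dual_def by (intro sq_integrable_add sq_integrable_scaleR sq_V)
  note Pu = sq_integrable_linear[OF lap.linP u]
  show ?thesis
    unfolding lyap_def lap.Q_def using z integrable_inner_sq_integrable[OF u Pu]
      integrable_inner_sq_integrable[OF z Pu] integrable_objective_gap[OF sq_mean]
    by (auto simp: sq_integrable_def)
qed

lemma integrable_stationarity: "integrable M (\<lambda>w. stationarity (X k w))"
  using sq_integrable_linear[OF lap.linK sq_X[of k]] sq_integrable_linear[OF linear_consensus sq_grads[OF sq_X[of k]]]
  by (simp add: stationarity_def sq_integrable_def)

section \<open>Telescoping the expected potential\<close>

definition potential :: "nat \<Rightarrow> real" where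
  "potential k = (\<integral>w. lyap (X k w) (V k w) \<partial>M) + (\<integral>w. (norm (X k w - Xh k w))\<^sup>2 \<partial>M)"

text \<open>The pathwise step leaves the error of the new point against the old estimate, weighted
  by 1 - 2 * \<open>e9\<close>; the compression in the next iteration bounds the new error by
  exactly this plus noise. Hence the scale with index \<open>Suc k\<close>.\<close>

lemma potential_step:
  "potential (Suc k) \<le> potential k - decrease * (\<integral>w. stationarity (X k w) \<partial>M)
    + real CARD('n) * \<omega> * r * C * (s (Suc k))\<^sup>2"
proof -
  have i1: "integrable M (\<lambda>w. (norm (X (Suc k) w - Xh k w))\<^sup>2)" and i2: "integrable M (\<lambda>w. (norm (X k w - Xh k w))\<^sup>2)"
    using sq_integrable_diff[OF sq_X[of "Suc k"] sq_Xh[of k]] sq_integrable_diff[OF sq_X[of k] sq_Xh[of k]]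
    by (auto simp: sq_integrable_def)
  have "(\<integral>w. lyap (X (Suc k) w) (V (Suc k) w) + (1 - 2 * e9) * (norm (X (Suc k) w - Xh k w))\<^sup>2 \<partial>M)
    \<le> (\<integral>w. lyap (X k w) (V k w) + (norm (X k w - Xh k w))\<^sup>2 - decrease * stationarity (X k w) \<partial>M)"
    using i1 i2 integrable_lyap integrable_stationarity
    by (intro integral_mono Bochner_Integration.integrable_add Bochner_Integration.integrable_diff
        integrable_mult_right lyap_step[OF consensus_V X_Suc V_Suc])
  then have "(\<integral>w. lyap (X (Suc k) w) (V (Suc k) w) \<partial>M) + (1 - 2 * e9) * (\<integral>w. (norm (X (Suc k) w - Xh k w))\<^sup>2 \<partial>M)
    \<le> potential k - decrease * (\<integral>w. stationarity (X k w) \<partial>M)"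
    using i1 i2 integrable_lyap integrable_stationarity by (simp add: potential_def)
  moreover have "(\<integral>w. (norm (X (Suc k) w - Xh (Suc k) w))\<^sup>2 \<partial>M)
      \<le> (1 - 2 * e9) * (\<integral>w. (norm (X (Suc k) w - Xh k w))\<^sup>2 \<partial>M) + real CARD('n) * \<omega> * r * C * (s (Suc k))\<^sup>2"
    using compression_stacked(2)[OF sq_X sq_pXh, of "Suc k"] by simp
  ultimately show ?thesis unfolding potential_def[of "Suc k"] by linarith
qed

definition bound :: real where
  "bound = potential 0 + real CARD('n) * \<omega> * r * C * (s0\<^sup>2 / (1 - \<epsilon>\<^sup>2))"

lemma potential_sum:
  "potential T + decrease * (\<Sum>k<T. \<integral>w. stationarity (X k w) \<partial>M) \<le> bound"
proof -
  define c where "c = real CARD('n) * \<omega> * r * C"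
  have c: "0 \<le> c" using omega r_pos C_pos by (simp add: c_def)
  have "potential T + decrease * (\<Sum>k<T. \<integral>w. stationarity (X k w) \<partial>M) \<le> potential 0 + c * (\<Sum>k<T. (s (Suc k))\<^sup>2)"
  proof (induction T)
    case (Suc T)
    then show ?case using potential_step[of T] by (simp add: c_def algebra_simps)
  qed simp
  moreover have "(\<Sum>k<T. (s (Suc k))\<^sup>2) \<le> s0\<^sup>2 / (1 - \<epsilon>\<^sup>2)"
  proof -
    have e2: "0 \<le> \<epsilon>\<^sup>2" "\<epsilon>\<^sup>2 < 1" using eps by (simp_all add: power_less_one_iff)
    have "(\<Sum>k<T. (s (Suc k))\<^sup>2) \<le> (\<Sum>k<T. s0\<^sup>2 * (\<epsilon>\<^sup>2) ^ k)"
    proof (rule sum_mono)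
      fix k
      \<comment> \<open>The index shift contributes an extra factor below 1, which is discarded to
        get the plain geometric series.\<close>
      have "(s (Suc k))\<^sup>2 = \<epsilon>\<^sup>2 * (s0\<^sup>2 * (\<epsilon>\<^sup>2) ^ k)"
        by (simp add: s_def power_mult_distrib power_mult[symmetric] mult_ac)
      also have "\<dots> \<le> 1 * (s0\<^sup>2 * (\<epsilon>\<^sup>2) ^ k)" using e2 by (intro mult_right_mono) auto
      finally show "(s (Suc k))\<^sup>2 \<le> s0\<^sup>2 * (\<epsilon>\<^sup>2) ^ k" by simp
    qed
    also have "\<dots> = s0\<^sup>2 * (\<Sum>k<T. (\<epsilon>\<^sup>2) ^ k)" by (simp add: sum_distrib_left)
    also have "\<dots> \<le> s0\<^sup>2 * (1 / (1 - \<epsilon>\<^sup>2))"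
    proof (rule mult_left_mono)
      have "(\<Sum>k<T. (\<epsilon>\<^sup>2) ^ k) \<le> (\<Sum>k. (\<epsilon>\<^sup>2) ^ k)"
        using e2 by (intro sum_le_suminf summable_geometric) auto
      also have "\<dots> = 1 / (1 - \<epsilon>\<^sup>2)" using e2 by (intro suminf_geometric) simp
      finally show "(\<Sum>k<T. (\<epsilon>\<^sup>2) ^ k) \<le> 1 / (1 - \<epsilon>\<^sup>2)" .
    qed simp
    finally show ?thesis by simp
  qed
  from mult_left_mono[OF this c] have "c * (\<Sum>k<T. (s (Suc k))\<^sup>2) \<le> c * (s0\<^sup>2 / (1 - \<epsilon>\<^sup>2))" .
  ultimately show ?thesis by (simp add: bound_def c_def)
qed

lemma gap_nonneg: "0 \<le> (\<integral>w. F (mean (X k w)) - Finf \<partial>M)"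
  using Finf_le by (intro Bochner_Integration.integral_nonneg) simp

lemma potential_ge: "real CARD('n) * (\<integral>w. F (mean (X k w)) - Finf \<partial>M) \<le> potential k"
proof -
  have "(\<integral>w. real CARD('n) * (F (mean (X k w)) - Finf) \<partial>M) \<le> (\<integral>w. lyap (X k w) (V k w) \<partial>M)"
    using integrable_objective_gap[OF sq_mean] integrable_lyap lyap_ge
    by (intro integral_mono) auto
  moreover have "0 \<le> (\<integral>w. (norm (X k w - Xh k w))\<^sup>2 \<partial>M)" by simp
  ultimately show ?thesis unfolding potential_def integral_mult_right_zero by linarith
qed

lemma stationarity_nonneg: "0 \<le> (\<integral>w. stationarity (X k w) \<partial>M)"
  by (intro Bochner_Integration.integral_nonneg) (simp add: stationarity_def)

lemma gap_bound: "(\<integral>w. F (mean (X T w)) - Finf \<partial>M) \<le> bound / real CARD('n)"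
proof -
  have "0 \<le> decrease * (\<Sum>k<T. \<integral>w. stationarity (X k w) \<partial>M)"
    using decrease_pos by (intro mult_nonneg_nonneg sum_nonneg stationarity_nonneg) auto
  then have "real CARD('n) * (\<integral>w. F (mean (X T w)) - Finf \<partial>M) \<le> bound"
    using potential_sum[of T] potential_ge[of T] by linarith
  then show ?thesis by (simp add: field_simps)
qed

lemma stationarity_bound: "(\<Sum>k<T. \<integral>w. stationarity (X k w) \<partial>M) \<le> bound / decrease"
proof -
  have "0 \<le> potential T"
    using gap_nonneg[of T] potential_ge[of T] by (meson mult_nonneg_nonneg of_nat_0_le_iff order_trans)
  then show ?thesis using potential_sum[of T] decrease_pos by (simp add: field_simps)
qed

section \<open>Convergence rate\<close>

definition residual :: "nat \<Rightarrow> 'w \<Rightarrow> real" where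
  "residual k w = (norm (gradient F (mean (X k w))))\<^sup>2 + average (\<lambda>i. (norm (x i k w - mean (X k w)))\<^sup>2)"

lemma residual_nonneg: "0 \<le> residual k w"
  by (simp add: residual_def average_def sum_nonneg)

lemma residual_le: "residual k w \<le> (3 + 2 * l\<^sup>2) / real CARD('n) * stationarity (X k w)"
  using residual_le_stationarity[of "X k w"] by (simp add: residual_def X_def)

lemma integrable_residual: "integrable M (residual k)"
proof -
  have "sq_integrable M (\<lambda>w. gradient F (mean (X k w)))"
    by (rule sq_integrable_lipschitz[OF M.finite_measure_axioms sq_mean gradient_F_lipschitz])
  moreover have "sq_integrable M (\<lambda>w. x i k w - mean (X k w))" for i
    using sq_integrable_diff[OF sq_integrable_linear[OF linear_vec_nth[of i] sq_X[of k]] sq_mean[of k]]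
    by (simp add: X_def)
  ultimately show ?thesis
    unfolding residual_def [abs_def] average_def by (auto simp: sq_integrable_def)
qed

lemma residual_sum_bound:
  "(\<Sum>k<T. \<integral>w. residual k w \<partial>M) \<le> (3 + 2 * l\<^sup>2) / real CARD('n) * (bound / decrease)"
proof -
  have "(\<Sum>k<T. \<integral>w. residual k w \<partial>M)
    \<le> (\<Sum>k<T. (3 + 2 * l\<^sup>2) / real CARD('n) * (\<integral>w. stationarity (X k w) \<partial>M))"
  proof (rule sum_mono)
    fix k
    have "(\<integral>w. residual k w \<partial>M) \<le> (\<integral>w. (3 + 2 * l\<^sup>2) / real CARD('n) * stationarity (X k w) \<partial>M)"
      using integrable_residual integrable_stationarity residual_le by (intro integral_mono) auto
    then show "(\<integral>w. residual k w \<partial>M) \<le> (3 + 2 * l\<^sup>2) / real CARD('n) * (\<integral>w. stationarity (X k w) \<partial>M)" by simp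
  qed
  also have "\<dots> = (3 + 2 * l\<^sup>2) / real CARD('n) * (\<Sum>k<T. \<integral>w. stationarity (X k w) \<partial>M)"
    by (simp only: sum_distrib_left)
  also have "\<dots> \<le> (3 + 2 * l\<^sup>2) / real CARD('n) * (bound / decrease)"
    by (intro mult_left_mono stationarity_bound) auto
  finally show ?thesis .
qed

text \<open>Integrability is asserted alongside the rates because the integral of a function that is
  not integrable is 0 by default, which would make the bounds empty.\<close>

lemma convergence_rate:
  "(\<forall>k. integrable M (residual k)) \<and>
   (\<lambda>T. (1 / real T) * (\<Sum>k<T. \<integral>w. residual k w \<partial>M)) \<in> O(\<lambda>T. 1 / real T) \<and>
   (\<forall>T. integrable M (\<lambda>w. F (mean (X T w)) - Finf)) \<and>
   (\<lambda>T. \<integral>w. F (mean (X T w)) - Finf \<partial>M) \<in> O(\<lambda>_. 1)"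
proof (intro conjI allI)
  show "integrable M (residual k)" for k by (rule integrable_residual)
  show "integrable M (\<lambda>w. F (mean (X T w)) - Finf)" for T by (rule integrable_objective_gap[OF sq_mean])
  show "(\<lambda>T. \<integral>w. F (mean (X T w)) - Finf \<partial>M) \<in> O(\<lambda>_. 1)"
    using gap_nonneg gap_bound by (intro bigoI[of _ "bound / real CARD('n)"] always_eventually) auto
  let ?c = "(3 + 2 * l\<^sup>2) / real CARD('n) * (bound / decrease)"
  show "(\<lambda>T. (1 / real T) * (\<Sum>k<T. \<integral>w. residual k w \<partial>M)) \<in> O(\<lambda>T. 1 / real T)"
  \<comment> \<open>The inequality holds for every \<open>T\<close>: at \<open>T = 0\<close> both
    sides are 0, since division by zero yields 0.\<close>
  proof (intro bigoI[of _ ?c] always_eventually allI)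
    fix T
    have "0 \<le> (\<Sum>k<T. \<integral>w. residual k w \<partial>M)"
      using residual_nonneg by (intro sum_nonneg Bochner_Integration.integral_nonneg) auto
    then have "norm ((1 / real T) * (\<Sum>k<T. \<integral>w. residual k w \<partial>M)) = (1 / real T) * (\<Sum>k<T. \<integral>w. residual k w \<partial>M)"
      by simp
    also have "\<dots> \<le> (1 / real T) * ?c" by (intro mult_left_mono residual_sum_bound) auto
    finally show "norm ((1 / real T) * (\<Sum>k<T. \<integral>w. residual k w \<partial>M)) \<le> ?c * norm (1 / real T)"
      by (simp add: mult.commute)
  qed
qed

end

theorem theorem4:
  fixes A :: "real ^ 'n ^ 'n"
    and f :: "'n \<Rightarrow> real ^ 'd \<Rightarrow> real"
    and F :: "real ^ 'd \<Rightarrow> real"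
    and M :: "'w measure"
    and D :: "'s measure"
    and Cmp :: "'s \<Rightarrow> real ^ 'd \<Rightarrow> real ^ 'd"
    and \<xi> :: "'n \<Rightarrow> nat \<Rightarrow> 'w \<Rightarrow> 's"
    and x v xh y q :: "'n \<Rightarrow> nat \<Rightarrow> 'w \<Rightarrow> real ^ 'd"
    and x0 :: "'n \<Rightarrow> real ^ 'd"
    and xbar :: "nat \<Rightarrow> 'w \<Rightarrow> real ^ 'd"
    and s :: "nat \<Rightarrow> real"
    and p :: ennreal
    and l \<rho> \<rho>2 r \<delta> C \<alpha> \<beta> \<gamma> \<omega> \<tau>1 \<epsilon> s0 :: real
  assumes agents: "2 \<le> CARD('n)"
    and graph: "undirected_weights A" "connected_graph A"
    and rho: "\<rho> = spectral_radius (laplacian A)"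
    and rho2: "\<rho>2 = least_pos_eigenvalue (laplacian A)"
    and diff: "\<And>i z. f i differentiable (at z)"
    and l_pos: "0 < l"
    and smooth: "\<And>i z z'. norm (gradient (f i) z - gradient (f i) z') \<le> l * norm (z - z')"
    and F_def: "F = (\<lambda>z. average (\<lambda>i. f i z))"
    and F_bdd: "bdd_below (range F)"
    and params: "0 < r" "0 < C" "0 < \<delta>" "\<delta> \<le> 1"
    and compressor: "globally_bounded_compressor D Cmp r \<delta> C"
    and prob: "prob_space M"
    and seeds: "compressor_seeds M D \<xi>"
    and run: "\<And>w. w \<in> space M \<Longrightarrow>
      unified_compression_run (laplacian A) (\<lambda>i. gradient (f i)) \<alpha> \<beta> \<gamma> \<omega> s
        (\<lambda>i k. Cmp (\<xi> i k w)) x0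
        (\<lambda>i k. x i k w) (\<lambda>i k. v i k w) (\<lambda>i k. xh i k w) (\<lambda>i k. y i k w) (\<lambda>i k. q i k w)"
    and xbar_def: "xbar = (\<lambda>k w. average (\<lambda>i. x i k w))"
    and alpha: "0 < \<alpha>" "\<alpha> < hat_kappa0' \<rho> \<rho>2 l \<beta> \<gamma> \<omega> r \<delta>"
    and tau1: "kappa1 \<rho>2 \<le> \<tau>1"
    and beta: "\<beta> = \<tau>1 * \<gamma>"
    and gamma: "kappa2 \<rho>2 l < \<gamma>"
    and omega: "0 < \<omega>" "\<omega> \<le> 1 / r"
    and p_ge_1: "1 \<le> p"
    and s0: "0 < s0" "(MAX i. lp_norm p (x0 i)) \<le> s0"
    and eps: "0 < \<epsilon>" "\<epsilon> < 1"
    and s_def: "\<And>k. s k = s0 * \<epsilon> ^ k"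
  shows "(\<forall>k. integrable M (\<lambda>w. (norm (gradient F (xbar k w)))\<^sup>2
                  + average (\<lambda>i. (norm (x i k w - xbar k w))\<^sup>2))) \<and>
         (\<lambda>T. (1 / real T) * (\<Sum>k<T. \<integral>w. (norm (gradient F (xbar k w)))\<^sup>2
                  + average (\<lambda>i. (norm (x i k w - xbar k w))\<^sup>2) \<partial>M))
           \<in> O(\<lambda>T. 1 / real T) \<and>
         (\<forall>T. integrable M (\<lambda>w. F (xbar T w) - (INF z. F z))) \<and>
         (\<lambda>T. \<integral>w. F (xbar T w) - (INF z. F z) \<partial>M) \<in> O(\<lambda>_. 1)"
proof -
  interpret stochastic_unified_compression A f F l \<rho> \<rho>2 r \<delta> \<alpha> \<beta> \<gamma> \<omega> \<tau>1 M D Cmp \<xi> x v xh y q x0 s C \<epsilon> s0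
    by (intro stochastic_unified_compression.intro unified_compression.intro
        stochastic_unified_compression_axioms.intro) (fact assms)+
  have "xbar k w = mean (X k w)" for k w by (simp add: xbar_def mean_def X_def)
  then show ?thesis using convergence_rate unfolding residual_def [abs_def] by simp
qed

end
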